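(* Let $\hat\tau$ be the marginal maximum likelihood estimator of the horseshoe parameter (defined in the context). Let $b$ be a fixed real number, let $\delta>0$ be arbitrary, let $C^*=(2/\pi)^{3/2}$ and $\zeta_{s_n/n}=\sqrt{2\log(n/s_n)}$. Then, as $n,s_n\to\infty$ with $s_n/n\to0$, \[ \sup_{\theta_0\in\mathcal{L}_{0,=}[s_n;b]}P_{\theta_0}\left(\hat\tau(X)\notin\left[\frac{s_n}{n}\zeta_{s_n/n}\frac{\Phi(b-\delta)}{C^*}(1+o(1))\,,\ \frac{s_n}{n}\zeta_{s_n/n}\frac{\Phi(b+\delta)}{C^*}(1+o(1))\right]\right)=o(1), \] where the $o(1)$ terms inside the interval are deterministic sequences tending to $0$ (not depending on $\theta_0$).
   Context: Model: $X=(X_1,\dots,X_n)$ with $X_i=\theta_i+\varepsilon_i$, $\varepsilon_i$ i.i.d. $\mathcal N(0,1)$, $\theta\in\mathbb R^n$; $P_\theta$ is the law of $X$. $\phi,\Phi$ are the standard normal density and cumulative distribution function. Sparse class: $1\le s_n\le n$ integers, $S_\theta=\{i:\theta_i\ne0\}$, $\mathcal{L}_{0,=}[s_n;b]=\{\theta\in\mathbb R^n: |S_\theta|=s_n,\ |\theta_i|=\sqrt{2\log(n/s_n)}+b\text{ for all }i\in S_\theta\}$. Horseshoe density $h_\tau$ ($\tau>0$): Lebesgue density of the law of $\theta_1$ when $\theta_1\mid\lambda\sim\mathcal N(0,\lambda^2\tau^2)$ and $\lambda$ is standard half-Cauchy (density $\frac{2}{\pi(1+\lambda^2)}$ on $(0,\infty)$).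 $\hat\tau=\hat\tau(X)=\operatorname{argmax}_{\tau\in[1/n,1]}\prod_{i=1}^n\int\phi(X_i-\theta)h_\tau(\theta)\,d\theta$. *)

theory Defs
  imports "HOL-Probability.Probability"
begin

(* Elements of R^n are the extensional functions on {..<n}, indexed from 0. *)
definition sample_law :: "nat \<Rightarrow> (nat \<Rightarrow> real) \<Rightarrow> (nat \<Rightarrow> real) measure" where
  "sample_law n \<theta> =
     distr (PiM {..<n} (\<lambda>_. std_normal_distribution)) (PiM {..<n} (\<lambda>_. borel))
       (\<lambda>\<epsilon>. \<lambda>i\<in>{..<n}. \<theta> i + \<epsilon> i)"

definition support :: "nat \<Rightarrow> (nat \<Rightarrow> real) \<Rightarrow> nat set" where
  "support n \<theta> = {i \<in> {..<n}. \<theta> i \<noteq> 0}"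

definition zeta :: "nat \<Rightarrow> nat \<Rightarrow> real" where
  "zeta n s = sqrt (2 * ln (real n / real s))"

definition sparse_class :: "nat \<Rightarrow> nat \<Rightarrow> real \<Rightarrow> (nat \<Rightarrow> real) set" where
  "sparse_class n s b =
     {\<theta> \<in> {..<n} \<rightarrow>\<^sub>E UNIV. card (support n \<theta>) = s \<and> (\<forall>i\<in>support n \<theta>. \<bar>\<theta> i\<bar> = zeta n s + b)}"

definition half_cauchy :: "real measure" where
  "half_cauchy =
     density lborel (\<lambda>l. ennreal (indicator {0<..} l * (2 / (pi * (1 + l\<^sup>2)))))"

(* The second parameter of normal_density is the standard deviation. *)
definition horseshoe_law :: "real \<Rightarrow> real measure" where
  "horseshoe_law \<tau> = bind half_cauchy (\<lambda>l. density lborel (normal_density 0 (l * \<tau>)))"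

definition horseshoe_density :: "real \<Rightarrow> real \<Rightarrow> real" where
  "horseshoe_density \<tau> t = enn2real (RN_deriv lborel (horseshoe_law \<tau>) t)"

definition marginal_likelihood :: "nat \<Rightarrow> (nat \<Rightarrow> real) \<Rightarrow> real \<Rightarrow> real" where
  "marginal_likelihood n x \<tau> =
     (\<Prod>i<n. LBINT t. std_normal_density (x i - t) * horseshoe_density \<tau> t)"

(* The maximiser over [1/n, 1] is not assumed to be unique: an MMLE is any measurable choice of one. *)
definition is_mmle :: "nat \<Rightarrow> ((nat \<Rightarrow> real) \<Rightarrow> real) \<Rightarrow> bool" where
  "is_mmle n T \<longleftrightarrow>
     T \<in> borel_measurable (PiM {..<n} (\<lambda>_. borel)) \<and>
     (\<forall>x\<in>space (PiM {..<n} (\<lambda>_. borel)).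
        is_arg_max (marginal_likelihood n x) (\<lambda>\<tau>. \<tau> \<in> {1 / real n..1}) (T x))"

definition C_star :: real where
  "C_star = (2 / pi) powr (3 / 2)"

lemma prob_space_sample_law: "prob_space (sample_law n \<theta>)"
proof -
  have N: "prob_space std_normal_distribution"
    by (rule prob_space_normal_density) simp
  have P: "prob_space (PiM {..<n} (\<lambda>_. std_normal_distribution))"
    by (rule prob_space_PiM) (rule N)
  have "(\<lambda>\<epsilon>. \<lambda>i\<in>{..<n}. \<theta> i + \<epsilon> i)
      \<in> PiM {..<n} (\<lambda>_. std_normal_distribution) \<rightarrow>\<^sub>M PiM {..<n} (\<lambda>_. borel)"
    by measurable
  then show ?thesis
    unfolding sample_law_def by (rule prob_space.prob_space_distr[OF P])
qed

lemma half_cauchy_nn_integral: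
  "(\<integral>\<^sup>+ l. ennreal (indicator {0<..} l * (2 / (pi * (1 + l\<^sup>2)))) \<partial>lborel) = 1"
proof -
  have "(\<integral>\<^sup>+ l. ennreal (2 / (pi * (1 + l\<^sup>2))) * indicator {0..} l \<partial>lborel) = ennreal (1 - 2 / pi * arctan 0)"
  proof (rule nn_integral_FTC_atLeast)
    fix x :: real
    show "((\<lambda>x. 2 / pi * arctan x) has_real_derivative 2 / (pi * (1 + x\<^sup>2))) (at x)"
      by (rule DERIV_cong[OF DERIV_cmult[OF DERIV_arctan]]) (simp add: divide_inverse)
  next
    have "((\<lambda>x. 2 / pi * arctan x) \<longlongrightarrow> 2 / pi * (pi / 2)) at_top"
      by (intro tendsto_intros tendsto_arctan_at_top)
    then show "((\<lambda>x. 2 / pi * arctan x) \<longlongrightarrow> 1) at_top" by simp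
  qed auto
  moreover have "(\<integral>\<^sup>+ l. ennreal (indicator {0<..} l * (2 / (pi * (1 + l\<^sup>2)))) \<partial>lborel)
      = (\<integral>\<^sup>+ l. ennreal (2 / (pi * (1 + l\<^sup>2))) * indicator {0..} l \<partial>lborel)"
    by (rule nn_integral_cong_AE, rule AE_mp[OF AE_lborel_singleton[of 0]])
       (auto split: split_indicator)
  ultimately show ?thesis by simp
qed

lemma prob_space_half_cauchy: "prob_space half_cauchy"
  using half_cauchy_nn_integral
  by (auto intro!: prob_spaceI simp: half_cauchy_def emeasure_density)

lemma normal_kernel_measurable:
  "(\<lambda>l. density lborel (normal_density 0 (l * \<tau>))) \<in> borel \<rightarrow>\<^sub>M subprob_algebra borel"
proof (rule measurable_subprob_algebra)
  fix l :: real
  show "subprob_space (density lborel (normal_density 0 (l * \<tau>)))"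
  proof (cases "l * \<tau> = 0")
    case True
    then show ?thesis
      by (auto intro!: subprob_spaceI simp: normal_density_def emeasure_density)
  next
    case False
    have "normal_density 0 (l * \<tau>) = normal_density 0 \<bar>l * \<tau>\<bar>"
      by (simp add: normal_density_def fun_eq_iff)
    then show ?thesis
      using prob_space_normal_density[of "\<bar>l * \<tau>\<bar>" 0] False
      by (simp add: prob_space_imp_subprob_space)
  qed
next
  fix A :: "real set" assume A[measurable]: "A \<in> sets borel"
  have "(\<lambda>l. \<integral>\<^sup>+ x. ennreal (normal_density 0 (l * \<tau>) x) * indicator A x \<partial>lborel) \<in> borel_measurable borel"
    unfolding normal_density_def by measurable
  then show "(\<lambda>l. emeasure (density lborel (normal_density 0 (l * \<tau>))) A) \<in> borel_measurable borel"
    by (simp add: emeasure_density)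
qed simp

lemma horseshoe_law_eq_density:
  "horseshoe_law \<tau> = density lborel (\<lambda>t.
     \<integral>\<^sup>+ l. ennreal (indicator {0<..} l * (normal_density 0 (l * \<tau>) t * (2 / (pi * (1 + l\<^sup>2))))) \<partial>lborel)"
    (is "_ = density lborel ?h")
proof (rule measure_eqI)
  have K: "(\<lambda>l. density lborel (normal_density 0 (l * \<tau>))) \<in> half_cauchy \<rightarrow>\<^sub>M subprob_algebra borel"
    using normal_kernel_measurable by (simp add: half_cauchy_def)
  have ne: "space half_cauchy \<noteq> {}" by (simp add: half_cauchy_def)
  have S: "sets (horseshoe_law \<tau>) = sets borel"
    unfolding horseshoe_law_def by (rule sets_bind[OF sets_kernel[OF K] ne])
  then show "sets (horseshoe_law \<tau>) = sets (density lborel ?h)" by simp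
  fix A assume "A \<in> sets (horseshoe_law \<tau>)"
  then have A[measurable]: "A \<in> sets borel" using S by simp
  have m[measurable]: "(\<lambda>(t, l). normal_density 0 (l * \<tau>) t) \<in> borel_measurable (borel \<Otimes>\<^sub>M borel)"
    unfolding normal_density_def by measurable
  have "emeasure (horseshoe_law \<tau>) A
      = (\<integral>\<^sup>+ l. \<integral>\<^sup>+ t. ennreal (normal_density 0 (l * \<tau>) t) * indicator A t \<partial>lborel \<partial>half_cauchy)"
    unfolding horseshoe_law_def by (subst emeasure_bind[OF ne K A]) (simp add: emeasure_density)
  also have "\<dots> = (\<integral>\<^sup>+ l. \<integral>\<^sup>+ t. ennreal (indicator {0<..} l * (2 / (pi * (1 + l\<^sup>2)))) *
      (ennreal (normal_density 0 (l * \<tau>) t) * indicator A t) \<partial>lborel \<partial>lborel)"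
    unfolding half_cauchy_def
    by (subst nn_integral_density) (auto simp: nn_integral_cmult normal_density_def)
  also have "\<dots> = (\<integral>\<^sup>+ t. \<integral>\<^sup>+ l. ennreal (indicator {0<..} l * (2 / (pi * (1 + l\<^sup>2)))) *
      (ennreal (normal_density 0 (l * \<tau>) t) * indicator A t) \<partial>lborel \<partial>lborel)"
    by (rule lborel_pair.Fubini') (simp add: case_prod_unfold normal_density_def)
  also have "\<dots> = (\<integral>\<^sup>+ t. ?h t * indicator A t \<partial>lborel)"
  proof (rule nn_integral_cong)
    fix t :: real
    have "?h t * indicator A t = (\<integral>\<^sup>+ l. ennreal (indicator {0<..} l *
        (normal_density 0 (l * \<tau>) t * (2 / (pi * (1 + l\<^sup>2))))) * indicator A t \<partial>lborel)"
      by (rule nn_integral_multc[symmetric]) (simp add: normal_density_def)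
    also have "\<dots> = (\<integral>\<^sup>+ l. ennreal (indicator {0<..} l * (2 / (pi * (1 + l\<^sup>2)))) *
        (ennreal (normal_density 0 (l * \<tau>) t) * indicator A t) \<partial>lborel)"
      by (intro nn_integral_cong)
         (auto split: split_indicator simp: ennreal_mult[symmetric] mult.commute)
    finally show "(\<integral>\<^sup>+ l. ennreal (indicator {0<..} l * (2 / (pi * (1 + l\<^sup>2)))) *
        (ennreal (normal_density 0 (l * \<tau>) t) * indicator A t) \<partial>lborel) = ?h t * indicator A t"
      by simp
  qed
  also have "\<dots> = emeasure (density lborel ?h) A"
    by (subst emeasure_density) (auto simp: normal_density_def)
  finally show "emeasure (horseshoe_law \<tau>) A = emeasure (density lborel ?h) A" .
qed

lemma horseshoe_density_AE:
  "AE t in lborel. horseshoe_density \<tau> t =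
     (LBINT l:{0<..}. normal_density 0 (l * \<tau>) t * (2 / (pi * (1 + l\<^sup>2))))"
proof -
  let ?h = "\<lambda>t. \<integral>\<^sup>+ l. ennreal (indicator {0<..} l * (normal_density 0 (l * \<tau>) t * (2 / (pi * (1 + l\<^sup>2))))) \<partial>lborel"
  have m: "?h \<in> borel_measurable lborel" by (simp add: normal_density_def)
  have "AE t in lborel. ?h t = RN_deriv lborel (horseshoe_law \<tau>) t"
    by (rule sigma_finite_measure.RN_deriv_unique[OF sigma_finite_lborel m horseshoe_law_eq_density[symmetric]])
  then show ?thesis
  proof eventually_elim
    case (elim t)
    have "(LBINT l:{0<..}. normal_density 0 (l * \<tau>) t * (2 / (pi * (1 + l\<^sup>2)))) = enn2real (?h t)"
      unfolding set_lebesgue_integral_def real_scaleR_def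
      by (rule integral_eq_nn_integral) (auto simp: normal_density_def)
    with elim show ?case by (simp add: horseshoe_density_def)
  qed
qed

end

(* The likelihood of one observation, divided by the null density, is
     R_tau(x) = (2/pi) int_0^1 tau exp(x^2 t^2/2) / (tau^2 (1 - t^2) + t^2) dt,
   obtained from the half-Cauchy mixture by t = sigma / sqrt (1 + sigma^2), sigma = lambda tau.
   Uniformly in x, ln R_tau = ln (1 + tau g) + O(tau^(3/2)), where
     g = (2/pi) (G - 1),  G(x) = int_0^1 (exp(x^2 t^2/2) - 1) / t^2 dt,
   so that the log-likelihood is nearly the concave function sum ln (1 + tau g(X_i)) and its
   maximiser is located by the sign of the derivative at just two points T = kappa (s/n) zeta.
   Under the null, E g = 0, so the mean of g/(1 + T g) is -T E[g^2/(1 + T g)]; as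
   phi(x) g(x) ~ (C_star/2)/x^2 and T g passes from 0 to infinity at |x| = zeta, it is ~ -C_star/zeta,
   and the same integral bounds the variance. A signal contributes Phi(b)/T on average. By
   Chebyshev the derivative is about (n/zeta) (Phi(b)/kappa - C_star), which changes sign at
   kappa = Phi(b)/C_star. Values tau >= zeta^(-4), where the linearisation is too coarse, are
   excluded by a Hellinger affinity bound on a grid. Since Phi(b - delta) < Phi(b) < Phi(b + delta)
   strictly, both o(1) sequences can be taken to be 0. *)

theory Submission
  imports Defs "HOL-Real_Asymp.Real_Asymp"
begin

section \<open>The likelihood ratio\<close>

text \<open>The obstacle is uniformity in x: in the tail g(x) grows like exp(x^2/2) up to a power of
  x, so no additive bound on the likelihood ratio survives the logarithm. Every error is therefore
  measured relative to 1 + tau g(x), which stays above 1/3. Placing the two points T strictly inside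
  the target interval makes the linear gain at least a constant times tau n/zeta (T n/zeta below the
  interval), against an error of order n tau^(3/2). Hence sqrt tau has to be small compared with
  1/zeta; the cut-off zeta^(-4), with square root zeta^(-2), achieves this. Above the cut-off the
  affinity gains at least a constant times n zeta^(-8), which still dominates the signals' share, of
  order s zeta^2, because n/s = exp(zeta^2/2). Uniformity in theta comes from symmetry: g is even
  and the noise is symmetric, so the mean of the score sum depends on theta only through the number
  of signals. The variable t is convenient because exp(X^2 t^2/2) has the explicit null mean (1 -
  t^2)^(-1/2), so null means become elementary integrals over (0,1).\<close>

definition hs_kernel :: "real \<Rightarrow> real \<Rightarrow> real" where
  "hs_kernel \<tau> t = \<tau> / (\<tau>\<^sup>2 * (1 - t\<^sup>2) + t\<^sup>2)"

definition hs_ratio :: "real \<Rightarrow> real \<Rightarrow> real" where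
  "hs_ratio \<tau> x = 2 / pi * (LBINT t:{0<..<1}. hs_kernel \<tau> t * exp (x\<^sup>2 * t\<^sup>2 / 2))"

lemma hs_kernel_denom_pos:
  fixes t \<tau> :: real
  assumes "0 < \<tau>" "0 \<le> t" "t \<le> 1"
  shows "0 < \<tau>\<^sup>2 * (1 - t\<^sup>2) + t\<^sup>2"
proof (cases "t = 0")
  case False
  have "t\<^sup>2 \<le> 1" using assms by (auto intro: power_le_one)
  then have "0 \<le> \<tau>\<^sup>2 * (1 - t\<^sup>2)" by simp
  then show ?thesis using False by (simp add: add_nonneg_pos)
qed (use assms in simp)

lemma hs_kernel_pos: "0 < \<tau> \<Longrightarrow> 0 \<le> t \<Longrightarrow> t \<le> 1 \<Longrightarrow> 0 < hs_kernel \<tau> t"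
  unfolding hs_kernel_def using hs_kernel_denom_pos[of \<tau> t] by simp

lemma hs_kernel_integrable:
  assumes "0 < \<tau>"
  shows "set_integrable lborel {0<..<1} (\<lambda>t. hs_kernel \<tau> t * exp (c * t\<^sup>2))"
proof (rule set_integrable_subset)
  show "set_integrable lborel {0..1} (\<lambda>t. hs_kernel \<tau> t * exp (c * t\<^sup>2))"
    unfolding hs_kernel_def
  proof (rule borel_integrable_atLeastAtMost', intro continuous_intros ballI)
    fix t :: real assume "t \<in> {0..1}"
    then show "\<tau>\<^sup>2 * (1 - t\<^sup>2) + t\<^sup>2 \<noteq> 0" using hs_kernel_denom_pos[of \<tau> t] assms by simp
  qed
qed auto

lemma hs_kernel_integrable':
  assumes "0 < \<tau>"
  shows "set_integrable lborel {0<..<1} (\<lambda>t. hs_kernel \<tau> t * exp (x\<^sup>2 * t\<^sup>2 / 2))"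
  using hs_kernel_integrable[OF assms, of "x\<^sup>2 / 2"] by (simp add: mult.commute mult.left_commute)

lemma einterval_0_1: "einterval 0 1 = ({0<..<1} :: real set)"
  by (simp add: einterval_eq zero_ereal_def one_ereal_def)

lemma einterval_0_inf: "einterval 0 \<infinity> = ({0<..} :: real set)"
  by (simp add: einterval_eq zero_ereal_def)


text \<open>Given l, the observation has variance 1 + (l tau)^2 = 1/(1 - t^2). With r = sqrt (1 -
  t^2) its density splits into r, the standard normal density and exp(x^2 t^2/2). The Cauchy factor
  contributes tau^2 r^2 to the numerator and the Jacobian is 1/(tau r^3), so r survives only in the
  denominator of \<open>hs_kernel\<close>.\<close>

lemma half_cauchy_mixture:
  fixes x \<tau> :: real
  assumes \<tau>: "0 < \<tau>"
  defines "f \<equiv> \<lambda>l. normal_density 0 (sqrt (1 + (l * \<tau>)\<^sup>2)) x * (2 / (pi * (1 + l\<^sup>2)))"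
  shows "set_integrable lborel {0<..} f"
    and "(LBINT l:{0<..}. f l) = std_normal_density x * hs_ratio \<tau> x"
proof -
  \<comment> \<open>\<open>g\<close> inverts t = l tau / sqrt (1 + (l tau)^2) and maps (0,1) onto
    (0, infinity); \<open>g'\<close> is its derivative.\<close>
  define g where "g = (\<lambda>t. t / (\<tau> * sqrt (1 - t\<^sup>2)))"
  define g' where "g' = (\<lambda>t. 1 / (\<tau> * sqrt (1 - t\<^sup>2) ^ 3))"
  have key: "f (g t) * g' t = std_normal_density x * (2 / pi) * (hs_kernel \<tau> t * exp (x\<^sup>2 * t\<^sup>2 / 2))"
    if t: "0 < t" "t < 1" for t
  proof -
    define r where "r = sqrt (1 - t\<^sup>2)"
    have t2: "t\<^sup>2 < 1" using t by (simp add: power_less_one_iff)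
    have r: "0 < r" using t2 by (simp add: r_def)
    have rr: "r\<^sup>2 = 1 - t\<^sup>2" using t2 by (simp add: r_def)
    have 1: "1 + (g t * \<tau>)\<^sup>2 = 1 / r\<^sup>2"
      using \<tau> r rr by (simp add: g_def r_def[symmetric] power_divide field_simps)
    have 2: "1 + (g t)\<^sup>2 = (\<tau>\<^sup>2 * r\<^sup>2 + t\<^sup>2) / (\<tau>\<^sup>2 * r\<^sup>2)"
      using \<tau> r by (simp add: g_def r_def[symmetric] power_divide power_mult_distrib field_simps)
    have 3: "normal_density 0 (sqrt (1 / r\<^sup>2)) x = r * (std_normal_density x * exp (x\<^sup>2 * t\<^sup>2 / 2))"
    proof -
      have "exp (- (x\<^sup>2 * r\<^sup>2) / 2) = exp (- x\<^sup>2 / 2) * exp (x\<^sup>2 * t\<^sup>2 / 2)"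
        unfolding exp_add[symmetric] rr by (simp add: field_simps)
      then show ?thesis using r
        by (simp add: normal_density_def real_sqrt_divide real_sqrt_mult field_simps)
    qed
    have pos: "0 < \<tau>\<^sup>2 * r\<^sup>2 + t\<^sup>2" using \<tau> r by (simp add: add_pos_nonneg)
    have "f (g t) * g' t = r * (std_normal_density x * exp (x\<^sup>2 * t\<^sup>2 / 2)) *
       (2 / (pi * ((\<tau>\<^sup>2 * r\<^sup>2 + t\<^sup>2) / (\<tau>\<^sup>2 * r\<^sup>2)))) * (1 / (\<tau> * r ^ 3))"
      unfolding f_def 1 2 3 by (simp add: g'_def r_def)
    also have "\<dots> = std_normal_density x * (2 / pi) * (hs_kernel \<tau> t * exp (x\<^sup>2 * t\<^sup>2 / 2))"
      using \<tau> r pos unfolding hs_kernel_def rr[symmetric]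
      by (simp add: divide_simps power2_eq_square power3_eq_cube)
    finally show ?thesis .
  qed
  have int: "set_integrable lborel (einterval 0 1) (\<lambda>t. f (g t) * g' t)"
  proof -
    have "set_integrable lborel {0<..<1} (\<lambda>t. std_normal_density x * (2 / pi) * (hs_kernel \<tau> t * exp (x\<^sup>2 * t\<^sup>2 / 2)))"
      using hs_kernel_integrable'[OF \<tau>] by (intro set_integrable_mult_right) auto
    also have "?this \<longleftrightarrow> set_integrable lborel (einterval 0 1) (\<lambda>t. f (g t) * g' t)"
      unfolding einterval_0_1 by (intro set_integrable_cong) (auto simp: key)
    finally show ?thesis .
  qed
  have 01: "0 < t" "t < 1" "t\<^sup>2 < 1" if "0 < ereal t" "ereal t < 1" for t :: real
    using that by (simp_all add: one_ereal_def power_less_one_iff)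
  have deriv: "DERIV g t :> g' t" if "0 < ereal t" "ereal t < 1" for t
  proof -
    define r where "r = sqrt (1 - t\<^sup>2)"
    have r: "0 < r" "r\<^sup>2 = 1 - t\<^sup>2" using 01[OF that] by (simp_all add: r_def)
    have "DERIV g t :> (1 * (\<tau> * r) - t * (\<tau> * (- (2 * t) * (inverse r / 2)))) / (\<tau> * r * (\<tau> * r))"
      unfolding g_def r_def using 01[OF that] \<tau> by (auto intro!: derivative_eq_intros)
    moreover have "(1 * (\<tau> * r) - t * (\<tau> * (- (2 * t) * (inverse r / 2)))) / (\<tau> * r * (\<tau> * r)) = (r\<^sup>2 + t\<^sup>2) / (\<tau> * r ^ 3)"
      using r(1) \<tau> by (simp add: field_simps power2_eq_square power3_eq_cube)
    ultimately show ?thesis by (simp add: r(2) g'_def r_def[symmetric])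
  qed
  have contg': "isCont g' t" if "0 < ereal t" "ereal t < 1" for t
    unfolding g'_def using 01[OF that] \<tau> by (auto intro!: continuous_intros)
  have "0 < 1 + (l * \<tau>)\<^sup>2" "0 < 1 + l\<^sup>2" for l :: real by (simp_all add: add_pos_nonneg)
  then have nz: "1 + (l * \<tau>)\<^sup>2 \<noteq> 0" "1 + l\<^sup>2 \<noteq> 0" for l :: real by (metis less_irrefl)+
  have contf: "isCont f (g t)" if "0 < ereal t" "ereal t < 1" for t
    unfolding f_def normal_density_def
    by (intro continuous_intros) (use nz in \<open>auto simp: add_nonneg_eq_0_iff\<close>)
  have g'_nonneg: "0 \<le> g' t" if "0 \<le> ereal t" "ereal t \<le> 1" for t
  proof -
    have "t\<^sup>2 \<le> 1" using that by (auto simp: one_ereal_def intro: power_le_one)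
    then show ?thesis using \<tau> by (simp add: g'_def)
  qed
  have f_nonneg: "0 \<le> f (g t)" for t unfolding f_def by simp
  have "(g \<longlongrightarrow> g 0) (at_right 0)"
    unfolding g_def using \<tau> by (intro tendsto_intros) auto
  then have lim0: "((ereal \<circ> g \<circ> real_of_ereal) \<longlongrightarrow> 0) (at_right 0)"
    by (simp only: zero_ereal_def ereal_tendsto_simps) (simp add: g_def)
  have "filterlim g at_top (at_left 1)"
    unfolding g_def using \<tau> by real_asymp
  then have lim1: "((ereal \<circ> g \<circ> real_of_ereal) \<longlongrightarrow> \<infinity>) (at_left 1)"
    by (simp only: one_ereal_def ereal_tendsto_simps)
  note sub = interval_integral_substitution_nonneg[OF _ deriv contf contg' f_nonneg g'_nonneg lim0 lim1 int, simplified]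
  show "set_integrable lborel {0<..} f" using sub(1) by (simp add: einterval_0_inf)
  have "(LBINT l:{0<..}. f l) = (LBINT t:{0<..<1}. f (g t) * g' t)"
    using sub(2) by (simp add: interval_lebesgue_integral_def einterval_0_inf einterval_0_1)
  also have "\<dots> = (LBINT t:{0<..<1}. std_normal_density x * (2 / pi) * (hs_kernel \<tau> t * exp (x\<^sup>2 * t\<^sup>2 / 2)))"
    by (intro set_lebesgue_integral_cong) (auto simp: key)
  also have "\<dots> = std_normal_density x * hs_ratio \<tau> x"
    by (simp add: hs_ratio_def)
  finally show "(LBINT l:{0<..}. f l) = std_normal_density x * hs_ratio \<tau> x" .
qed

text \<open>The Radon-Nikodym density is known only almost everywhere, so the identity goes through
  nonnegative integrals. Tonelli brings the integration over t inside the mixture, where two centred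
  normal densities convolve.\<close>

lemma marginal_density_eq:
  assumes \<tau>: "0 < \<tau>"
  shows "(LBINT t. std_normal_density (x - t) * horseshoe_density \<tau> t) = std_normal_density x * hs_ratio \<tau> x"
proof -
  let ?h = "\<lambda>t. LBINT l:{0<..}. normal_density 0 (l * \<tau>) t * (2 / (pi * (1 + l\<^sup>2)))"
  let ?H = "\<lambda>t. \<integral>\<^sup>+ l. ennreal (indicator {0<..} l * (normal_density 0 (l * \<tau>) t * (2 / (pi * (1 + l\<^sup>2))))) \<partial>lborel"
  let ?f = "\<lambda>l. normal_density 0 (sqrt (1 + (l * \<tau>)\<^sup>2)) x * (2 / (pi * (1 + l\<^sup>2)))"
  have [measurable]: "(\<lambda>(t, l). normal_density 0 (l * \<tau>) t) \<in> borel_measurable (borel \<Otimes>\<^sub>M borel)"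
    unfolding normal_density_def by measurable
  have [measurable]: "?H \<in> borel_measurable lborel" by (simp add: normal_density_def)
  \<comment> \<open>\<open>enn2real\<close> sends infinity to 0, so the mixture integral must be
    finite almost everywhere before it can be converted back. At t = 0 it is infinite; elsewhere
    finiteness almost everywhere follows from total mass at most 1.\<close>
  have fin: "AE t in lborel. ?H t \<noteq> \<infinity>"
  proof (rule nn_integral_noteq_infinite)
    have "emeasure (horseshoe_law \<tau>) UNIV = (\<integral>\<^sup>+ t. ?H t \<partial>lborel)"
      unfolding horseshoe_law_eq_density by (subst emeasure_density) (auto simp: normal_density_def)
    moreover have "emeasure (horseshoe_law \<tau>) UNIV \<le> 1"
    proof -
      have "subprob_space (horseshoe_law \<tau>)"
        unfolding horseshoe_law_def
        by (rule subprob_space_bind[where N=borel])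
           (use prob_space_half_cauchy normal_kernel_measurable in
             \<open>auto simp: half_cauchy_def intro: prob_space_imp_subprob_space\<close>)
      then show ?thesis
        using subprob_space.emeasure_space_le_1[of "horseshoe_law \<tau>"]
          subprob_space.subprob_emeasure_le_1 by blast
    qed
    ultimately show "(\<integral>\<^sup>+ t. ?H t \<partial>lborel) \<noteq> \<infinity>" by (metis ennreal_one_neq_top infinity_ennreal_def top.extremum_unique)
  qed measurable
  have mH: "(\<lambda>t. enn2real (ennreal (std_normal_density (x - t)) * ?H t)) \<in> borel_measurable lborel"
    by measurable
  have "(LBINT t. std_normal_density (x - t) * horseshoe_density \<tau> t) = (LBINT t. enn2real (ennreal (std_normal_density (x - t)) * ?H t))"
  proof (rule integral_cong_AE)
    show "AE t in lborel. std_normal_density (x - t) * horseshoe_density \<tau> t = enn2real (ennreal (std_normal_density (x - t)) * ?H t)"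
      using horseshoe_density_AE[of \<tau>]
    proof eventually_elim
      case (elim t)
      have "?h t = enn2real (?H t)"
        unfolding set_lebesgue_integral_def real_scaleR_def
        by (rule integral_eq_nn_integral) (auto simp: normal_density_def)
      with elim show ?case by (simp add: enn2real_mult)
    qed
    show "(\<lambda>t. std_normal_density (x - t) * horseshoe_density \<tau> t) \<in> borel_measurable lborel"
      unfolding horseshoe_density_def by measurable
  qed (rule mH)
  also have "\<dots> = enn2real (\<integral>\<^sup>+ t. ennreal (enn2real (ennreal (std_normal_density (x - t)) * ?H t)) \<partial>lborel)"
    by (intro integral_eq_nn_integral mH) simp
  also have "(\<integral>\<^sup>+ t. ennreal (enn2real (ennreal (std_normal_density (x - t)) * ?H t)) \<partial>lborel)
     = (\<integral>\<^sup>+ t. ennreal (std_normal_density (x - t)) * ?H t \<partial>lborel)"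
    by (rule nn_integral_cong_AE, use fin in eventually_elim)
       (simp add: ennreal_enn2real_if ennreal_mult_eq_top_iff)
  also have "\<dots> = (\<integral>\<^sup>+ t. \<integral>\<^sup>+ l. ennreal (std_normal_density (x - t)) * ennreal (indicator {0<..} l * (normal_density 0 (l * \<tau>) t * (2 / (pi * (1 + l\<^sup>2))))) \<partial>lborel \<partial>lborel)"
    by (intro nn_integral_cong nn_integral_cmult[symmetric]) (simp add: normal_density_def)
  also have "\<dots> = (\<integral>\<^sup>+ l. \<integral>\<^sup>+ t. ennreal (std_normal_density (x - t)) * ennreal (indicator {0<..} l * (normal_density 0 (l * \<tau>) t * (2 / (pi * (1 + l\<^sup>2))))) \<partial>lborel \<partial>lborel)"
    by (rule lborel_pair.Fubini'[symmetric]) (simp add: case_prod_unfold normal_density_def)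
  also have "\<dots> = (\<integral>\<^sup>+ l. ennreal (indicator {0<..} l * ?f l) \<partial>lborel)"
  proof (rule nn_integral_cong)
    fix l :: real
    show "(\<integral>\<^sup>+ t. ennreal (std_normal_density (x - t)) * ennreal (indicator {0<..} l * (normal_density 0 (l * \<tau>) t * (2 / (pi * (1 + l\<^sup>2))))) \<partial>lborel)
      = ennreal (indicator {0<..} l * ?f l)"
    proof (cases "0 < l")
      case True
      have "(\<integral>\<^sup>+ t. ennreal (std_normal_density (x - t)) * ennreal (indicator {0<..} l * (normal_density 0 (l * \<tau>) t * (2 / (pi * (1 + l\<^sup>2))))) \<partial>lborel)
         = (\<integral>\<^sup>+ t. ennreal (std_normal_density (x - t) * normal_density 0 (l * \<tau>) t) * ennreal (2 / (pi * (1 + l\<^sup>2))) \<partial>lborel)"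
        using True by (intro nn_integral_cong) (simp add: ennreal_mult[symmetric] mult.assoc)
      also have "\<dots> = (\<integral>\<^sup>+ t. ennreal (std_normal_density (x - t) * normal_density 0 (l * \<tau>) t) \<partial>lborel) * ennreal (2 / (pi * (1 + l\<^sup>2)))"
        by (rule nn_integral_multc) simp
      also have "(\<integral>\<^sup>+ t. ennreal (std_normal_density (x - t) * normal_density 0 (l * \<tau>) t) \<partial>lborel) = ennreal (normal_density 0 (sqrt (1 + (l * \<tau>)\<^sup>2)) x)"
        using conv_normal_density_zero_mean[of 1 "l * \<tau>"] True \<tau> by (simp add: fun_eq_iff)
      finally show ?thesis using True by (simp add: ennreal_mult[symmetric])
    qed simp
  qed
  also have "enn2real \<dots> = (LBINT l:{0<..}. ?f l)"
    unfolding set_lebesgue_integral_def real_scaleR_def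
    by (rule integral_eq_nn_integral[symmetric]) (auto simp: normal_density_def)
  also have "\<dots> = std_normal_density x * hs_ratio \<tau> x"
    by (rule half_cauchy_mixture(2)[OF \<tau>])
  finally show ?thesis .
qed

section \<open>The first-order coefficients G and g\<close>

definition hs_G :: "real \<Rightarrow> real" where
  "hs_G x = (LBINT t:{0<..<1}. (exp (x\<^sup>2 * t\<^sup>2 / 2) - 1) / t\<^sup>2)"

definition hs_g :: "real \<Rightarrow> real" where
  "hs_g x = 2 / pi * (hs_G x - 1)"

lemma unit_sq_less: "0 < t \<Longrightarrow> t < 1 \<Longrightarrow> (t::real)\<^sup>2 < 1"
  by (simp add: power_less_one_iff)

lemma set_integrable_bounded_unit:
  fixes f :: "real \<Rightarrow> real"
  assumes "f \<in> borel_measurable borel" "\<And>t. 0 < t \<Longrightarrow> t < 1 \<Longrightarrow> \<bar>f t\<bar> \<le> B"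
  shows "set_integrable lborel {0<..<1} f"
proof (rule set_integrable_bound[where f="\<lambda>_::real. B"])
  show "set_integrable lborel {0<..<1} (\<lambda>_::real. B)"
    by (auto simp: set_integrable_def integrable_indicator_iff)
  show "AE x in lborel. x \<in> {0<..<1} \<longrightarrow> norm (f x) \<le> norm B"
    using assms(2) by (auto intro!: AE_I2 order_trans[OF _ abs_ge_self])
qed (use assms(1) in \<open>auto simp: set_borel_measurable_def\<close>)

lemma exp_minus_1_le: "exp v - 1 \<le> v * exp (v::real)"
proof -
  have "1 - v \<le> exp (- v)" using exp_ge_add_one_self[of "- v"] by simp
  then have "(1 - v) * exp v \<le> exp (- v) * exp v" by (intro mult_right_mono) auto
  then show ?thesis by (simp add: algebra_simps exp_minus)
qed

lemma exp_quot_le: "0 < t \<Longrightarrow> (exp (c * t\<^sup>2) - 1) / t\<^sup>2 \<le> c * exp (c * (t::real)\<^sup>2)"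
  using exp_minus_1_le[of "c * t\<^sup>2"] by (simp add: field_simps)

lemma exp_quot_nonneg: "0 \<le> c \<Longrightarrow> 0 \<le> (exp (c * t\<^sup>2) - 1) / (t::real)\<^sup>2"
  by simp

lemma hs_G_altdef: "hs_G x = (LBINT t:{0<..<1}. (exp (x\<^sup>2 / 2 * t\<^sup>2) - 1) / t\<^sup>2)"
  by (simp add: hs_G_def)

lemma hs_G_integrable:
  fixes c :: real
  assumes "0 \<le> c"
  shows "set_integrable lborel {0<..<1} (\<lambda>t. (exp (c * t\<^sup>2) - 1) / t\<^sup>2)"
proof (rule set_integrable_bounded_unit)
  fix t :: real assume t: "0 < t" "t < 1"
  have "(exp (c * t\<^sup>2) - 1) / t\<^sup>2 \<le> c * exp (c * t\<^sup>2)" using exp_quot_le t by simp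
  also have "\<dots> \<le> c * exp (c * 1)"
    using assms mult_left_mono[of "t\<^sup>2" 1 c] unit_sq_less[OF t] by (intro mult_left_mono, subst exp_le_cancel_iff) auto
  finally show "\<bar>(exp (c * t\<^sup>2) - 1) / t\<^sup>2\<bar> \<le> c * exp c" using exp_quot_nonneg[OF assms, of t] by simp
qed measurable

lemma hs_G_nonneg: "0 \<le> hs_G x"
  unfolding hs_G_def set_lebesgue_integral_def by (intro integral_nonneg_AE) auto

lemma measurable_hs_G[measurable]: "hs_G \<in> borel_measurable borel"
  unfolding hs_G_def set_lebesgue_integral_def by measurable

lemma measurable_hs_g[measurable]: "hs_g \<in> borel_measurable borel"
  unfolding hs_g_def by measurable

lemma measurable_hs_ratio[measurable]: "hs_ratio \<tau> \<in> borel_measurable borel"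
  unfolding hs_ratio_def hs_kernel_def set_lebesgue_integral_def by measurable

lemma hs_G_minus [simp]: "hs_G (- x) = hs_G x" by (simp add: hs_G_def)
lemma hs_g_minus [simp]: "hs_g (- x) = hs_g x" by (simp add: hs_g_def)

section \<open>Exact integrals over the unit interval\<close>

lemma set_integral_FTC_unit:
  fixes f F :: "real \<Rightarrow> real"
  assumes "\<And>x. 0 < x \<Longrightarrow> x < 1 \<Longrightarrow> DERIV F x :> f x"
    and "\<And>x. 0 < x \<Longrightarrow> x < 1 \<Longrightarrow> isCont f x"
    and "\<And>x. 0 < x \<Longrightarrow> x < 1 \<Longrightarrow> 0 \<le> f x"
    and "(F \<longlongrightarrow> A) (at_right 0)" "(F \<longlongrightarrow> B) (at_left 1)"
  shows "set_integrable lborel {0<..<1} f" "(LBINT x:{0<..<1}. f x) = B - A"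
proof -
  have 01: "0 < x" "x < 1" if "0 < ereal x" "ereal x < 1" for x
    using that by (simp_all add: one_ereal_def)
  have D: "DERIV F x :> f x" if "0 < ereal x" "ereal x < 1" for x using assms(1) 01 that by blast
  have C: "isCont f x" if "0 < ereal x" "ereal x < 1" for x using assms(2) 01 that by blast
  have N: "AE x in lborel. 0 < ereal x \<longrightarrow> ereal x < 1 \<longrightarrow> 0 \<le> f x"
    using assms(3) 01 by (intro AE_I2) blast
  have L: "((F \<circ> real_of_ereal) \<longlongrightarrow> A) (at_right 0)" "((F \<circ> real_of_ereal) \<longlongrightarrow> B) (at_left 1)"
    by (simp_all only: zero_ereal_def one_ereal_def ereal_tendsto_simps assms(4,5))
  note * = interval_integral_FTC_nonneg[OF _ D C N L]
  show "set_integrable lborel {0<..<1} f" using *(1) by (simp add: einterval_0_1)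
  show "(LBINT x:{0<..<1}. f x) = B - A"
    using *(2) by (simp add: interval_lebesgue_integral_def einterval_0_1)
qed

text \<open>In the variable l = t/(tau sqrt (1 - t^2)) the integrand is the half-Cauchy density up
  to the factor pi/2, which explains both the arctangent and the value. Since 1/sqrt (1 - t^2) is
  the null mean of exp(X^2 t^2/2), this encodes that the likelihood ratio has null mean 1.\<close>

lemma hs_kernel_arcsin_integral:
  assumes \<tau>: "0 < \<tau>"
  shows "set_integrable lborel {0<..<1} (\<lambda>t. hs_kernel \<tau> t / sqrt (1 - t\<^sup>2))"
    and "(LBINT t:{0<..<1}. hs_kernel \<tau> t / sqrt (1 - t\<^sup>2)) = pi / 2"
proof -
  let ?F = "\<lambda>t. arctan (t / (\<tau> * sqrt (1 - t\<^sup>2)))"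
  have D: "DERIV ?F t :> hs_kernel \<tau> t / sqrt (1 - t\<^sup>2)" if t: "0 < t" "t < 1" for t
  proof -
    define r where "r = sqrt (1 - t\<^sup>2)"
    have r: "0 < r" "r\<^sup>2 = 1 - t\<^sup>2" using unit_sq_less[OF t] by (simp_all add: r_def)
    have "DERIV ?F t :> inverse (1 + (t / (\<tau> * r))\<^sup>2) * ((1 * (\<tau> * r) - t * (\<tau> * (- (2 * t) * (inverse r / 2)))) / (\<tau> * r * (\<tau> * r)))"
      unfolding r_def using unit_sq_less[OF t] \<tau> by (auto intro!: derivative_eq_intros simp: mult_ac)
    moreover have "inverse (1 + (t / (\<tau> * r))\<^sup>2) * ((1 * (\<tau> * r) - t * (\<tau> * (- (2 * t) * (inverse r / 2)))) / (\<tau> * r * (\<tau> * r)))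
        = hs_kernel \<tau> t / r"
    proof -
      have "(1 * (\<tau> * r) - t * (\<tau> * (- (2 * t) * (inverse r / 2)))) / (\<tau> * r * (\<tau> * r)) = (r\<^sup>2 + t\<^sup>2) / (\<tau> * r ^ 3)"
        using r(1) \<tau> by (simp add: field_simps power2_eq_square power3_eq_cube)
      also have "\<dots> = 1 / (\<tau> * r ^ 3)" by (simp add: r(2))
      finally have 1: "(1 * (\<tau> * r) - t * (\<tau> * (- (2 * t) * (inverse r / 2)))) / (\<tau> * r * (\<tau> * r)) = 1 / (\<tau> * r ^ 3)" .
      have 2: "inverse (1 + (t / (\<tau> * r))\<^sup>2) = \<tau>\<^sup>2 * r\<^sup>2 / (\<tau>\<^sup>2 * r\<^sup>2 + t\<^sup>2)"
        using r(1) \<tau> by (simp add: field_simps)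
      show ?thesis
        unfolding 1 2 hs_kernel_def r(2)[symmetric] using r(1) \<tau>
        by (simp add: divide_simps power2_eq_square power3_eq_cube)
    qed
    ultimately show ?thesis unfolding r_def by (rule DERIV_cong)
  qed
  have C: "isCont (\<lambda>t. hs_kernel \<tau> t / sqrt (1 - t\<^sup>2)) t" if t: "0 < t" "t < 1" for t
    unfolding hs_kernel_def using unit_sq_less[OF t] hs_kernel_denom_pos[of \<tau> t] \<tau> t
    by (intro continuous_intros) auto
  have N: "0 \<le> hs_kernel \<tau> t / sqrt (1 - t\<^sup>2)" if t: "0 < t" "t < 1" for t
    using hs_kernel_pos[of \<tau> t] \<tau> t unit_sq_less[OF t] by simp
  have L: "(?F \<longlongrightarrow> 0) (at_right 0)" "(?F \<longlongrightarrow> pi / 2) (at_left 1)"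
    using \<tau> by real_asymp+
  show "set_integrable lborel {0<..<1} (\<lambda>t. hs_kernel \<tau> t / sqrt (1 - t\<^sup>2))"
    by (rule set_integral_FTC_unit(1)[OF D C N L])
  show "(LBINT t:{0<..<1}. hs_kernel \<tau> t / sqrt (1 - t\<^sup>2)) = pi / 2"
    using set_integral_FTC_unit(2)[OF D C N L] by simp
qed

lemma one_le_inverse_sqrt: "0 < t \<Longrightarrow> t < 1 \<Longrightarrow> 1 \<le> 1 / sqrt (1 - (t::real)\<^sup>2)"
  using unit_sq_less[of t] by (simp add: le_divide_eq)

text \<open>The value 1 is the null mean of \<open>hs_G\<close>; it is the constant subtracted in
  \<open>hs_g\<close>, which is thereby centred under the null.\<close>

lemma arcsin_quot_integral:
  shows "set_integrable lborel {0<..<1} (\<lambda>t. (1 / sqrt (1 - t\<^sup>2) - 1) / t\<^sup>2)"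
    and "(LBINT t:{0<..<1}. (1 / sqrt (1 - t\<^sup>2) - 1) / t\<^sup>2) = 1"
proof -
  let ?F = "\<lambda>t::real. (1 - sqrt (1 - t\<^sup>2)) / t"
  let ?f = "\<lambda>t::real. (1 / sqrt (1 - t\<^sup>2) - 1) / t\<^sup>2"
  have D: "DERIV ?F t :> ?f t" if t: "0 < t" "t < 1" for t
  proof -
    define r where "r = sqrt (1 - t\<^sup>2)"
    have r: "0 < r" "t\<^sup>2 = 1 - r\<^sup>2" using unit_sq_less[OF t] by (simp_all add: r_def)
    have "DERIV ?F t :> ((0 - (- (2 * t) * (inverse r / 2))) * t - (1 - r) * 1) / (t * t)"
      unfolding r_def using unit_sq_less[OF t] t by (auto intro!: derivative_eq_intros)
    moreover have "((0 - (- (2 * t) * (inverse r / 2))) * t - (1 - r) * 1) / (t * t) = (1 / r - 1) / t\<^sup>2"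
    proof -
      have "(0 - (- (2 * t) * (inverse r / 2))) * t - (1 - r) * 1 = t\<^sup>2 / r - 1 + r"
        using r(1) by (simp add: field_simps power2_eq_square)
      also have "\<dots> = 1 / r - 1"
        unfolding r(2) using r(1) by (simp add: field_simps power2_eq_square)
      finally show ?thesis by (simp add: power2_eq_square)
    qed
    ultimately show ?thesis unfolding r_def by (rule DERIV_cong)
  qed
  have C: "isCont ?f t" if t: "0 < t" "t < 1" for t
    using unit_sq_less[OF t] t by (intro continuous_intros) auto
  have N: "0 \<le> ?f t" if t: "0 < t" "t < 1" for t
    using one_le_inverse_sqrt[OF t] by simp
  have L: "(?F \<longlongrightarrow> 0) (at_right 0)" "(?F \<longlongrightarrow> 1) (at_left 1)"
    by real_asymp+
  show "set_integrable lborel {0<..<1} ?f"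
    by (rule set_integral_FTC_unit(1)[OF D C N L])
  show "(LBINT t:{0<..<1}. ?f t) = 1"
    using set_integral_FTC_unit(2)[OF D C N L] by simp
qed

text \<open>Divided by tau, the kernel decreases in tau because its denominator increases. This is
  used to pass from an arbitrary tau to a grid point below it, and to bound the signal coordinates
  crudely.\<close>

lemma hs_ratio_le_scale:
  assumes "0 < \<tau>'" "\<tau>' \<le> \<tau>"
  shows "hs_ratio \<tau> x \<le> \<tau> / \<tau>' * hs_ratio \<tau>' x"
proof -
  have \<tau>: "0 < \<tau>" using assms by simp
  have "(LBINT t:{0<..<1}. hs_kernel \<tau> t * exp (x\<^sup>2 * t\<^sup>2 / 2)) \<le>
      (LBINT t:{0<..<1}. \<tau> / \<tau>' * (hs_kernel \<tau>' t * exp (x\<^sup>2 * t\<^sup>2 / 2)))"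
  proof (rule set_integral_mono)
    fix t :: real assume t: "t \<in> {0<..<1}"
    have "\<tau>'\<^sup>2 * (1 - t\<^sup>2) + t\<^sup>2 \<le> \<tau>\<^sup>2 * (1 - t\<^sup>2) + t\<^sup>2"
      using assms t unit_sq_less[of t] by (intro add_right_mono mult_right_mono power_mono) auto
    then have "hs_kernel \<tau> t \<le> \<tau> / (\<tau>'\<^sup>2 * (1 - t\<^sup>2) + t\<^sup>2)"
      unfolding hs_kernel_def
      using hs_kernel_denom_pos[of \<tau> t] hs_kernel_denom_pos[of \<tau>' t] assms \<tau> t
      by (intro divide_left_mono) auto
    also have "\<dots> = \<tau> / \<tau>' * hs_kernel \<tau>' t" using assms by (simp add: hs_kernel_def)
    finally show "hs_kernel \<tau> t * exp (x\<^sup>2 * t\<^sup>2 / 2) \<le> \<tau> / \<tau>' * (hs_kernel \<tau>' t * exp (x\<^sup>2 * t\<^sup>2 / 2))"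
      by (simp only: mult.assoc[symmetric]) (rule mult_right_mono, auto)
  qed (use hs_kernel_integrable'[OF \<tau>] hs_kernel_integrable'[OF assms(1)] in auto)
  from mult_left_mono[OF this, of "2 / pi"] show ?thesis
    by (simp add: hs_ratio_def mult_ac)
qed

text \<open>The weight (1 - t^2)^(-1/2) is the null expectation of the exponential factor, so that both
  integrals below are deviations from a null mean.\<close>

lemma hs_ratio_minus_1:
  assumes "0 < \<tau>"
  shows "set_integrable lborel {0<..<1} (\<lambda>t. hs_kernel \<tau> t * (exp (x\<^sup>2 / 2 * t\<^sup>2) - 1 / sqrt (1 - t\<^sup>2)))"
    and "hs_ratio \<tau> x - 1 = 2 / pi * (LBINT t:{0<..<1}. hs_kernel \<tau> t * (exp (x\<^sup>2 / 2 * t\<^sup>2) - 1 / sqrt (1 - t\<^sup>2)))"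
proof -
  note I = hs_kernel_integrable[OF assms, of "x\<^sup>2 / 2"] hs_kernel_arcsin_integral(1)[OF assms]
  show "set_integrable lborel {0<..<1} (\<lambda>t. hs_kernel \<tau> t * (exp (x\<^sup>2 / 2 * t\<^sup>2) - 1 / sqrt (1 - t\<^sup>2)))"
    using set_integral_diff(1)[OF I] by (simp add: right_diff_distrib)
  show "hs_ratio \<tau> x - 1 = 2 / pi * (LBINT t:{0<..<1}. hs_kernel \<tau> t * (exp (x\<^sup>2 / 2 * t\<^sup>2) - 1 / sqrt (1 - t\<^sup>2)))"
    using set_integral_diff(2)[OF I] hs_kernel_arcsin_integral(2)[OF assms]
    by (simp add: right_diff_distrib hs_ratio_def)
qed

lemma hs_g_altdef:
  shows "set_integrable lborel {0<..<1} (\<lambda>t. (exp (x\<^sup>2 / 2 * t\<^sup>2) - 1 / sqrt (1 - t\<^sup>2)) / t\<^sup>2)"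
    and "hs_g x = 2 / pi * (LBINT t:{0<..<1}. (exp (x\<^sup>2 / 2 * t\<^sup>2) - 1 / sqrt (1 - t\<^sup>2)) / t\<^sup>2)"
proof -
  have I: "set_integrable lborel {0<..<1} (\<lambda>t. (exp (x\<^sup>2 / 2 * t\<^sup>2) - 1) / t\<^sup>2)"
    by (rule hs_G_integrable) simp
  have eq: "(exp (x\<^sup>2 / 2 * t\<^sup>2) - 1) / t\<^sup>2 - (1 / sqrt (1 - t\<^sup>2) - 1) / t\<^sup>2 = (exp (x\<^sup>2 / 2 * t\<^sup>2) - 1 / sqrt (1 - t\<^sup>2)) / t\<^sup>2" for t :: real
    by (simp only: diff_divide_distrib[symmetric]) (simp add: algebra_simps)
  show "set_integrable lborel {0<..<1} (\<lambda>t. (exp (x\<^sup>2 / 2 * t\<^sup>2) - 1 / sqrt (1 - t\<^sup>2)) / t\<^sup>2)"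
    using set_integral_diff(1)[OF I arcsin_quot_integral(1)] unfolding eq .
  show "hs_g x = 2 / pi * (LBINT t:{0<..<1}. (exp (x\<^sup>2 / 2 * t\<^sup>2) - 1 / sqrt (1 - t\<^sup>2)) / t\<^sup>2)"
    using set_integral_diff(2)[OF I arcsin_quot_integral(1)] arcsin_quot_integral(2) unfolding eq
    by (simp add: hs_g_def hs_G_altdef)
qed

lemma hs_kernel_integral_le:
  assumes "0 < \<tau>"
  shows "set_integrable lborel {0<..<1} (hs_kernel \<tau>)" "(LBINT t:{0<..<1}. hs_kernel \<tau> t) \<le> pi / 2"
proof -
  show I: "set_integrable lborel {0<..<1} (hs_kernel \<tau>)" using hs_kernel_integrable[OF assms, of 0] by simp
  show "(LBINT t:{0<..<1}. hs_kernel \<tau> t) \<le> pi / 2"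
    unfolding hs_kernel_arcsin_integral(2)[OF assms, symmetric]
  proof (rule set_integral_mono[OF I hs_kernel_arcsin_integral(1)[OF assms]])
    fix t :: real assume t: "t \<in> {0<..<1}"
    show "hs_kernel \<tau> t \<le> hs_kernel \<tau> t / sqrt (1 - t\<^sup>2)"
      using mult_left_mono[OF one_le_inverse_sqrt[of t], of "hs_kernel \<tau> t"] hs_kernel_pos[of \<tau> t] t assms by simp
  qed
qed

lemma hs_g_ge: "- (2 / pi) \<le> hs_g x"
  using hs_G_nonneg[of x] by (simp add: hs_g_def field_simps)

lemma two_div_pi: "2 / pi \<le> 2 / 3" "1 / 2 \<le> 2 / pi"
  using pi_gt3 pi_less_4 by (auto simp: field_simps)

section \<open>Linearisation in tau\<close>

text \<open>The negative part of tau g is at most 2/pi <= 2/3, and 2/pi >= 1/3 keeps a third of tau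
  G. Errors proportional to 1 + tau G can thus be charged to 1 + tau g.\<close>

lemma hs_g_linear_pos:
  assumes "0 \<le> \<tau>" "\<tau> \<le> 1"
  shows "(1 + \<tau> * hs_G x) / 3 \<le> 1 + \<tau> * hs_g x"
proof -
  define p where "p = 2 / pi"
  have p: "1 / 2 \<le> p" "p \<le> 2 / 3" using two_div_pi by (simp_all add: p_def)
  have "\<tau> * p \<le> 1 * (2 / 3)"
    using assms p by (intro mult_mono) auto
  moreover have "(\<tau> * hs_G x) * (1 / 3) \<le> (\<tau> * hs_G x) * p"
    using assms hs_G_nonneg[of x] p by (intro mult_left_mono) auto
  moreover have "\<tau> * hs_g x = (\<tau> * hs_G x) * p - \<tau> * p"
    unfolding hs_g_def p_def[symmetric] by (simp add: algebra_simps)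
  ultimately show ?thesis by argo
qed

text \<open>On (9/10, 1) one has t^2 >= 3/4, and that interval has length 1/10. The exponent 3/4 is
  chosen for its square root exp(3y/8), y = x^2/2, which dominates the part of the linearisation
  error with t <= 1/2.\<close>

lemma exp_le_hs_G: "exp (3 * (x\<^sup>2 / 2) / 4) \<le> 1 + 10 * hs_G x"
proof -
  let ?y = "x\<^sup>2 / 2"
  have "(LBINT t:{9/10<..<1::real}. exp (3 * ?y / 4) - 1) \<le> (LBINT t:{9/10<..<1}. (exp (?y * t\<^sup>2) - 1) / t\<^sup>2)"
  proof (rule set_integral_mono)
    show "set_integrable lborel {9/10<..<1::real} (\<lambda>t. exp (3 * ?y / 4) - 1)"
      by (auto simp: set_integrable_def integrable_indicator_iff)
    show "set_integrable lborel {9/10<..<1} (\<lambda>t. (exp (?y * t\<^sup>2) - 1) / t\<^sup>2)"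
      by (rule set_integrable_subset[OF hs_G_integrable]) auto
    fix t :: real assume t: "t \<in> {9/10<..<1}"
    have "(9/10)\<^sup>2 \<le> t\<^sup>2" using t by (intro power_mono) auto
    then have "?y * (3 / 4) \<le> ?y * t\<^sup>2" by (intro mult_left_mono) (auto simp: power2_eq_square)
    then have "exp (3 * ?y / 4) - 1 \<le> exp (?y * t\<^sup>2) - 1" by simp
    also have "\<dots> \<le> (exp (?y * t\<^sup>2) - 1) / t\<^sup>2"
    proof -
      have "(exp (?y * t\<^sup>2) - 1) * t\<^sup>2 \<le> (exp (?y * t\<^sup>2) - 1) * 1"
        using t unit_sq_less[of t] by (intro mult_left_mono) auto
      then show ?thesis using t by (simp add: le_divide_eq)
    qed
    finally show "exp (3 * ?y / 4) - 1 \<le> (exp (?y * t\<^sup>2) - 1) / t\<^sup>2" .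
  qed
  also have "\<dots> \<le> hs_G x"
    unfolding hs_G_altdef set_lebesgue_integral_def
  proof (rule integral_mono)
    show "integrable lborel (\<lambda>t. indicator {9/10<..<1} t *\<^sub>R ((exp (?y * t\<^sup>2) - 1) / t\<^sup>2))"
      unfolding set_integrable_def[symmetric] by (rule set_integrable_subset[OF hs_G_integrable]) auto
    show "integrable lborel (\<lambda>t. indicator {0<..<1} t *\<^sub>R ((exp (?y * t\<^sup>2) - 1) / t\<^sup>2))"
      unfolding set_integrable_def[symmetric] by (rule hs_G_integrable) simp
  qed (auto split: split_indicator)
  also have "(LBINT t:{9/10<..<1::real}. exp (3 * ?y / 4) - 1) = (exp (3 * ?y / 4) - 1) / 10"
    by (simp add: set_lebesgue_integral_def)
  finally show ?thesis by simp
qed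

text \<open>The kernel differs from tau/t^2 by exactly -tau^2 k(t) (1 - t^2)/t^2, where k =
  \<open>hs_kernel \<tau>\<close>. For t >= 1/2 the kernel is at most 4 tau, which costs tau^3 G.
  For t <= 1/2 the exponential quotient is of order sqrt (1 + 10 G), while k has integral at most
  pi/2, which costs tau^2 sqrt (1 + 10 G). Half a power of tau is spent on absorbing that square
  root into 1 + tau G; hence the exponent 3/2.\<close>

lemma hs_ratio_linear:
  assumes \<tau>: "0 < \<tau>" "\<tau> \<le> 1"
  shows "\<bar>hs_ratio \<tau> x - (1 + \<tau> * hs_g x)\<bar> \<le> 180 * (\<tau> * sqrt \<tau>) * (1 + \<tau> * hs_g x)"
proof -
  define y where "y = x\<^sup>2 / 2"
  define G where "G = hs_G x"
  define q where "q = (\<lambda>t. exp (y * t\<^sup>2) - 1 / sqrt (1 - t\<^sup>2))"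
  \<comment> \<open>\<open>S\<close> bounds (exp (y t^2) - 1)/t^2 for t <= 1/2: from y <= 8 exp(y/8)
    the bound y exp(y/4) becomes 8 exp(3y/8), and \<open>exp_le_hs_G\<close> applies to its
    square.\<close>
  define S where "S = 8 * sqrt (1 + 10 * G)"
  have y: "0 \<le> y" by (simp add: y_def)
  have G: "0 \<le> G" by (simp add: G_def hs_G_nonneg)
  note I1 = hs_ratio_minus_1[OF \<tau>(1), of x, folded y_def]
  note I2 = hs_g_altdef[of x, folded y_def]
  note IG = hs_G_integrable[OF y]
  note Ik = hs_kernel_integral_le[OF \<tau>(1)]
  have I2': "set_integrable lborel {0<..<1} (\<lambda>t. \<tau> * (q t / t\<^sup>2))"
    using I2(1) by (intro set_integrable_mult_right) (simp add: q_def)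
  have diff: "hs_ratio \<tau> x - (1 + \<tau> * hs_g x) = 2 / pi * (LBINT t:{0<..<1}. hs_kernel \<tau> t * q t - \<tau> * (q t / t\<^sup>2))"
  proof -
    have "(LBINT t:{0<..<1}. hs_kernel \<tau> t * q t - \<tau> * (q t / t\<^sup>2)) =
      (LBINT t:{0<..<1}. hs_kernel \<tau> t * q t) - \<tau> * (LBINT t:{0<..<1}. q t / t\<^sup>2)"
      using set_integral_diff(2)[OF I1(1) I2'] unfolding q_def by (simp only: set_integral_mult_right)
    moreover have "hs_ratio \<tau> x - 1 = 2 / pi * (LBINT t:{0<..<1}. hs_kernel \<tau> t * q t)"
      unfolding q_def by (rule I1(2))
    moreover have "hs_g x = 2 / pi * (LBINT t:{0<..<1}. q t / t\<^sup>2)"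
      unfolding q_def by (rule I2(2))
    ultimately show ?thesis by (simp only: right_diff_distrib) (simp add: algebra_simps)
  qed
  have bound: "\<bar>hs_kernel \<tau> t * q t - \<tau> * (q t / t\<^sup>2)\<bar>
      \<le> \<tau>\<^sup>2 * (hs_kernel \<tau> t * (S + 1 / 2)) + \<tau>\<^sup>2 * (4 * \<tau> * ((exp (y * t\<^sup>2) - 1) / t\<^sup>2))"
    if t: "0 < t" "t < 1" for t
  proof -
    have t2: "t\<^sup>2 < 1" "0 < t\<^sup>2" using unit_sq_less[OF t] t by auto
    have kpos: "0 < hs_kernel \<tau> t" using hs_kernel_pos[of \<tau> t] \<tau> t by simp
    have dpos: "0 < \<tau>\<^sup>2 * (1 - t\<^sup>2) + t\<^sup>2" using hs_kernel_denom_pos[of \<tau> t] \<tau> t by simp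
    have ident: "hs_kernel \<tau> t * q t - \<tau> * (q t / t\<^sup>2) = - \<tau>\<^sup>2 * hs_kernel \<tau> t * ((1 - t\<^sup>2) * q t / t\<^sup>2)"
      unfolding hs_kernel_def using dpos t by (simp add: divide_simps) (simp add: algebra_simps power2_eq_square)
    \<comment> \<open>The factor 1 - t^2 tames the singularity of the null mean at t = 1: with r =
      sqrt (1 - t^2) it leaves r - r^2, which is at most (1 - r^2)/2 = t^2/2.\<close>
    have q1: "\<bar>(1 - t\<^sup>2) * q t\<bar> \<le> (exp (y * t\<^sup>2) - 1) + t\<^sup>2 / 2"
    proof -
      define r where "r = sqrt (1 - t\<^sup>2)"
      have r: "0 < r" "1 - t\<^sup>2 = r\<^sup>2" "r \<le> 1" using t2 by (simp_all add: r_def)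
      have e: "(1 - t\<^sup>2) * q t = r\<^sup>2 * (exp (y * t\<^sup>2) - 1) - (r - r\<^sup>2)"
      proof -
        have "(1 - t\<^sup>2) * q t = r\<^sup>2 * (exp (y * t\<^sup>2) - 1 / r)" 
          unfolding q_def r_def[symmetric] unfolding r(2) by simp
        also have "\<dots> = r\<^sup>2 * (exp (y * t\<^sup>2) - 1) - (r - r\<^sup>2)"
          using r(1) by (simp add: field_simps power2_eq_square)
        finally show ?thesis .
      qed
      have "r\<^sup>2 * (exp (y * t\<^sup>2) - 1) \<le> 1 * (exp (y * t\<^sup>2) - 1)"
        using t2 y unfolding r(2)[symmetric] by (intro mult_right_mono) auto
      moreover have "0 \<le> r\<^sup>2 * (exp (y * t\<^sup>2) - 1)" using y by simp
      moreover have "0 \<le> r - r\<^sup>2" using r by (simp add: power2_eq_square mult_left_le)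
      moreover have "r - r\<^sup>2 \<le> t\<^sup>2 / 2"
      proof -
        have "t\<^sup>2 = 1 - r\<^sup>2" using r(2) by simp
        moreover have "0 \<le> (1 - r)\<^sup>2" by simp
        ultimately show ?thesis by (simp add: power2_eq_square algebra_simps)
      qed
      moreover have "\<bar>A - B\<bar> \<le> E + C" if "A \<le> 1 * E" "0 \<le> A" "0 \<le> B" "B \<le> C" for A B C E :: real
        using that by linarith
      ultimately show ?thesis unfolding e by blast
    qed
    have "\<bar>(1 - t\<^sup>2) * q t / t\<^sup>2\<bar> \<le> ((exp (y * t\<^sup>2) - 1) + t\<^sup>2 / 2) / t\<^sup>2"
      using q1 by (simp add: abs_mult divide_right_mono)
    also have "\<dots> = (exp (y * t\<^sup>2) - 1) / t\<^sup>2 + 1 / 2"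
      using t2 by (simp add: field_simps)
    finally have "hs_kernel \<tau> t * \<bar>(1 - t\<^sup>2) * q t / t\<^sup>2\<bar> \<le> hs_kernel \<tau> t * ((exp (y * t\<^sup>2) - 1) / t\<^sup>2 + 1 / 2)"
      using kpos by (intro mult_left_mono) auto
    also have "\<dots> \<le> hs_kernel \<tau> t * (S + 1 / 2) + 4 * \<tau> * ((exp (y * t\<^sup>2) - 1) / t\<^sup>2)"
    proof (cases "t \<le> 1 / 2")
      case True
      have "t\<^sup>2 \<le> (1/2)\<^sup>2" using True t by (intro power_mono) auto
      then have "y * t\<^sup>2 \<le> y * (1 / 4)" using y by (intro mult_left_mono) (auto simp: power2_eq_square)
      then have e1: "exp (y * t\<^sup>2) \<le> exp (y / 4)" by simp
      have e2: "y / 8 \<le> exp (y / 8)" using exp_ge_add_one_self[of "y / 8"] by linarith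
      have "(exp (y * t\<^sup>2) - 1) / t\<^sup>2 \<le> y * exp (y * t\<^sup>2)" using exp_quot_le t by simp
      also have "\<dots> \<le> (8 * exp (y / 8)) * exp (y / 4)"
        using e1 e2 y by (intro mult_mono) auto
      also have "\<dots> = 8 * exp (3 * y / 8)" by (simp add: exp_add[symmetric])
      also have "exp (3 * y / 8) \<le> sqrt (1 + 10 * G)"
      proof (rule real_le_rsqrt)
        have "(exp (3 * y / 8))\<^sup>2 = exp (3 * y / 4)" by (simp add: exp_double[symmetric])
        then show "(exp (3 * y / 8))\<^sup>2 \<le> 1 + 10 * G" using exp_le_hs_G[of x] by (simp add: G_def y_def)
      qed
      finally have "(exp (y * t\<^sup>2) - 1) / t\<^sup>2 + 1 / 2 \<le> S + 1 / 2" by (simp add: S_def)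
      then have "hs_kernel \<tau> t * ((exp (y * t\<^sup>2) - 1) / t\<^sup>2 + 1 / 2) \<le> hs_kernel \<tau> t * (S + 1 / 2)"
        using kpos by (intro mult_left_mono) auto
      moreover have "0 \<le> 4 * \<tau> * ((exp (y * t\<^sup>2) - 1) / t\<^sup>2)" using \<tau> y by simp
      ultimately show ?thesis by linarith
    next
      case False
      have "(1/2)\<^sup>2 \<le> t\<^sup>2" using False by (intro power_mono) auto
      then have "1 / 4 \<le> \<tau>\<^sup>2 * (1 - t\<^sup>2) + t\<^sup>2" using t2 by (simp add: power2_eq_square add_increasing)
      then have "hs_kernel \<tau> t \<le> \<tau> / (1 / 4)"
        unfolding hs_kernel_def using \<tau> dpos by (intro divide_left_mono) auto
      then have "hs_kernel \<tau> t * ((exp (y * t\<^sup>2) - 1) / t\<^sup>2) \<le> 4 * \<tau> * ((exp (y * t\<^sup>2) - 1) / t\<^sup>2)"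
        using y by (intro mult_right_mono) auto
      moreover have "0 \<le> hs_kernel \<tau> t * S" using kpos G by (simp add: S_def)
      ultimately show ?thesis by (simp add: distrib_left)
    qed
    finally have "\<tau>\<^sup>2 * (hs_kernel \<tau> t * \<bar>(1 - t\<^sup>2) * q t / t\<^sup>2\<bar>) \<le> \<tau>\<^sup>2 * (hs_kernel \<tau> t * (S + 1 / 2) + 4 * \<tau> * ((exp (y * t\<^sup>2) - 1) / t\<^sup>2))"
      by (intro mult_left_mono) auto
    moreover have "\<bar>- \<tau>\<^sup>2 * hs_kernel \<tau> t * ((1 - t\<^sup>2) * q t / t\<^sup>2)\<bar> = \<tau>\<^sup>2 * (hs_kernel \<tau> t * \<bar>(1 - t\<^sup>2) * q t / t\<^sup>2\<bar>)"
      using kpos by (simp only: abs_mult abs_minus abs_power2 abs_of_pos mult.assoc)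
    ultimately show ?thesis unfolding ident by (simp only: distrib_left)
  qed
  have J1: "set_integrable lborel {0<..<1} (\<lambda>t. \<tau>\<^sup>2 * (hs_kernel \<tau> t * (S + 1 / 2)))"
    by (intro set_integrable_mult_right set_integrable_mult_left impI Ik(1))
  have J2: "set_integrable lborel {0<..<1} (\<lambda>t. \<tau>\<^sup>2 * (4 * \<tau> * ((exp (y * t\<^sup>2) - 1) / t\<^sup>2)))"
    by (intro set_integrable_mult_right impI IG)
  have J0: "set_integrable lborel {0<..<1} (\<lambda>t. hs_kernel \<tau> t * q t - \<tau> * (q t / t\<^sup>2))"
    using set_integral_diff(1)[OF I1(1) I2'] by (simp add: q_def)
  have "\<bar>LBINT t:{0<..<1}. hs_kernel \<tau> t * q t - \<tau> * (q t / t\<^sup>2)\<bar>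
      \<le> (LBINT t:{0<..<1}. \<bar>hs_kernel \<tau> t * q t - \<tau> * (q t / t\<^sup>2)\<bar>)"
    using set_integral_norm_bound[OF J0] by simp
  also have "\<dots> \<le> (LBINT t:{0<..<1}. \<tau>\<^sup>2 * (hs_kernel \<tau> t * (S + 1 / 2)) + \<tau>\<^sup>2 * (4 * \<tau> * ((exp (y * t\<^sup>2) - 1) / t\<^sup>2)))"
    by (intro set_integral_mono set_integrable_abs J0 set_integral_add(1)[OF J1 J2] bound) auto
  also have "\<dots> = \<tau>\<^sup>2 * ((LBINT t:{0<..<1}. hs_kernel \<tau> t) * (S + 1 / 2)) + \<tau>\<^sup>2 * (4 * \<tau> * G)"
    unfolding G_def hs_G_altdef y_def[symmetric]
    by (simp only: set_integral_add(2)[OF J1 J2] set_integral_mult_right set_integral_mult_left)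
  also have "\<dots> \<le> \<tau>\<^sup>2 * (2 * (S + 1 / 2)) + \<tau>\<^sup>2 * (4 * \<tau> * G)"
    using Ik(2) pi_less_4 G by (intro add_right_mono mult_left_mono mult_right_mono) (auto simp: S_def)
  also have "\<dots> \<le> (\<tau> * sqrt \<tau>) * (90 * (1 + \<tau> * G))"
  proof -
    define w where "w = sqrt \<tau>"
    have w: "0 < w" "w \<le> 1" "\<tau> = w\<^sup>2" using \<tau> by (simp_all add: w_def)
    \<comment> \<open>Here half a power of tau is traded: tau (1 + 10 G) is at most the square of 4
      (1 + tau G).\<close>
    have "w * sqrt (1 + 10 * G) = sqrt (\<tau> * (1 + 10 * G))" by (simp add: w_def real_sqrt_mult)
    also have "\<dots> \<le> sqrt ((4 * (1 + \<tau> * G))\<^sup>2)"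
    proof (rule real_sqrt_le_mono)
      have "0 \<le> \<tau> * G" using \<tau> G by simp
      moreover have "0 \<le> (\<tau> * G) * (\<tau> * G)" by simp
      ultimately show "\<tau> * (1 + 10 * G) \<le> (4 * (1 + \<tau> * G))\<^sup>2"
        using \<tau> by (simp add: power2_eq_square algebra_simps)
    qed
    also have "\<dots> = 4 * (1 + \<tau> * G)" using \<tau> G by simp
    finally have s: "w * sqrt (1 + 10 * G) \<le> 4 * (1 + \<tau> * G)" .
    have tG: "0 \<le> \<tau> * G" using \<tau> G by simp
    have "\<tau>\<^sup>2 * (2 * (S + 1 / 2)) + \<tau>\<^sup>2 * (4 * \<tau> * G) = (\<tau> * w) * (16 * (w * sqrt (1 + 10 * G)) + w + 4 * (w * (\<tau> * G)))"
      unfolding S_def w(3) by (simp add: algebra_simps power2_eq_square)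
    also have "\<dots> \<le> (\<tau> * w) * (16 * (4 * (1 + \<tau> * G)) + 1 + 4 * (1 * (\<tau> * G)))"
      using s w \<tau> tG by (intro mult_left_mono add_mono mult_right_mono) auto
    also have "\<dots> \<le> (\<tau> * w) * (90 * (1 + \<tau> * G))"
    proof (rule mult_left_mono)
      have "16 * (4 * (1 + v)) + 1 + 4 * (1 * v) \<le> 90 * (1 + v)" if "0 \<le> v" for v :: real
        using that by simp
      from this[OF tG] show "16 * (4 * (1 + \<tau> * G)) + 1 + 4 * (1 * (\<tau> * G)) \<le> 90 * (1 + \<tau> * G)" .
    qed (use w \<tau> in auto)
    finally show ?thesis by (simp add: w_def)
  qed
  finally have A: "\<bar>LBINT t:{0<..<1}. hs_kernel \<tau> t * q t - \<tau> * (q t / t\<^sup>2)\<bar> \<le> (\<tau> * sqrt \<tau>) * (90 * (1 + \<tau> * G))" .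
  have "\<bar>hs_ratio \<tau> x - (1 + \<tau> * hs_g x)\<bar> \<le> 2 / 3 * ((\<tau> * sqrt \<tau>) * (90 * (1 + \<tau> * G)))"
    unfolding diff abs_mult using A two_div_pi by (intro mult_mono) auto
  also have "\<dots> = 180 * (\<tau> * sqrt \<tau>) * ((1 + \<tau> * G) / 3)" by simp
  also have "\<dots> \<le> 180 * (\<tau> * sqrt \<tau>) * (1 + \<tau> * hs_g x)"
    using hs_g_linear_pos[of \<tau> x] \<tau> unfolding G_def by (intro mult_left_mono) auto
  finally show ?thesis .
qed

lemma hs_linear_pos: "0 \<le> \<tau> \<Longrightarrow> \<tau> \<le> 1 \<Longrightarrow> 1 / 3 \<le> 1 + \<tau> * hs_g x"
  using hs_g_linear_pos[of \<tau> x] mult_nonneg_nonneg[OF _ hs_G_nonneg, of \<tau> x] by (auto intro: order_trans[rotated])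

lemma hs_kernel_ge:
  assumes "0 < \<tau>" "\<tau> \<le> 1" "0 < t" "t < 1"
  shows "\<tau> \<le> hs_kernel \<tau> t"
proof -
  have "\<tau>\<^sup>2 * (1 - t\<^sup>2) \<le> 1 * (1 - t\<^sup>2)"
    using assms unit_sq_less[of t] by (intro mult_right_mono) (auto intro: power_le_one)
  then have "\<tau> / 1 \<le> hs_kernel \<tau> t"
    unfolding hs_kernel_def using assms hs_kernel_denom_pos[of \<tau> t] by (intro divide_left_mono) auto
  then show ?thesis by simp
qed

lemma hs_ratio_pos:
  assumes "0 < \<tau>" "\<tau> \<le> 1"
  shows "0 < hs_ratio \<tau> x"
proof -
  have "(LBINT t:{0<..<1::real}. \<tau>) \<le> (LBINT t:{0<..<1}. hs_kernel \<tau> t * exp (x\<^sup>2 * t\<^sup>2 / 2))"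
  proof (rule set_integral_mono)
    show "set_integrable lborel {0<..<1::real} (\<lambda>t. \<tau>)"
      by (rule set_integrable_bounded_unit) auto
    fix t :: real assume t: "t \<in> {0<..<1}"
    show "\<tau> \<le> hs_kernel \<tau> t * exp (x\<^sup>2 * t\<^sup>2 / 2)"
      using mult_mono[OF hs_kernel_ge[of \<tau> t], of 1 "exp (x\<^sup>2 * t\<^sup>2 / 2)"] hs_kernel_pos[of \<tau> t] assms t by simp
  qed (rule hs_kernel_integrable'[OF assms(1)])
  moreover have "(LBINT t:{0<..<1::real}. \<tau>) = \<tau>" by (simp add: set_lebesgue_integral_def)
  ultimately show ?thesis using assms by (simp add: hs_ratio_def)
qed

text \<open>The hypothesis on tau makes the relative error e at most 1/2, where |ln (1 + u)| <= 2 e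
  for |u| <= e. Because the error was relative, the resulting bound is free of x.\<close>

lemma ln_hs_ratio_linear:
  assumes \<tau>: "0 < \<tau>" "\<tau> \<le> 1" "360 * (\<tau> * sqrt \<tau>) \<le> 1"
  shows "\<bar>ln (hs_ratio \<tau> x) - ln (1 + \<tau> * hs_g x)\<bar> \<le> 360 * (\<tau> * sqrt \<tau>)"
proof -
  define Q where "Q = 1 + \<tau> * hs_g x"
  define e where "e = 180 * (\<tau> * sqrt \<tau>)"
  have Q: "0 < Q" using hs_linear_pos[of \<tau> x] \<tau> by (simp add: Q_def)
  have e: "0 \<le> e" "e \<le> 1 / 2" using \<tau> by (simp_all add: e_def)
  have lin: "\<bar>hs_ratio \<tau> x - Q\<bar> \<le> e * Q" using hs_ratio_linear[OF \<tau>(1,2)] by (simp add: Q_def e_def)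
  define u where "u = hs_ratio \<tau> x / Q - 1"
  have u: "\<bar>u\<bar> \<le> e"
  proof -
    have "u = (hs_ratio \<tau> x - Q) / Q" using Q by (simp add: u_def field_simps)
    then show ?thesis using lin Q by (simp add: divide_le_eq)
  qed
  have "hs_ratio \<tau> x = Q * (1 + u)" using Q by (simp add: u_def)
  then have "ln (hs_ratio \<tau> x) - ln Q = ln (1 + u)" using Q u e by (simp add: ln_mult)
  moreover have "\<bar>ln (1 + u)\<bar> \<le> 2 * e"
  proof -
    have "ln (1 + u) \<le> u" using u e by (intro ln_add_one_self_le_self2) auto
    moreover have "- ln (1 + u) \<le> 2 * e"
    proof -
      have "- ln (1 + u) = ln (inverse (1 + u))" using u e by (simp add: ln_inverse)
      also have "\<dots> \<le> inverse (1 + u) - 1" using u e by (intro ln_le_minus_one) auto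
      also have "\<dots> = - u / (1 + u)" using u e by (simp add: field_simps)
      also have "\<dots> \<le> e / (1 / 2)" using u e by (intro frac_le) auto
      finally show ?thesis by simp
    qed
    ultimately show ?thesis using u e by linarith
  qed
  ultimately show ?thesis by (simp add: Q_def e_def)
qed

section \<open>Null expectations\<close>

abbreviation "N01 \<equiv> std_normal_distribution"

lemma prob_space_N01: "prob_space N01"
  by (rule prob_space_normal_density) simp

lemma N01_exp_square:
  assumes t: "0 \<le> t" "t < 1"
  shows "integrable N01 (\<lambda>x. exp (x\<^sup>2 * t\<^sup>2 / 2))" and "(\<integral>x. exp (x\<^sup>2 * t\<^sup>2 / 2) \<partial>N01) = 1 / sqrt (1 - t\<^sup>2)"
proof -
  define r where "r = sqrt (1 - t\<^sup>2)"
  have "t\<^sup>2 < 1" using t by (simp add: power_less_one_iff)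
  then have r: "0 < r" "1 - t\<^sup>2 = r\<^sup>2" by (simp_all add: r_def)
  have eq: "std_normal_density x * exp (x\<^sup>2 * t\<^sup>2 / 2) = 1 / r * normal_density 0 (1 / r) x" for x
  proof -
    have "exp (- x\<^sup>2 / 2) * exp (x\<^sup>2 * t\<^sup>2 / 2) = exp (- (x\<^sup>2 * (1 - t\<^sup>2)) / 2)"
      unfolding exp_add[symmetric] by (simp add: field_simps)
    then show ?thesis unfolding r(2) using r(1)
      by (simp add: normal_density_def real_sqrt_divide real_sqrt_mult field_simps)
  qed
  have int: "integrable lborel (\<lambda>x. 1 / r * normal_density 0 (1 / r) x)"
    using r(1) by (intro integrable_mult_right) (simp add: integrable_normal_density)
  show "integrable N01 (\<lambda>x. exp (x\<^sup>2 * t\<^sup>2 / 2))"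
    using int by (subst integrable_density) (auto simp: eq)
  have "(\<integral>x. exp (x\<^sup>2 * t\<^sup>2 / 2) \<partial>N01) = (LBINT x. 1 / r * normal_density 0 (1 / r) x)"
    by (subst integral_density) (auto simp: eq)
  also have "\<dots> = 1 / r" using r(1) by (simp add: integral_normal_density)
  finally show "(\<integral>x. exp (x\<^sup>2 * t\<^sup>2 / 2) \<partial>N01) = 1 / sqrt (1 - t\<^sup>2)" by (simp add: r_def)
qed

text \<open>One Tonelli argument serves the likelihood ratio (a = 0) and G (a = 1, weight 1/t^2).
  For G the constant must be subtracted inside the integral, since 1/t^2 alone is not integrable at
  0; a <= 1 keeps the integrand nonnegative.\<close>

lemma N01_exp_square_mixture:
  fixes w :: "real \<Rightarrow> real"
  assumes [measurable]: "w \<in> borel_measurable borel"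
    and w: "\<And>t. 0 < t \<Longrightarrow> t < 1 \<Longrightarrow> 0 \<le> w t" and a: "0 \<le> a" "a \<le> 1"
    and I1: "set_integrable lborel {0<..<1} (\<lambda>t. w t * (1 / sqrt (1 - t\<^sup>2) - a))"
    and I2: "\<And>x. set_integrable lborel {0<..<1} (\<lambda>t. w t * (exp (x\<^sup>2 * t\<^sup>2 / 2) - a))"
  shows "integrable N01 (\<lambda>x. LBINT t:{0<..<1}. w t * (exp (x\<^sup>2 * t\<^sup>2 / 2) - a))"
    and "(\<integral>x. (LBINT t:{0<..<1}. w t * (exp (x\<^sup>2 * t\<^sup>2 / 2) - a)) \<partial>N01) = (LBINT t:{0<..<1}. w t * (1 / sqrt (1 - t\<^sup>2) - a))"
proof -
  interpret N: prob_space N01 by (rule prob_space_N01)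
  interpret P: pair_sigma_finite N01 lborel by unfold_locales
  let ?f = "\<lambda>x t. indicator {0<..<1} t * (w t * (exp (x\<^sup>2 * t\<^sup>2 / 2) - a))"
  let ?h = "\<lambda>t. indicator {0<..<1} t * (w t * (1 / sqrt (1 - t\<^sup>2) - a))"
  let ?F = "\<lambda>x. LBINT t:{0<..<1}. w t * (exp (x\<^sup>2 * t\<^sup>2 / 2) - a)"
  have meas: "?F \<in> borel_measurable N01"
    unfolding set_lebesgue_integral_def by measurable
  have e1: "a \<le> exp (x\<^sup>2 * t\<^sup>2 / 2)" for x t :: real
    by (rule order_trans[OF a(2)]) simp
  have f0: "0 \<le> ?f x t" for x t using w[of t] e1[of x t] by (auto split: split_indicator)
  have h0: "0 \<le> ?h t" for t using w[of t] one_le_inverse_sqrt[of t] a by (auto split: split_indicator)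
  have F0: "0 \<le> ?F x" for x unfolding set_lebesgue_integral_def using f0 by (intro integral_nonneg_AE AE_I2) simp
  have inner: "(\<integral>\<^sup>+x. ennreal (?f x t) \<partial>N01) = ennreal (?h t)" for t
  proof (cases "0 < t \<and> t < 1")
    case True
    then have t: "0 \<le> t" "t < 1" by auto
    have I: "integrable N01 (\<lambda>x. w t * (exp (x\<^sup>2 * t\<^sup>2 / 2) - a))"
      by (intro integrable_mult_right Bochner_Integration.integrable_diff N01_exp_square(1)[OF t] N.integrable_const)
    have "(\<integral>\<^sup>+x. ennreal (?f x t) \<partial>N01) = ennreal (\<integral>x. w t * (exp (x\<^sup>2 * t\<^sup>2 / 2) - a) \<partial>N01)"
      using True w[of t] e1 by (subst nn_integral_eq_integral[OF I, symmetric]) auto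
    also have "(\<integral>x. w t * (exp (x\<^sup>2 * t\<^sup>2 / 2) - a) \<partial>N01) = w t * (1 / sqrt (1 - t\<^sup>2) - a)"
      using N01_exp_square[OF t] N.prob_space
      by (subst integral_mult_right_zero, subst Bochner_Integration.integral_diff) auto
    finally show ?thesis using True by simp
  next
    case False
    then show ?thesis by (auto split: split_indicator)
  qed
  have "(\<integral>\<^sup>+x. ennreal (?F x) \<partial>N01) = (\<integral>\<^sup>+x. \<integral>\<^sup>+t. ennreal (?f x t) \<partial>lborel \<partial>N01)"
  proof (rule nn_integral_cong)
    fix x
    have "integrable lborel (?f x)" using I2[of x] by (simp add: set_integrable_def)
    from nn_integral_eq_integral[OF this] f0
    show "ennreal (?F x) = (\<integral>\<^sup>+t. ennreal (?f x t) \<partial>lborel)" by (simp add: set_lebesgue_integral_def)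
  qed
  also have "\<dots> = (\<integral>\<^sup>+t. \<integral>\<^sup>+x. ennreal (?f x t) \<partial>N01 \<partial>lborel)"
    by (rule P.Fubini'[symmetric]) measurable
  also have "\<dots> = (\<integral>\<^sup>+t. ennreal (?h t) \<partial>lborel)" by (simp only: inner)
  also have "\<dots> = ennreal (LBINT t. ?h t)"
    using I1 h0 by (intro nn_integral_eq_integral) (auto simp: set_integrable_def)
  also have "(LBINT t. ?h t) = (LBINT t:{0<..<1}. w t * (1 / sqrt (1 - t\<^sup>2) - a))"
    by (simp add: set_lebesgue_integral_def)
  finally have nn: "(\<integral>\<^sup>+x. ennreal (?F x) \<partial>N01) = ennreal (LBINT t:{0<..<1}. w t * (1 / sqrt (1 - t\<^sup>2) - a))" .
  have R0: "0 \<le> (LBINT t:{0<..<1}. w t * (1 / sqrt (1 - t\<^sup>2) - a))"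
    unfolding set_lebesgue_integral_def using h0 by (intro integral_nonneg_AE AE_I2) simp
  show "integrable N01 ?F"
    by (rule integrableI_nn_integral_finite[OF meas _ nn]) (use F0 in auto)
  show "(\<integral>x. ?F x \<partial>N01) = (LBINT t:{0<..<1}. w t * (1 / sqrt (1 - t\<^sup>2) - a))"
    using integral_eq_nn_integral[OF meas] F0 nn R0 by simp
qed

lemma N01_hs_ratio:
  assumes "0 < \<tau>"
  shows "integrable N01 (hs_ratio \<tau>)" "(\<integral>x. hs_ratio \<tau> x \<partial>N01) = 1"
proof -
  have w: "hs_kernel \<tau> \<in> borel_measurable borel" unfolding hs_kernel_def by measurable
  have w0: "\<And>t. 0 < t \<Longrightarrow> t < 1 \<Longrightarrow> 0 \<le> hs_kernel \<tau> t" using hs_kernel_pos[OF assms] by (simp add: less_imp_le)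
  note * = N01_exp_square_mixture[OF w w0, of 0, simplified, OF hs_kernel_arcsin_integral(1)[OF assms] hs_kernel_integrable'[OF assms]]
  show "integrable N01 (hs_ratio \<tau>)"
    unfolding hs_ratio_def using *(1) by (intro integrable_mult_right) auto
  show "(\<integral>x. hs_ratio \<tau> x \<partial>N01) = 1"
    unfolding hs_ratio_def using *(2) hs_kernel_arcsin_integral(2)[OF assms] by simp
qed

lemma N01_hs_G: "integrable N01 hs_G" "(\<integral>x. hs_G x \<partial>N01) = 1"
proof -
  have I1: "set_integrable lborel {0<..<1} (\<lambda>t. 1 / t\<^sup>2 * (1 / sqrt (1 - t\<^sup>2) - 1))"
    using arcsin_quot_integral(1) by simp
  have I2: "set_integrable lborel {0<..<1} (\<lambda>t. 1 / t\<^sup>2 * (exp (x\<^sup>2 * t\<^sup>2 / 2) - 1))" for x :: real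
    using hs_G_integrable[of "x\<^sup>2 / 2"] by simp
  have m: "(\<lambda>t::real. 1 / t\<^sup>2) \<in> borel_measurable borel" by measurable
  note * = N01_exp_square_mixture[of "\<lambda>t. 1 / t\<^sup>2" 1, OF m _ _ _ I1 I2]
  show "integrable N01 hs_G" using *(1) by (simp add: hs_G_def[abs_def])
  show "(\<integral>x. hs_G x \<partial>N01) = 1" using *(2) arcsin_quot_integral(2) by (simp add: hs_G_def)
qed

lemma N01_hs_g: "integrable N01 hs_g" "(\<integral>x. hs_g x \<partial>N01) = 0"
proof -
  interpret N: prob_space N01 by (rule prob_space_N01)
  have c: "integrable N01 (\<lambda>x. 1 :: real)" by (rule N.integrable_const)
  show "integrable N01 hs_g" unfolding hs_g_def[abs_def]
    by (intro integrable_mult_right Bochner_Integration.integrable_diff N01_hs_G c)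
  show "(\<integral>x. hs_g x \<partial>N01) = 0"
    unfolding hs_g_def using N01_hs_G c N.prob_space
    by (simp add: Bochner_Integration.integral_diff)
qed

section \<open>Two-sided bounds for G\<close>

lemma unit_integral_id_exp:
  assumes "0 < (y::real)"
  shows "set_integrable lborel {0<..<1} (\<lambda>t. t * exp (y * t\<^sup>2))"
    "(LBINT t:{0<..<1}. t * exp (y * t\<^sup>2)) = (exp y - 1) / (2 * y)"
proof -
  let ?F = "\<lambda>t. exp (y * t\<^sup>2) / (2 * y)"
  have D: "DERIV ?F t :> t * exp (y * t\<^sup>2)" for t
    using assms by (auto intro!: derivative_eq_intros simp: field_simps)
  have c: "isCont ?F t" for t using D DERIV_isCont by blast
  have L: "(?F \<longlongrightarrow> ?F 0) (at_right 0)" "(?F \<longlongrightarrow> ?F 1) (at_left 1)"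
    using c[of 0] c[of 1] by (auto simp: isCont_def intro: tendsto_within_subset)
  have C: "isCont (\<lambda>t. t * exp (y * t\<^sup>2)) t" for t by (intro continuous_intros)
  note * = set_integral_FTC_unit[OF D C _ L]
  show "set_integrable lborel {0<..<1} (\<lambda>t. t * exp (y * t\<^sup>2))" by (rule *(1)) auto
  show "(LBINT t:{0<..<1}. t * exp (y * t\<^sup>2)) = (exp y - 1) / (2 * y)"
    by (subst *(2)) (auto simp: diff_divide_distrib)
qed

lemma unit_integral_id: "set_integrable lborel {0<..<1} (\<lambda>t::real. t)" "(LBINT t:{0<..<1::real}. t) = 1 / 2"
proof -
  have D: "DERIV (\<lambda>t::real. t\<^sup>2 / 2) t :> t" for t by (auto intro!: derivative_eq_intros)
  have L: "((\<lambda>t::real. t\<^sup>2 / 2) \<longlongrightarrow> 0) (at_right 0)" "((\<lambda>t::real. t\<^sup>2 / 2) \<longlongrightarrow> 1 / 2) (at_left 1)"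
    by real_asymp+
  note * = set_integral_FTC_unit[OF D _ _ L]
  show "set_integrable lborel {0<..<1} (\<lambda>t::real. t)" by (rule *(1)) auto
  show "(LBINT t:{0<..<1::real}. t) = 1 / 2" by (subst *(2)) auto
qed

text \<open>Replacing 1/t^2 by t is sharp to first order, because the mass of the integral sits at t = 1.\<close>

lemma hs_G_lower:
  assumes "x \<noteq> 0"
  shows "(exp (x\<^sup>2 / 2) - 1) / x\<^sup>2 - 1 / 2 \<le> hs_G x"
proof -
  have y: "0 < x\<^sup>2 / 2" using assms by simp
  have "(exp (x\<^sup>2 / 2) - 1) / x\<^sup>2 - 1 / 2 = (LBINT t:{0<..<1}. t * exp (x\<^sup>2 / 2 * t\<^sup>2) - t)"
    using set_integral_diff(2)[OF unit_integral_id_exp(1)[OF y] unit_integral_id(1)]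
      unit_integral_id_exp(2)[OF y] unit_integral_id(2) by simp
  also have "\<dots> \<le> hs_G x"
    unfolding hs_G_altdef
  proof (rule set_integral_mono)
    show "set_integrable lborel {0<..<1} (\<lambda>t. t * exp (x\<^sup>2 / 2 * t\<^sup>2) - t)"
      by (rule set_integral_diff(1)[OF unit_integral_id_exp(1)[OF y] unit_integral_id(1)])
    fix t :: real assume t: "t \<in> {0<..<1}"
    have "t ^ 3 \<le> 1" using t by (intro power_le_one) auto
    then have "t \<le> 1 / t\<^sup>2" using t by (simp add: le_divide_eq power2_eq_square power3_eq_cube mult.assoc)
    then have "(exp (x\<^sup>2 / 2 * t\<^sup>2) - 1) * t \<le> (exp (x\<^sup>2 / 2 * t\<^sup>2) - 1) * (1 / t\<^sup>2)"
      by (intro mult_left_mono) auto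
    moreover have "t * exp (x\<^sup>2 / 2 * t\<^sup>2) - t = (exp (x\<^sup>2 / 2 * t\<^sup>2) - 1) * t" by (simp add: algebra_simps)
    ultimately show "t * exp (x\<^sup>2 / 2 * t\<^sup>2) - t \<le> (exp (x\<^sup>2 / 2 * t\<^sup>2) - 1) / t\<^sup>2" by simp
  qed (rule hs_G_integrable, simp)
  finally show ?thesis .
qed

text \<open>Below the cut a the quotient is at most y exp(y a^2), with y = x^2/2; above it, 1/t^2 <=
  t/a^3 leads to the explicit integral of t exp(y t^2). Letting a tend to 1 slowly makes the first
  part negligible and the constant of the second part sharp.\<close>

lemma hs_G_upper:
  assumes "x \<noteq> 0" "0 < a"
  shows "hs_G x \<le> x\<^sup>2 / 2 * exp (x\<^sup>2 / 2 * a\<^sup>2) + exp (x\<^sup>2 / 2) / (a ^ 3 * x\<^sup>2)"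
proof -
  define y where "y = x\<^sup>2 / 2"
  have y: "0 < y" using assms by (simp add: y_def)
  note I = unit_integral_id_exp[OF y]
  have J1: "set_integrable lborel {0<..<1} (\<lambda>t::real. y * exp (y * a\<^sup>2))"
    by (rule set_integrable_bounded_unit) auto
  have J2: "set_integrable lborel {0<..<1} (\<lambda>t. 1 / a ^ 3 * (t * exp (y * t\<^sup>2)))"
    by (intro set_integrable_mult_right impI I(1))
  have "hs_G x \<le> (LBINT t:{0<..<1}. y * exp (y * a\<^sup>2) + 1 / a ^ 3 * (t * exp (y * t\<^sup>2)))"
    unfolding hs_G_altdef y_def[symmetric]
  proof (rule set_integral_mono[OF hs_G_integrable set_integral_add(1)[OF J1 J2]])
    fix t :: real assume t: "t \<in> {0<..<1}"
    show "(exp (y * t\<^sup>2) - 1) / t\<^sup>2 \<le> y * exp (y * a\<^sup>2) + 1 / a ^ 3 * (t * exp (y * t\<^sup>2))"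
    proof (cases "t \<le> a")
      case True
      have "(exp (y * t\<^sup>2) - 1) / t\<^sup>2 \<le> y * exp (y * t\<^sup>2)" using exp_quot_le t by simp
      also have "\<dots> \<le> y * exp (y * a\<^sup>2)" using True t y by (simp add: power_mono)
      moreover have "0 \<le> 1 / a ^ 3 * (t * exp (y * t\<^sup>2))" using assms t by simp
      ultimately show ?thesis by linarith
    next
      case False
      have "a ^ 3 \<le> t ^ 3" using False assms by (intro power_mono) auto
      then have "1 / t\<^sup>2 \<le> t / a ^ 3" using t assms
        by (simp add: divide_simps power2_eq_square power3_eq_cube mult_ac)
      then have "exp (y * t\<^sup>2) * (1 / t\<^sup>2) \<le> exp (y * t\<^sup>2) * (t / a ^ 3)"
        by (intro mult_left_mono) auto
      moreover have "(exp (y * t\<^sup>2) - 1) / t\<^sup>2 \<le> exp (y * t\<^sup>2) * (1 / t\<^sup>2)"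
        by (simp add: divide_right_mono)
      moreover have "0 \<le> y * exp (y * a\<^sup>2)" using y by simp
      moreover have "1 / a ^ 3 * (t * exp (y * t\<^sup>2)) = exp (y * t\<^sup>2) * (t / a ^ 3)" by simp
      ultimately show ?thesis by linarith
    qed
  qed (use y in auto)
  also have "\<dots> = y * exp (y * a\<^sup>2) + 1 / a ^ 3 * ((exp y - 1) / (2 * y))"
  proof -
    have "(LBINT t:{0<..<1::real}. y * exp (y * a\<^sup>2)) = y * exp (y * a\<^sup>2)"
      by (simp add: set_lebesgue_integral_def)
    then show ?thesis
      by (simp only: set_integral_add(2)[OF J1 J2] set_integral_mult_right I(2))
  qed
  also have "\<dots> \<le> y * exp (y * a\<^sup>2) + 1 / a ^ 3 * (exp y / (2 * y))"
    using y assms by (intro add_left_mono mult_left_mono divide_right_mono) auto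
  finally show ?thesis by (simp add: y_def)
qed

section \<open>Asymptotics of the score\<close>

lemma hs_G_asymp: "((\<lambda>x. x\<^sup>2 * exp (- x\<^sup>2 / 2) * hs_G x) \<longlongrightarrow> 1) at_top"
proof (rule tendsto_sandwich)
  show "\<forall>\<^sub>F x in at_top. x\<^sup>2 * exp (- x\<^sup>2 / 2) * ((exp (x\<^sup>2 / 2) - 1) / x\<^sup>2 - 1 / 2) \<le> x\<^sup>2 * exp (- x\<^sup>2 / 2) * hs_G x"
    using eventually_gt_at_top[of 0] by eventually_elim (intro mult_left_mono hs_G_lower, auto)
  \<comment> \<open>The cut is a = sqrt (1 - 1/x): then a tends to 1, while exp(x^2 a^2/2) is
    smaller than exp(x^2/2) by the factor exp(-x/2), which beats every power of x.\<close>
  show "\<forall>\<^sub>F x in at_top. x\<^sup>2 * exp (- x\<^sup>2 / 2) * hs_G x \<le>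
      x\<^sup>2 * exp (- x\<^sup>2 / 2) * (x\<^sup>2 / 2 * exp (x\<^sup>2 / 2 * (sqrt (1 - 1 / x))\<^sup>2) + exp (x\<^sup>2 / 2) / (sqrt (1 - 1 / x) ^ 3 * x\<^sup>2))"
    using eventually_gt_at_top[of 1] by eventually_elim (intro mult_left_mono hs_G_upper, auto)
  show "((\<lambda>x. x\<^sup>2 * exp (- x\<^sup>2 / 2) * ((exp (x\<^sup>2 / 2) - 1) / x\<^sup>2 - 1 / 2)) \<longlongrightarrow> 1) (at_top :: real filter)"
    by real_asymp
  show "((\<lambda>x. x\<^sup>2 * exp (- x\<^sup>2 / 2) * (x\<^sup>2 / 2 * exp (x\<^sup>2 / 2 * (sqrt (1 - 1 / x))\<^sup>2) + exp (x\<^sup>2 / 2) / (sqrt (1 - 1 / x) ^ 3 * x\<^sup>2))) \<longlongrightarrow> 1) (at_top :: real filter)"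
    by real_asymp
qed

lemma std_normal_density_hs_g_asymp:
  "((\<lambda>x. std_normal_density x * hs_g x * x\<^sup>2) \<longlongrightarrow> C_star / 2) at_top"
proof -
  have "((\<lambda>x. 2 / (pi * sqrt (2 * pi)) * (x\<^sup>2 * exp (- x\<^sup>2 / 2) * hs_G x - x\<^sup>2 * exp (- x\<^sup>2 / 2))) \<longlongrightarrow> 2 / (pi * sqrt (2 * pi)) * (1 - 0)) at_top"
  proof (intro tendsto_intros hs_G_asymp)
    show "((\<lambda>x. x\<^sup>2 * exp (- x\<^sup>2 / 2)) \<longlongrightarrow> 0) (at_top :: real filter)" by real_asymp
  qed
  also have "(\<lambda>x. 2 / (pi * sqrt (2 * pi)) * (x\<^sup>2 * exp (- x\<^sup>2 / 2) * hs_G x - x\<^sup>2 * exp (- x\<^sup>2 / 2))) = (\<lambda>x. std_normal_density x * hs_g x * x\<^sup>2)"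
    by (rule ext) (simp add: std_normal_density_def hs_g_def field_simps)
  also have "2 / (pi * sqrt (2 * pi)) * (1 - 0) = C_star / 2"
  proof -
    have "C_star = (2 / pi) powr (1 + 1 / 2)" by (simp add: C_star_def)
    also have "\<dots> = 2 / pi * sqrt (2 / pi)" by (subst powr_add) (simp add: powr_half_sqrt)
    also have "sqrt (2 / pi) = sqrt (2\<^sup>2 / (2 * pi))" by (simp add: power2_eq_square)
    also have "\<dots> = 2 / sqrt (2 * pi)" by (subst real_sqrt_divide) simp
    finally show ?thesis by simp
  qed
  finally show ?thesis .
qed

text \<open>An envelope valid for all x with the true decay 1/x^2, so that after rescaling it
  supplies an integrable dominating function. With y = x^2/2, the range y < 1 uses G <= y exp y and
  the rest uses \<open>hs_G_upper\<close> with a = 1/2; the constants are crude.\<close>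

lemma std_normal_density_hs_g_bound: "std_normal_density x * \<bar>hs_g x\<bar> \<le> 25 / (1 + x\<^sup>2)"
proof -
  define y where "y = x\<^sup>2 / 2"
  have y: "0 \<le> y" by (simp add: y_def)
  have e2: "1 + 2 * y \<le> 2 * exp y" using exp_ge_add_one_self[of y] y by linarith
  have G: "exp (- y) * hs_G x * (1 + 2 * y) \<le> 23"
  proof (cases "y < 1")
    case True
    have "hs_G x \<le> y * exp y"
    proof -
      have "hs_G x \<le> (LBINT t:{0<..<1::real}. y * exp y)"
        unfolding hs_G_altdef y_def[symmetric]
      proof (rule set_integral_mono[OF hs_G_integrable[OF y]])
        show "set_integrable lborel {0<..<1} (\<lambda>t::real. y * exp y)"
          by (rule set_integrable_bounded_unit) auto
        fix t :: real assume t: "t \<in> {0<..<1}"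
        have "(exp (y * t\<^sup>2) - 1) / t\<^sup>2 \<le> y * exp (y * t\<^sup>2)" using exp_quot_le t by simp
        also have "\<dots> \<le> y * exp y"
          using y unit_sq_less[of t] t mult_left_mono[of "t\<^sup>2" 1 y] by (intro mult_left_mono) auto
        finally show "(exp (y * t\<^sup>2) - 1) / t\<^sup>2 \<le> y * exp y" .
      qed
      also have "\<dots> = y * exp y" by (simp add: set_lebesgue_integral_def)
      finally show ?thesis .
    qed
    then have "exp (- y) * hs_G x \<le> exp (- y) * (y * exp y)" by (intro mult_left_mono) auto
    moreover have "exp (- y) * (y * exp y) = y" by (simp add: exp_minus)
    ultimately have "exp (- y) * hs_G x \<le> y" by simp
    then have "exp (- y) * hs_G x * (1 + 2 * y) \<le> 1 * 3" using True y hs_G_nonneg[of x] by (intro mult_mono) auto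
    then show ?thesis by simp
  next
    case False
    then have y1: "1 \<le> y" by simp
    then have x0: "x \<noteq> 0" by (auto simp: y_def)
    have x2: "x\<^sup>2 = 2 * y" by (simp add: y_def)
    have "hs_G x \<le> y * exp (y * (1/2)\<^sup>2) + exp y / ((1/2) ^ 3 * (2 * y))"
      using hs_G_upper[OF x0, of "1/2"] unfolding x2 by simp
    also have "\<dots> = y * exp (y / 4) + 4 * exp y / y"
      using y1 by (simp add: power2_eq_square power3_eq_cube field_simps)
    finally have "exp (- y) * hs_G x \<le> exp (- y) * (y * exp (y / 4) + 4 * exp y / y)"
      by (intro mult_left_mono) auto
    also have "\<dots> = y * exp (- (3 * y / 4)) + 4 / y"
    proof -
      have "exp (- y) * exp (y / 4) = exp (- (3 * y / 4))" unfolding exp_add[symmetric] by (simp add: field_simps)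
      moreover have "exp (- y) * exp y = 1" by (simp add: exp_minus)
      ultimately show ?thesis by (simp add: algebra_simps add_divide_distrib)
    qed
    finally have "exp (- y) * hs_G x * (1 + 2 * y) \<le> (y * exp (- (3 * y / 4)) + 4 / y) * (3 * y)"
      using y1 hs_G_nonneg[of x] by (intro mult_mono) auto
    also have "\<dots> = 3 * (y\<^sup>2 * exp (- (3 * y / 4))) + 12" using y1 by (simp add: field_simps power2_eq_square)
    also have "y\<^sup>2 * exp (- (3 * y / 4)) \<le> 32 / 9"
    proof -
      have "1 + 3 * y / 4 + (3 * y / 4)\<^sup>2 / 2 \<le> exp (3 * y / 4)" using y by (intro exp_lower_Taylor_quadratic) auto
      then have "(3 * y / 4)\<^sup>2 / 2 \<le> exp (3 * y / 4)" using y by linarith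
      then have "y\<^sup>2 \<le> 32 / 9 * exp (3 * y / 4)" by (simp add: power2_eq_square field_simps)
      then have "y\<^sup>2 * exp (- (3 * y / 4)) \<le> (32 / 9 * exp (3 * y / 4)) * exp (- (3 * y / 4))" by (intro mult_right_mono) auto
      also have "\<dots> = 32 / 9" by (simp add: exp_minus)
      finally show ?thesis .
    qed
    finally show ?thesis by simp
  qed
  have "\<bar>hs_g x\<bar> \<le> 1 * (hs_G x + 1)"
    unfolding hs_g_def abs_mult using pi_gt3 hs_G_nonneg[of x] by (intro mult_mono) auto
  then have "exp (- y) * \<bar>hs_g x\<bar> * (1 + 2 * y) \<le> exp (- y) * (1 * (hs_G x + 1)) * (1 + 2 * y)"
    using y by (intro mult_right_mono mult_left_mono) auto
  also have "\<dots> = exp (- y) * hs_G x * (1 + 2 * y) + exp (- y) * (1 + 2 * y)" by (simp add: algebra_simps)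
  also have "exp (- y) * (1 + 2 * y) \<le> exp (- y) * (2 * exp y)" using e2 by (intro mult_left_mono) auto
  also have "\<dots> = 2" by (simp add: exp_minus)
  finally have "exp (- y) * \<bar>hs_g x\<bar> * (1 + 2 * y) \<le> 25" using G by simp
  then have "exp (- y) * \<bar>hs_g x\<bar> \<le> 25 / (1 + x\<^sup>2)"
    by (simp add: le_divide_eq y_def add_pos_nonneg)
  moreover have "std_normal_density x * \<bar>hs_g x\<bar> \<le> exp (- y) * \<bar>hs_g x\<bar>"
  proof (rule mult_right_mono)
    have "1 \<le> sqrt (2 * pi)" using pi_gt3 by simp
    then show "std_normal_density x \<le> exp (- y)" by (simp add: std_normal_density_def y_def divide_le_eq)
  qed simp
  ultimately show ?thesis by linarith
qed

lemma hs_g_abs_le: "\<bar>hs_g x\<bar> \<le> 75 * exp (x\<^sup>2 / 2)"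
proof -
  have "std_normal_density x * \<bar>hs_g x\<bar> \<le> 25 / 1"
    by (rule order_trans[OF std_normal_density_hs_g_bound]) (simp add: divide_le_eq add_pos_nonneg)
  then have "\<bar>hs_g x\<bar> \<le> 25 * (sqrt (2 * pi) * exp (x\<^sup>2 / 2))"
    by (simp add: std_normal_density_def exp_minus field_simps)
  also have "\<dots> \<le> 25 * (3 * exp (x\<^sup>2 / 2))"
  proof (intro mult_left_mono mult_right_mono)
    show "sqrt (2 * pi) \<le> 3" using pi_less_4 by (intro real_le_lsqrt) auto
  qed auto
  finally show ?thesis by simp
qed

text \<open>T times the derivative of ln (1 + T g(x)) in T. It is bounded, and for T =
  \<open>hs_T \<kappa> z\<close> it acts as a smooth indicator of |x| > z.\<close>

definition hs_w :: "real \<Rightarrow> real \<Rightarrow> real" where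
  "hs_w T x = T * hs_g x / (1 + T * hs_g x)"

lemma measurable_hs_w[measurable]: "hs_w T \<in> borel_measurable borel"
  unfolding hs_w_def by measurable

lemma hs_w_minus [simp]: "hs_w T (- x) = hs_w T x" by (simp add: hs_w_def)

lemma hs_w_bounds:
  assumes "0 \<le> T" "T \<le> 1"
  shows "\<bar>hs_w T x\<bar> \<le> 2" "\<bar>hs_w T x\<bar> \<le> 3 * T * \<bar>hs_g x\<bar>" "hs_w T x = 1 - 1 / (1 + T * hs_g x)"
proof -
  have p: "1 / 3 \<le> 1 + T * hs_g x" by (rule hs_linear_pos[OF assms])
  then have 0: "0 < 1 + T * hs_g x" by linarith
  show w: "hs_w T x = 1 - 1 / (1 + T * hs_g x)" using 0 by (simp add: hs_w_def field_simps)
  define r where "r = 1 / (1 + T * hs_g x)"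
  have "r \<le> 1 / (1 / 3)" unfolding r_def using p 0 by (intro divide_left_mono) auto
  then have "r \<le> 3" by simp
  moreover have "0 \<le> r" using 0 by (simp add: r_def)
  ultimately show "\<bar>hs_w T x\<bar> \<le> 2" unfolding w r_def[symmetric] by linarith
  have "\<bar>hs_w T x\<bar> = (T * \<bar>hs_g x\<bar>) / (1 + T * hs_g x)" using 0 assms by (simp add: hs_w_def abs_mult)
  also have "\<dots> \<le> (T * \<bar>hs_g x\<bar>) / (1 / 3)" using p 0 assms by (intro divide_left_mono) auto
  finally show "\<bar>hs_w T x\<bar> \<le> 3 * T * \<bar>hs_g x\<bar>" by simp
qed

text \<open>At z = zeta one has exp(-z^2/2) = s/n, so this is kappa (s/n) zeta. Written as a
  function of z alone, it lets all limits be taken along one real variable.\<close>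

definition hs_T :: "real \<Rightarrow> real \<Rightarrow> real" where
  "hs_T \<kappa> z = \<kappa> * z * exp (- z\<^sup>2 / 2)"

lemma hs_T_tendsto_0: "(hs_T \<kappa> \<longlongrightarrow> 0) at_top"
  unfolding hs_T_def by (cases \<kappa> "0::real" rule: linorder_cases) (real_asymp, simp, real_asymp)

lemma eventually_hs_T:
  assumes "0 < \<kappa>" "0 < e"
  shows "\<forall>\<^sub>F z in at_top. 0 < hs_T \<kappa> z \<and> hs_T \<kappa> z < e"
  using order_tendstoD(2)[OF hs_T_tendsto_0 assms(2), of \<kappa>] eventually_gt_at_top[of 0]
  by eventually_elim (use assms in \<open>simp add: hs_T_def\<close>)

lemma hs_w_tendsto_1:
  assumes "filterlim (\<lambda>z. T z * hs_g (f z)) at_top F" "\<forall>\<^sub>F z in F. 0 \<le> T z \<and> T z \<le> 1"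
  shows "((\<lambda>z. hs_w (T z) (f z)) \<longlongrightarrow> 1) F"
proof -
  have "filterlim (\<lambda>z. 1 + T z * hs_g (f z)) at_top F"
    by (intro filterlim_tendsto_add_at_top[OF tendsto_const] assms)
  then have "((\<lambda>z. 1 / (1 + T z * hs_g (f z))) \<longlongrightarrow> 0) F"
    by (intro tendsto_divide_0[OF tendsto_const] filterlim_at_top_imp_at_infinity)
  from tendsto_diff[OF tendsto_const this, of 1]
  have "((\<lambda>z. 1 - 1 / (1 + T z * hs_g (f z))) \<longlongrightarrow> 1) F" by simp
  then show ?thesis
    by (rule Lim_transform_eventually) (use assms(2) hs_w_bounds(3) in \<open>auto elim!: eventually_mono\<close>)
qed

lemma hs_w_tendsto_0:
  assumes "((\<lambda>z. T z * \<bar>hs_g (f z)\<bar>) \<longlongrightarrow> 0) F" "\<forall>\<^sub>F z in F. 0 \<le> T z \<and> T z \<le> 1"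
  shows "((\<lambda>z. hs_w (T z) (f z)) \<longlongrightarrow> 0) F"
proof (rule Lim_null_comparison)
  show "((\<lambda>z. 3 * (T z * \<bar>hs_g (f z)\<bar>)) \<longlongrightarrow> 0) F" using tendsto_mult_right_zero[OF assms(1), of 3] by simp
  show "\<forall>\<^sub>F z in F. norm (hs_w (T z) (f z)) \<le> 3 * (T z * \<bar>hs_g (f z)\<bar>)"
    using assms(2) by eventually_elim (use hs_w_bounds(2) in \<open>simp add: mult.assoc\<close>)
qed

lemma hs_T_01: "0 < \<kappa> \<Longrightarrow> \<forall>\<^sub>F z in at_top. 0 \<le> hs_T \<kappa> z \<and> hs_T \<kappa> z \<le> 1"
  by (rule eventually_mono[OF eventually_hs_T[of \<kappa> 1]]) auto

lemma hs_g_lower: "x \<noteq> 0 \<Longrightarrow> 1 / 2 * (exp (x\<^sup>2 / 2) - 1) / x\<^sup>2 - 1 \<le> hs_g x"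
proof -
  assume x: "x \<noteq> 0"
  define p where "p = 2 / pi"
  define A where "A = (exp (x\<^sup>2 / 2) - 1) / x\<^sup>2"
  have p: "1 / 2 \<le> p" "p \<le> 2 / 3" using two_div_pi by (simp_all add: p_def)
  have "0 \<le> A" by (simp add: A_def)
  then have "1 / 2 * A \<le> p * A" using p by (intro mult_right_mono) auto
  moreover have "p * (A - 1 / 2) \<le> p * hs_G x"
    using hs_G_lower[OF x] p by (intro mult_left_mono) (auto simp: A_def)
  moreover have "hs_g x = p * hs_G x - p" by (simp add: hs_g_def p_def right_diff_distrib)
  ultimately have "1 / 2 * A - 1 \<le> hs_g x" using p by (simp add: right_diff_distrib)
  then show ?thesis by (simp add: A_def)
qed

text \<open>T g(z + a) is of order exp(a z)/z: it diverges for a > 0 and vanishes for a < 0. So the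
  transition sits at |x| = z to within o(1), whatever kappa is.\<close>

lemma hs_w_shift_tendsto:
  assumes \<kappa>: "0 < \<kappa>" and "a \<noteq> 0"
  shows "((\<lambda>z. hs_w (hs_T \<kappa> z) (z + a)) \<longlongrightarrow> indicator {0<..} a) at_top"
proof (cases "a > 0")
  case True
  have "filterlim (\<lambda>z. hs_T \<kappa> z * (1 / 2 * (exp ((z + a)\<^sup>2 / 2) - 1) / (z + a)\<^sup>2 - 1)) at_top at_top"
    unfolding hs_T_def using \<kappa> True by real_asymp
  moreover have "\<forall>\<^sub>F z in at_top. hs_T \<kappa> z * (1 / 2 * (exp ((z + a)\<^sup>2 / 2) - 1) / (z + a)\<^sup>2 - 1) \<le> hs_T \<kappa> z * hs_g (z + a)"
    using hs_T_01[OF \<kappa>] eventually_gt_at_top[of 0]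
    by eventually_elim (use True in \<open>intro mult_left_mono hs_g_lower, auto\<close>)
  ultimately have "filterlim (\<lambda>z. hs_T \<kappa> z * hs_g (z + a)) at_top at_top"
    by (rule filterlim_at_top_mono)
  from hs_w_tendsto_1[OF this hs_T_01[OF \<kappa>]] True show ?thesis by simp
next
  case False
  with assms have a: "a < 0" by simp
  have "((\<lambda>z. hs_T \<kappa> z * \<bar>hs_g (z + a)\<bar>) \<longlongrightarrow> 0) at_top"
  proof (rule Lim_null_comparison)
    show "\<forall>\<^sub>F z in at_top. norm (hs_T \<kappa> z * \<bar>hs_g (z + a)\<bar>) \<le> hs_T \<kappa> z * (75 * exp ((z + a)\<^sup>2 / 2))"
      using hs_T_01[OF \<kappa>] by eventually_elim (use hs_g_abs_le in \<open>auto simp: abs_mult intro!: mult_left_mono\<close>)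
    show "((\<lambda>z. hs_T \<kappa> z * (75 * exp ((z + a)\<^sup>2 / 2))) \<longlongrightarrow> 0) at_top"
      unfolding hs_T_def using \<kappa> a by real_asymp
  qed
  from hs_w_tendsto_0[OF this hs_T_01[OF \<kappa>]] a show ?thesis by simp
qed

text \<open>On the multiplicative scale, T g(z v) behaves like exp((v^2 - 1) z^2/2) up to powers of
  z, so the sign of v - 1 decides the limit.\<close>

lemma hs_w_scale_tendsto:
  assumes \<kappa>: "0 < \<kappa>" and v: "0 < v" "v \<noteq> 1"
  shows "((\<lambda>z. hs_w (hs_T \<kappa> z) (z * v)) \<longlongrightarrow> indicator {1<..} v) at_top"
proof (cases "v > 1")
  case True
  define d where "d = (v\<^sup>2 - 1) / 2"
  have d: "0 < d" using True by (simp add: d_def)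
  have c: "0 < v\<^sup>2" using True by simp
  have "filterlim (\<lambda>z. \<kappa> * z * (1 / 2 * (exp (d * z\<^sup>2) - 1) / (z\<^sup>2 * v\<^sup>2) - 1)) at_top at_top"
    using \<kappa> d c by real_asymp
  moreover have "\<forall>\<^sub>F z in at_top. \<kappa> * z * (1 / 2 * (exp (d * z\<^sup>2) - 1) / (z\<^sup>2 * v\<^sup>2) - 1) \<le> hs_T \<kappa> z * hs_g (z * v)"
    using hs_T_01[OF \<kappa>] eventually_gt_at_top[of 0]
  proof eventually_elim
    case (elim z)
    \<comment> \<open>Multiplying by \<open>e\<close> before estimating merges the two exponentials
      into exp (d z^2); replacing the leftover \<open>e\<close> by 1 only lowers the bound.\<close>
    define e where "e = exp (- z\<^sup>2 / 2)"
    have e: "0 < e" "e \<le> 1" by (simp_all add: e_def)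
    have "exp (d * z\<^sup>2) = e * exp ((z * v)\<^sup>2 / 2)"
      unfolding e_def exp_add[symmetric] power_mult_distrib d_def by (simp add: field_simps)
    moreover have "e * (1 / 2 * (X - 1) / Y - 1) = 1 / 2 * (e * X - e) / Y - e" for X Y :: real
      by (simp add: right_diff_distrib)
    ultimately have 1: "e * (1 / 2 * (exp ((z * v)\<^sup>2 / 2) - 1) / (z * v)\<^sup>2 - 1) = 1 / 2 * (exp (d * z\<^sup>2) - e) / (z\<^sup>2 * v\<^sup>2) - e"
      by (simp only: power_mult_distrib)
    have 2: "1 / 2 * (exp (d * z\<^sup>2) - 1) / (z\<^sup>2 * v\<^sup>2) - 1 \<le> 1 / 2 * (exp (d * z\<^sup>2) - e) / (z\<^sup>2 * v\<^sup>2) - e"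
      using e by (intro diff_mono divide_right_mono mult_left_mono) auto
    have "1 / 2 * (exp ((z * v)\<^sup>2 / 2) - 1) / (z * v)\<^sup>2 - 1 \<le> hs_g (z * v)"
      using elim True by (intro hs_g_lower) auto
    then have "e * (1 / 2 * (exp ((z * v)\<^sup>2 / 2) - 1) / (z * v)\<^sup>2 - 1) \<le> e * hs_g (z * v)"
      using e by (intro mult_left_mono) auto
    then have "1 / 2 * (exp (d * z\<^sup>2) - 1) / (z\<^sup>2 * v\<^sup>2) - 1 \<le> e * hs_g (z * v)"
      using 2 unfolding 1 by (rule order_trans[rotated])
    then have "\<kappa> * z * (1 / 2 * (exp (d * z\<^sup>2) - 1) / (z\<^sup>2 * v\<^sup>2) - 1) \<le> \<kappa> * z * (e * hs_g (z * v))"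
      using \<kappa> elim by (intro mult_left_mono) auto
    then show ?case by (simp add: hs_T_def e_def mult.assoc)
  qed
  ultimately have "filterlim (\<lambda>z. hs_T \<kappa> z * hs_g (z * v)) at_top at_top"
    by (rule filterlim_at_top_mono)
  from hs_w_tendsto_1[OF this hs_T_01[OF \<kappa>]] True show ?thesis by simp
next
  case False
  define d where "d = (1 - v\<^sup>2) / 2"
  have "v\<^sup>2 < 1" using False v by (simp add: power_less_one_iff)
  then have d: "0 < d" by (simp add: d_def)
  have "((\<lambda>z. hs_T \<kappa> z * \<bar>hs_g (z * v)\<bar>) \<longlongrightarrow> 0) at_top"
  proof (rule Lim_null_comparison)
    show "\<forall>\<^sub>F z in at_top. norm (hs_T \<kappa> z * \<bar>hs_g (z * v)\<bar>) \<le> 75 * \<kappa> * z * exp (- d * z\<^sup>2)"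
      using hs_T_01[OF \<kappa>] 
    proof eventually_elim
      case (elim z)
      have "norm (hs_T \<kappa> z * \<bar>hs_g (z * v)\<bar>) \<le> hs_T \<kappa> z * (75 * exp ((z * v)\<^sup>2 / 2))"
        using elim hs_g_abs_le[of "z * v"] by (auto simp: abs_mult intro!: mult_left_mono)
      also have "\<dots> = 75 * \<kappa> * z * (exp (- z\<^sup>2 / 2) * exp ((z * v)\<^sup>2 / 2))" by (simp add: hs_T_def)
      also have "exp (- z\<^sup>2 / 2) * exp ((z * v)\<^sup>2 / 2) = exp (- d * z\<^sup>2)"
        unfolding exp_add[symmetric] power_mult_distrib d_def by (simp add: field_simps)
      finally show ?case .
    qed
    show "((\<lambda>z. 75 * \<kappa> * z * exp (- d * z\<^sup>2)) \<longlongrightarrow> 0) at_top"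
      using \<kappa> d by real_asymp
  qed
  from hs_w_tendsto_0[OF this hs_T_01[OF \<kappa>]] False show ?thesis by simp
qed

section \<open>Limits of the signal mean and of the null mean\<close>

lemma N01_integral_uminus:
  fixes f :: "real \<Rightarrow> real"
  assumes [measurable]: "f \<in> borel_measurable borel"
  shows "(\<integral>x. f (- x) \<partial>N01) = (\<integral>x. f x \<partial>N01)"
proof -
  have "(\<integral>x. f x \<partial>N01) = (LBINT x. std_normal_density x * f x)" by (subst integral_density) auto
  also have "\<dots> = (LBINT x. std_normal_density (- x) * f (- x))"
    using lborel_integral_real_affine[of "-1" "\<lambda>x. std_normal_density x * f x" 0] by simp
  also have "\<dots> = (LBINT x. std_normal_density x * f (- x))" by (simp add: std_normal_density_def)
  also have "\<dots> = (\<integral>x. f (- x) \<partial>N01)" by (subst integral_density) auto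
  finally show ?thesis by simp
qed

lemma AE_N01_neq: "AE x in N01. x \<noteq> c"
  using AE_lborel_singleton[of c] by (subst AE_density) auto

text \<open>A signal z + b - x exceeds the threshold z exactly when the noise x is below b, so
  bounded convergence of the smooth indicator gives the distribution function at b.\<close>

lemma hs_w_signal_mean:
  assumes \<kappa>: "0 < \<kappa>"
  shows "((\<lambda>z. \<integral>x. hs_w (hs_T \<kappa> z) (z + b - x) \<partial>N01) \<longlongrightarrow> cdf N01 b) at_top"
proof -
  interpret N: prob_space N01 by (rule prob_space_N01)
  have "((\<lambda>z. \<integral>x. hs_w (hs_T \<kappa> z) (z + b - x) \<partial>N01) \<longlongrightarrow> (\<integral>x. indicator {..<b} x \<partial>N01)) at_top"
  proof (rule integral_dominated_convergence_at_top[where w="\<lambda>_. 2"])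
    show "AE x in N01. ((\<lambda>z. hs_w (hs_T \<kappa> z) (z + b - x)) \<longlongrightarrow> indicator {..<b} x) at_top"
      using AE_N01_neq[of b]
    proof eventually_elim
      case (elim x)
      have "indicator {0<..} (b - x) = (indicator {..<b} x :: real)" by (auto split: split_indicator)
      then show ?case using hs_w_shift_tendsto[OF \<kappa>, of "b - x"] elim by (simp add: add_diff_eq)
    qed
    show "\<forall>\<^sub>F z in at_top. AE x in N01. norm (hs_w (hs_T \<kappa> z) (z + b - x)) \<le> 2"
      using hs_T_01[OF \<kappa>] by eventually_elim (use hs_w_bounds(1) in auto)
  qed (auto intro: N.integrable_const)
  also have "(\<integral>x. indicator {..<b} x \<partial>N01) = cdf N01 b"
  proof -
    have "(\<integral>x. indicator {..<b} x \<partial>N01) = (\<integral>x. indicator {..b} x \<partial>N01 :: real)"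
      using AE_N01_neq[of b] by (intro integral_cong_AE) (auto elim!: eventually_mono split: split_indicator)
    then show ?thesis by (simp add: cdf_def)
  qed
  finally show ?thesis .
qed

lemma integral_inverse_square_tails:
  "integrable lborel (\<lambda>v::real. indicator {1<..} \<bar>v\<bar> / v\<^sup>2)" "(LBINT v. indicator {1<..} \<bar>v\<bar> / v\<^sup>2) = (2::real)"
proof -
  have D: "DERIV (\<lambda>v. - 1 / v) v :> 1 / v\<^sup>2" if "(1::ereal) < ereal v" "ereal v < \<infinity>" for v
    using that by (auto intro!: derivative_eq_intros simp: one_ereal_def power2_eq_square)
  have C: "isCont (\<lambda>v. 1 / v\<^sup>2) v" if "(1::ereal) < ereal v" "ereal v < \<infinity>" for v :: real
    using that by (intro continuous_intros) (auto simp: one_ereal_def)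
  have c1: "((\<lambda>v::real. - 1 / v) \<longlongrightarrow> - 1) (at_right 1)" "((\<lambda>v::real. - 1 / v) \<longlongrightarrow> 0) at_top"
    by real_asymp+
  have L: "(((\<lambda>v. - 1 / v) \<circ> real_of_ereal) \<longlongrightarrow> - 1) (at_right 1)"
    "(((\<lambda>v. - 1 / v) \<circ> real_of_ereal) \<longlongrightarrow> 0) (at_left \<infinity>)"
    by (simp_all only: one_ereal_def ereal_tendsto_simps c1)
  note FTC = interval_integral_FTC_nonneg[OF _ D C _ L, simplified]
  have e: "einterval 1 \<infinity> = ({1<..} :: real set)" by (simp add: einterval_eq one_ereal_def)
  let ?f = "\<lambda>v::real. indicator {1<..} v / v\<^sup>2"
  have i1: "integrable lborel ?f" using FTC(1) by (simp add: e set_integrable_def)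
  have v1: "(LBINT v. ?f v) = 1"
    using FTC(2) by (simp add: e interval_lebesgue_integral_def set_lebesgue_integral_def)
  have i2: "integrable lborel (\<lambda>v. ?f (- v))"
    using lborel_integrable_real_affine[OF i1, of "-1" 0] by simp
  have v2: "(LBINT v. ?f (- v)) = 1"
    using lborel_integral_real_affine[of "-1" ?f 0] v1 by simp
  have eq: "(\<lambda>v::real. indicator {1<..} \<bar>v\<bar> / v\<^sup>2) = (\<lambda>v. ?f v + ?f (- v) :: real)"
    by (rule ext) (auto split: split_indicator)
  show "integrable lborel (\<lambda>v::real. indicator {1<..} \<bar>v\<bar> / v\<^sup>2 :: real)"
    unfolding eq by (intro Bochner_Integration.integrable_add i1 i2)
  show "(LBINT v. indicator {1<..} \<bar>v\<bar> / v\<^sup>2) = (2::real)"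
    unfolding eq by (subst Bochner_Integration.integral_add[OF i1 i2]) (use v1 v2 in simp)
qed

text \<open>Substituting x = z v gives one factor z from the Jacobian and one from the prefactor;
  the resulting z^2 compensates the decay phi g ~ (C_star/2)/x^2. The rescaled integrand tends to
  (C_star/2)/v^2 on |v| > 1 and to 0 on |v| < 1, and the two tails integrate to C_star.\<close>

lemma hs_null_mean_scaled:
  assumes \<kappa>: "0 < \<kappa>"
  shows "((\<lambda>z. z * (\<integral>x. hs_g x * hs_w (hs_T \<kappa> z) x \<partial>N01)) \<longlongrightarrow> C_star) at_top"
proof -
  define s where "s = (\<lambda>z v. z\<^sup>2 * (std_normal_density (z * v) * hs_g (z * v) * hs_w (hs_T \<kappa> z) (z * v)))"
  have even: "s z v = s z \<bar>v\<bar>" for z v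
    by (cases "0 \<le> v") (simp_all add: s_def std_normal_density_def)
  have "((\<lambda>z. LBINT v. s z v) \<longlongrightarrow> (LBINT v. C_star / 2 * (indicator {1<..} \<bar>v\<bar> / v\<^sup>2))) at_top"
  proof (rule integral_dominated_convergence_at_top[where w="\<lambda>v. 250 * inverse (1 + v\<^sup>2)"])
    show "integrable lborel (\<lambda>v::real. 250 * inverse (1 + v\<^sup>2))"
      using integrable_inverse_1_plus_square by (intro integrable_mult_right) (simp add: set_integrable_def)
    have "AE v in lborel. v \<noteq> 0 \<and> v \<noteq> 1 \<and> v \<noteq> (-1::real)"
      using AE_lborel_singleton[of 0] AE_lborel_singleton[of 1] AE_lborel_singleton[of "-1"]
      by eventually_elim auto
    then show "AE v in lborel. ((\<lambda>z. s z v) \<longlongrightarrow> C_star / 2 * (indicator {1<..} \<bar>v\<bar> / v\<^sup>2)) at_top"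
    proof eventually_elim
      case (elim v)
      define u where "u = \<bar>v\<bar>"
      have u: "0 < u" "u \<noteq> 1" using elim by (auto simp: u_def)
      have lim: "filterlim (\<lambda>z. z * u) at_top at_top"
        using filterlim_tendsto_pos_mult_at_top[OF tendsto_const u(1) filterlim_ident] by (simp add: mult.commute)
      have "((\<lambda>z. (std_normal_density (z * u) * hs_g (z * u) * (z * u)\<^sup>2) * hs_w (hs_T \<kappa> z) (z * u) / u\<^sup>2) \<longlongrightarrow> C_star / 2 * indicator {1<..} u / u\<^sup>2) at_top"
        by (intro tendsto_intros filterlim_compose[OF std_normal_density_hs_g_asymp lim] hs_w_scale_tendsto \<kappa> u) (use u in auto)
      moreover have "(std_normal_density (z * u) * hs_g (z * u) * (z * u)\<^sup>2) * hs_w (hs_T \<kappa> z) (z * u) / u\<^sup>2 = s z u" for z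
        using u by (simp add: s_def power_mult_distrib)
      ultimately show ?case by (simp add: even[of _ v] u_def)
    qed
    \<comment> \<open>For |v| <= 1/2 the weight is at most 3 T |g| with |g| <= 75 exp(z^2/8), so T
      makes it exponentially small and it absorbs z^2. The constant is 25 * 3 * 75, the exponent
      -1/2 + 1/8 = -3/8.\<close>
    have "((\<lambda>z. 5625 * \<kappa> * z ^ 3 * exp (- (3 * z\<^sup>2 / 8))) \<longlongrightarrow> 0) at_top" using \<kappa> by real_asymp
    then have "\<forall>\<^sub>F z in at_top. 5625 * \<kappa> * z ^ 3 * exp (- (3 * z\<^sup>2 / 8)) < 1" by (rule order_tendstoD) simp
    then show "\<forall>\<^sub>F z in at_top. AE v in lborel. norm (s z v) \<le> 250 * inverse (1 + v\<^sup>2)"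
      using hs_T_01[OF \<kappa>] eventually_gt_at_top[of 0]
    proof eventually_elim
      case (elim z)
      have "norm (s z v) \<le> 250 * inverse (1 + v\<^sup>2)" for v
      proof -
        have pos: "0 < 1 + v\<^sup>2" "0 < 1 + (z * v)\<^sup>2" by (simp_all add: add_pos_nonneg)
        have ns: "norm (s z v) = z\<^sup>2 * (std_normal_density (z * v) * \<bar>hs_g (z * v)\<bar> * \<bar>hs_w (hs_T \<kappa> z) (z * v)\<bar>)"
          by (simp add: s_def abs_mult)
        show ?thesis
        proof (cases "\<bar>v\<bar> \<le> 1 / 2")
          case True
          have v2: "v\<^sup>2 \<le> 1 / 4" using power_mono[OF True, of 2] by (simp add: power2_eq_square)
          have "\<bar>hs_w (hs_T \<kappa> z) (z * v)\<bar> \<le> 3 * hs_T \<kappa> z * (75 * exp (z\<^sup>2 / 8))"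
          proof -
            have "(z * v)\<^sup>2 / 2 \<le> z\<^sup>2 / 8" using mult_left_mono[OF v2, of "z\<^sup>2"] by (simp add: power_mult_distrib mult_ac)
            then have "\<bar>hs_g (z * v)\<bar> \<le> 75 * exp (z\<^sup>2 / 8)" by (intro order_trans[OF hs_g_abs_le]) simp
            then show ?thesis
              using elim by (intro order_trans[OF hs_w_bounds(2)] mult_left_mono) auto
          qed
          moreover have "std_normal_density (z * v) * \<bar>hs_g (z * v)\<bar> \<le> 25"
            using pos by (intro order_trans[OF std_normal_density_hs_g_bound]) (simp add: divide_le_eq)
          ultimately have "norm (s z v) \<le> z\<^sup>2 * (25 * (3 * hs_T \<kappa> z * (75 * exp (z\<^sup>2 / 8))))"
            unfolding ns by (intro mult_left_mono mult_mono) auto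
          also have "\<dots> = 5625 * \<kappa> * z ^ 3 * (exp (- z\<^sup>2 / 2) * exp (z\<^sup>2 / 8))"
            by (simp add: hs_T_def power2_eq_square power3_eq_cube)
          also have "exp (- z\<^sup>2 / 2) * exp (z\<^sup>2 / 8) = exp (- (3 * z\<^sup>2 / 8))"
            unfolding exp_add[symmetric] by (simp add: field_simps)
          also have "5625 * \<kappa> * z ^ 3 * exp (- (3 * z\<^sup>2 / 8)) \<le> 1" using elim by simp
          also have "1 \<le> 250 * inverse (1 + v\<^sup>2)" using v2 pos by (simp add: field_simps)
          finally show ?thesis .
        next
          case False
          then have v2: "1 / 4 \<le> v\<^sup>2" using power_mono[of "1/2" "\<bar>v\<bar>" 2] by (simp add: power2_eq_square)
          have "norm (s z v) \<le> z\<^sup>2 * (25 / (1 + (z * v)\<^sup>2) * 2)"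
            unfolding ns using elim pos
            by (intro mult_left_mono mult_mono std_normal_density_hs_g_bound hs_w_bounds(1)) auto
          also have "\<dots> \<le> z\<^sup>2 * (25 / (z * v)\<^sup>2 * 2)"
            using pos v2 elim by (intro mult_left_mono mult_right_mono divide_left_mono) (auto simp: zero_less_mult_iff)
          also have "\<dots> = 50 / v\<^sup>2" using elim by (simp add: power_mult_distrib)
          \<comment> \<open>The constant 250 is what 50 (1 + v^2) <= 250 v^2 asks for when v^2 >=
            1/4.\<close>
          also have "\<dots> \<le> 250 * inverse (1 + v\<^sup>2)"
          proof -
            have "0 < v\<^sup>2" using v2 by linarith
            then show ?thesis using v2 pos(1) by (simp add: divide_simps)
          qed
          finally show ?thesis .
        qed
      qed
      then show ?case by simp
    qed
  qed (auto simp: s_def)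
  also have "(LBINT v. C_star / 2 * (indicator {1<..} \<bar>v\<bar> / v\<^sup>2)) = C_star"
    using integral_inverse_square_tails(2) by (subst integral_mult_right_zero) simp
  finally have lim: "((\<lambda>z. LBINT v. s z v) \<longlongrightarrow> C_star) at_top" .
  show ?thesis
  proof (rule Lim_transform_eventually[OF lim])
    show "\<forall>\<^sub>F z in at_top. (LBINT v. s z v) = z * (\<integral>x. hs_g x * hs_w (hs_T \<kappa> z) x \<partial>N01)"
      using eventually_gt_at_top[of 0]
    proof eventually_elim
      case (elim z)
      let ?f = "\<lambda>x. std_normal_density x * (hs_g x * hs_w (hs_T \<kappa> z) x)"
      have "(\<integral>x. hs_g x * hs_w (hs_T \<kappa> z) x \<partial>N01) = (LBINT x. ?f x)"
        by (subst integral_density) auto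
      also have "\<dots> = z * (LBINT v. ?f (z * v))"
        using elim lborel_integral_real_affine[of z ?f 0] by simp
      finally have "z * (\<integral>x. hs_g x * hs_w (hs_T \<kappa> z) x \<partial>N01) = z\<^sup>2 * (LBINT v. ?f (z * v))"
        by (simp add: power2_eq_square)
      also have "\<dots> = (LBINT v. s z v)"
        by (simp add: s_def mult.assoc)
      finally show ?case by simp
    qed
  qed
qed

text \<open>The derivative of ln (1 + T g(x)) with respect to T.\<close>

definition hs_score :: "real \<Rightarrow> real \<Rightarrow> real" where
  "hs_score T x = hs_g x / (1 + T * hs_g x)"

lemma measurable_hs_score[measurable]: "hs_score T \<in> borel_measurable borel"
  unfolding hs_score_def by measurable

lemma hs_score_minus [simp]: "hs_score T (- x) = hs_score T x" by (simp add: hs_score_def)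

lemma hs_score_eq_w: "T \<noteq> 0 \<Longrightarrow> hs_score T x = hs_w T x / T"
  by (simp add: hs_score_def hs_w_def)

lemma hs_score_bound: "0 < T \<Longrightarrow> T \<le> 1 \<Longrightarrow> \<bar>hs_score T x\<bar> \<le> 2 / T"
  using hs_w_bounds(1)[of T x] by (simp add: hs_score_eq_w divide_right_mono)

text \<open>Both parts rest on g/(1 + T g) = g - g w with w = \<open>hs_w T\<close>. The mean of g
  vanishes, leaving only the correction g w. The squared score equals g w/(T (1 + T g)), and 1 + T g
  >= 1/3.\<close>

lemma hs_score_null:
  assumes T: "0 < T" "T \<le> 1"
  shows "(\<integral>x. hs_score T x \<partial>N01) = - (\<integral>x. hs_g x * hs_w T x \<partial>N01)"
    and "(\<integral>x. (hs_score T x)\<^sup>2 \<partial>N01) \<le> 3 / T * (\<integral>x. hs_g x * hs_w T x \<partial>N01)"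
proof -
  interpret N: prob_space N01 by (rule prob_space_N01)
  have p: "1 / 3 \<le> 1 + T * hs_g x" for x using hs_linear_pos[of T x] T by simp
  have p0: "0 < 1 + T * hs_g x" for x using p[of x] by linarith
  have i: "integrable N01 (\<lambda>x. hs_g x * hs_w T x)"
  proof (rule Bochner_Integration.integrable_bound)
    show "integrable N01 (\<lambda>x. 2 * hs_g x)" by (intro integrable_mult_right N01_hs_g)
    show "AE x in N01. norm (hs_g x * hs_w T x) \<le> norm (2 * hs_g x)"
      using hs_w_bounds(1)[of T] T by (intro AE_I2) (auto simp: abs_mult mult.commute intro!: mult_left_mono)
  qed simp
  have eq: "hs_score T x = hs_g x - hs_g x * hs_w T x" for x
    using p0[of x] by (simp add: hs_score_def hs_w_def field_simps)
  show "(\<integral>x. hs_score T x \<partial>N01) = - (\<integral>x. hs_g x * hs_w T x \<partial>N01)"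
    unfolding eq using N01_hs_g i by (simp add: Bochner_Integration.integral_diff)
  have "(\<integral>x. (hs_score T x)\<^sup>2 \<partial>N01) \<le> (\<integral>x. 3 / T * (hs_g x * hs_w T x) \<partial>N01)"
  proof (rule integral_mono)
    show "integrable N01 (\<lambda>x. (hs_score T x)\<^sup>2)"
    proof (rule Bochner_Integration.integrable_bound)
      show "integrable N01 (\<lambda>x. (2 / T)\<^sup>2)" by (rule N.integrable_const)
      show "AE x in N01. norm ((hs_score T x)\<^sup>2) \<le> norm ((2 / T)\<^sup>2)"
        using power_mono[OF hs_score_bound[OF T] abs_ge_zero, of _ 2] by (intro AE_I2) simp
    qed simp
    show "integrable N01 (\<lambda>x. 3 / T * (hs_g x * hs_w T x))" by (intro integrable_mult_right i)
    fix x
    define r where "r = 1 / (1 + T * hs_g x)"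
    have "r \<le> 1 / (1 / 3)" unfolding r_def using p[of x] p0[of x] by (intro divide_left_mono) auto
    then have r: "0 < r" "r \<le> 3" using p0[of x] by (simp_all add: r_def)
    have "(hs_score T x)\<^sup>2 = ((hs_g x)\<^sup>2 * r) * r" by (simp add: hs_score_def r_def power2_eq_square)
    also have "\<dots> \<le> ((hs_g x)\<^sup>2 * r) * 3" using r by (intro mult_left_mono) auto
    also have "\<dots> = 3 / T * (hs_g x * hs_w T x)" using T by (simp add: hs_w_def r_def power2_eq_square)
    finally show "(hs_score T x)\<^sup>2 \<le> 3 / T * (hs_g x * hs_w T x)" .
  qed
  also have "\<dots> = 3 / T * (\<integral>x. hs_g x * hs_w T x \<partial>N01)" by simp
  finally show "(\<integral>x. (hs_score T x)\<^sup>2 \<partial>N01) \<le> 3 / T * (\<integral>x. hs_g x * hs_w T x \<partial>N01)" .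
qed

section \<open>Concentration and Hellinger affinity\<close>

abbreviation "PN n \<equiv> PiM {..<n::nat} (\<lambda>_. N01)"

lemma prob_space_PN: "prob_space (PN n)"
  by (rule prob_space_PiM) (rule prob_space_N01)

lemma N01_UNIV: "measure N01 UNIV = 1"
  using prob_space.prob_space[OF prob_space_N01] by simp

lemma PN_second_moment:
  fixes h :: "nat \<Rightarrow> real \<Rightarrow> real"
  assumes m[measurable]: "\<And>i. h i \<in> borel_measurable borel"
    and B: "\<And>i x. \<bar>h i x\<bar> \<le> B" and mean: "\<And>i. i < n \<Longrightarrow> (\<integral>x. h i x \<partial>N01) = 0"
  shows "integrable (PN n) (\<lambda>\<omega>. (\<Sum>i<n. h i (\<omega> i))\<^sup>2)"
    and "(\<integral>\<omega>. (\<Sum>i<n. h i (\<omega> i))\<^sup>2 \<partial>PN n) = (\<Sum>i<n. \<integral>x. (h i x)\<^sup>2 \<partial>N01)"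
proof -
  interpret N: prob_space N01 by (rule prob_space_N01)
  interpret P: product_sigma_finite "\<lambda>_::nat. N01" by standard
  \<comment> \<open>\<open>F i j\<close> writes h_i(\<omega>_i) h_j(\<omega>_j) as a product over
    all coordinates of one-variable functions, with factor 1 elsewhere; for i = j the two factors
    meet in one coordinate and give the square. This is the form to which the product integral
    formula applies.\<close>
  define F where "F = (\<lambda>i j k x. (if k = i then h i x else 1) * (if k = j then h j x else 1))"
  have B0: "0 \<le> B" using B[of 0 0] by linarith
  have Fm: "F i j k \<in> borel_measurable borel" for i j k unfolding F_def by measurable
  have Fb: "\<bar>F i j k x\<bar> \<le> (B + 1) * (B + 1)" for i j k x
    unfolding F_def abs_mult using B[of i x] B[of j x] B0 by (intro mult_mono) auto
  have Fi: "integrable N01 (F i j k)" for i j k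
    by (rule N.integrable_const_bound[where B="(B + 1) * (B + 1)"]) (use Fb Fm in auto)
  have prod: "(\<Prod>k<n. F i j k (\<omega> k)) = h i (\<omega> i) * h j (\<omega> j)" if "i < n" "j < n" for i j \<omega>
    unfolding F_def using that by (simp add: prod.distrib prod.delta)
  have int: "integrable (PN n) (\<lambda>\<omega>. h i (\<omega> i) * h j (\<omega> j))" if "i < n" "j < n" for i j
    using P.product_integrable_prod[of "{..<n}" "F i j"] Fi by (simp add: prod that)
  have val: "(\<integral>\<omega>. h i (\<omega> i) * h j (\<omega> j) \<partial>PN n) = (if i = j then \<integral>x. (h i x)\<^sup>2 \<partial>N01 else 0)" if ij: "i < n" "j < n" for i j
  proof -
    have "(\<integral>\<omega>. h i (\<omega> i) * h j (\<omega> j) \<partial>PN n) = (\<Prod>k<n. \<integral>x. F i j k x \<partial>N01)"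
      using P.product_integral_prod[of "{..<n}" "F i j"] Fi by (simp add: prod ij)
    also have "\<dots> = (if i = j then \<integral>x. (h i x)\<^sup>2 \<partial>N01 else 0)"
    proof (cases "i = j")
      case True
      have "(\<integral>x. F i i k x \<partial>N01) = (if k = i then \<integral>x. (h i x)\<^sup>2 \<partial>N01 else 1)" for k
        by (simp add: F_def power2_eq_square N01_UNIV)
      then show ?thesis using True ij by (simp add: prod.delta)
    next
      case False
      then have "(\<integral>x. F i j i x \<partial>N01) = 0" using mean[OF ij(1)] by (simp add: F_def)
      then show ?thesis using False ij by (auto intro!: prod_zero)
    qed
    finally show ?thesis .
  qed
  have sq: "(\<Sum>i<n. h i (\<omega> i))\<^sup>2 = (\<Sum>i<n. \<Sum>j<n. h i (\<omega> i) * h j (\<omega> j))" for \<omega>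
    by (simp add: power2_eq_square sum_product)
  show "integrable (PN n) (\<lambda>\<omega>. (\<Sum>i<n. h i (\<omega> i))\<^sup>2)"
    unfolding sq by (intro Bochner_Integration.integrable_sum int) auto
  have "(\<integral>\<omega>. (\<Sum>i<n. h i (\<omega> i))\<^sup>2 \<partial>PN n) = (\<Sum>i<n. \<Sum>j<n. \<integral>\<omega>. h i (\<omega> i) * h j (\<omega> j) \<partial>PN n)"
    unfolding sq
    using int by (subst Bochner_Integration.integral_sum) (auto intro!: Bochner_Integration.integrable_sum Bochner_Integration.integral_sum sum.cong)
  also have "\<dots> = (\<Sum>i<n. \<integral>x. (h i x)\<^sup>2 \<partial>N01)" by (simp add: val)
  finally show "(\<integral>\<omega>. (\<Sum>i<n. h i (\<omega> i))\<^sup>2 \<partial>PN n) = (\<Sum>i<n. \<integral>x. (h i x)\<^sup>2 \<partial>N01)" .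
qed

text \<open>Each variance is replaced by the raw second moment, which for null coordinates is the
  quantity bounded in \<open>hs_score_null\<close>.\<close>

lemma PN_Chebyshev:
  fixes f :: "nat \<Rightarrow> real \<Rightarrow> real"
  assumes m[measurable]: "\<And>i. f i \<in> borel_measurable borel"
    and B: "\<And>i x. \<bar>f i x\<bar> \<le> B" and a: "0 < a"
  shows "measure (PN n) {\<omega> \<in> space (PN n). a \<le> \<bar>(\<Sum>i<n. f i (\<omega> i)) - (\<Sum>i<n. \<integral>x. f i x \<partial>N01)\<bar>}
    \<le> (\<Sum>i<n. \<integral>x. (f i x)\<^sup>2 \<partial>N01) / a\<^sup>2"
proof -
  interpret N: prob_space N01 by (rule prob_space_N01)
  interpret P: prob_space "PN n" by (rule prob_space_PN)
  define c where "c = (\<lambda>i. \<integral>x. f i x \<partial>N01)"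
  define h where "h = (\<lambda>i x. f i x - c i)"
  have fi: "integrable N01 (f i)" for i
    by (rule N.integrable_const_bound[where B=B]) (use B in auto)
  have f2: "integrable N01 (\<lambda>x. (f i x)\<^sup>2)" for i
    by (rule N.integrable_const_bound[where B="B\<^sup>2"]) (use power_mono[OF B abs_ge_zero, of _ _ 2] in auto)
  have cB: "\<bar>c i\<bar> \<le> B" for i
  proof -
    have "\<bar>c i\<bar> \<le> (\<integral>x. \<bar>f i x\<bar> \<partial>N01)" unfolding c_def by (rule integral_abs_bound)
    also have "\<dots> \<le> (\<integral>x. B \<partial>N01)" using B fi by (intro integral_mono) auto
    finally show ?thesis by (simp add: N01_UNIV)
  qed
  have hm: "h i \<in> borel_measurable borel" for i unfolding h_def by measurable
  have hB: "\<bar>h i x\<bar> \<le> 2 * B" for i x unfolding h_def using B[of i x] cB[of i] by linarith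
  have h0: "(\<integral>x. h i x \<partial>N01) = 0" for i
    unfolding h_def using fi N01_UNIV by (simp add: Bochner_Integration.integral_diff c_def)
  have h2: "(\<integral>x. (h i x)\<^sup>2 \<partial>N01) \<le> (\<integral>x. (f i x)\<^sup>2 \<partial>N01)" for i
    using N.variance_eq[OF fi f2, of i] by (simp add: h_def c_def)
  note sm = PN_second_moment[of h, OF hm hB h0]
  have "measure (PN n) {\<omega> \<in> space (PN n). a \<le> \<bar>\<Sum>i<n. h i (\<omega> i)\<bar>} \<le> (\<integral>\<omega>. (\<Sum>i<n. h i (\<omega> i))\<^sup>2 \<partial>PN n) / a\<^sup>2"
    using a by (intro P.second_moment_method sm(1)) (auto simp: h_def)
  also have "\<dots> \<le> (\<Sum>i<n. \<integral>x. (f i x)\<^sup>2 \<partial>N01) / a\<^sup>2"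
    unfolding sm(2) by (intro divide_right_mono sum_mono h2) auto
  finally show ?thesis by (simp add: h_def c_def sum_subtractf)
qed

lemma PN_prod_Markov:
  fixes f :: "real \<Rightarrow> real"
  assumes A: "A \<subseteq> {..<n}" and f: "integrable N01 f" "\<And>x. 0 \<le> f x" and v: "0 < v"
  shows "measure (PN n) {\<omega> \<in> space (PN n). v \<le> (\<Prod>i\<in>A. f (\<omega> i))} \<le> (\<integral>x. f x \<partial>N01) ^ card A / v"
proof -
  interpret N: prob_space N01 by (rule prob_space_N01)
  interpret P: product_sigma_finite "\<lambda>_::nat. N01" by standard
  define F where "F = (\<lambda>k x. if k \<in> A then f x else 1)"
  have Fi: "integrable N01 (F k)" for k unfolding F_def using f N.integrable_const by (cases "k \<in> A") auto
  have prod: "(\<Prod>k<n. F k (\<omega> k)) = (\<Prod>i\<in>A. f (\<omega> i))" for \<omega>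
    unfolding F_def using A by (subst prod.inter_restrict[symmetric]) (auto simp: Int_absorb1)
  have I: "integrable (PN n) (\<lambda>\<omega>. \<Prod>i\<in>A. f (\<omega> i))"
    using P.product_integrable_prod[of "{..<n}" F] Fi by (simp add: prod)
  have "(\<integral>\<omega>. (\<Prod>i\<in>A. f (\<omega> i)) \<partial>PN n) = (\<Prod>k<n. \<integral>x. F k x \<partial>N01)"
    using P.product_integral_prod[of "{..<n}" F] Fi by (simp add: prod)
  also have "\<dots> = (\<Prod>k<n. if k \<in> A then \<integral>x. f x \<partial>N01 else 1)"
    by (intro prod.cong) (auto simp: F_def N01_UNIV)
  also have "\<dots> = (\<integral>x. f x \<partial>N01) ^ card A"
    using A by (subst prod.inter_restrict[symmetric]) (auto simp: Int_absorb1)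
  finally have E: "(\<integral>\<omega>. (\<Prod>i\<in>A. f (\<omega> i)) \<partial>PN n) = (\<integral>x. f x \<partial>N01) ^ card A" .
  have "measure (PN n) {\<omega> \<in> space (PN n). v \<le> (\<Prod>i\<in>A. f (\<omega> i))} \<le> (\<integral>\<omega>. (\<Prod>i\<in>A. f (\<omega> i)) \<partial>PN n) / v"
    using I v f(2) by (intro integral_Markov_inequality_measure[where A="{}"]) (auto intro!: prod_nonneg)
  then show ?thesis by (simp add: E)
qed

text \<open>For |x| <= 1/2 the factor exp(x^2 t^2/2) is below its null mean 1/sqrt (1 - t^2) by at
  least t^2/4 for every t. As the kernel is at least tau, the ratio is below 1 by an amount of order
  tau on a set of fixed positive probability, which is what separates it from the null.\<close>

lemma hs_ratio_central_le:
  assumes \<tau>: "0 < \<tau>" "\<tau> \<le> 1" and x: "\<bar>x\<bar> \<le> 1 / 2"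
  shows "hs_ratio \<tau> x \<le> 1 - \<tau> / (6 * pi)"
proof -
  note I = hs_ratio_minus_1[OF \<tau>(1), of x]
  have D: "DERIV (\<lambda>t::real. t ^ 3 / 3) t :> t\<^sup>2" for t by (auto intro!: derivative_eq_intros)
  have L: "((\<lambda>t::real. t ^ 3 / 3) \<longlongrightarrow> 0) (at_right 0)" "((\<lambda>t::real. t ^ 3 / 3) \<longlongrightarrow> 1 / 3) (at_left 1)"
    by real_asymp+
  have sq: "set_integrable lborel {0<..<1} (\<lambda>t::real. t\<^sup>2)" "(LBINT t:{0<..<1::real}. t\<^sup>2) = 1 / 3"
    using set_integral_FTC_unit[OF D _ _ L] by auto
  have "(LBINT t:{0<..<1}. hs_kernel \<tau> t * (exp (x\<^sup>2 / 2 * t\<^sup>2) - 1 / sqrt (1 - t\<^sup>2))) \<le> (LBINT t:{0<..<1}. - \<tau> / 4 * t\<^sup>2)"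
  proof (rule set_integral_mono[OF I(1)])
    show "set_integrable lborel {0<..<1} (\<lambda>t. - \<tau> / 4 * t\<^sup>2)"
      by (intro set_integrable_mult_right impI sq)
    fix t :: real assume t: "t \<in> {0<..<1}"
    have t2: "t\<^sup>2 < 1" "0 < t\<^sup>2" using unit_sq_less[of t] t by auto
    have "x\<^sup>2 \<le> (1 / 2)\<^sup>2" using power_mono[OF x abs_ge_zero, of 2] by simp
    then have u: "x\<^sup>2 / 2 * t\<^sup>2 \<le> t\<^sup>2 / 8" using mult_right_mono[of "x\<^sup>2 / 2" "1 / 8" "t\<^sup>2"] by (simp add: power2_eq_square)
    define w where "w = t\<^sup>2 / 8"
    have w: "0 \<le> w" "w \<le> 1" using t2 by (auto simp: w_def)
    have "exp (x\<^sup>2 / 2 * t\<^sup>2) \<le> exp w" using u by (simp add: w_def)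
    also have "\<dots> \<le> 1 + w + w\<^sup>2" using w by (intro exp_bound) auto
    also have "\<dots> \<le> 1 + w + w * 1" using w by (simp add: power2_eq_square mult_left_le)
    finally have 1: "exp (x\<^sup>2 / 2 * t\<^sup>2) \<le> 1 + t\<^sup>2 / 4" by (simp add: w_def)
    have 2: "1 + t\<^sup>2 / 2 \<le> 1 / sqrt (1 - t\<^sup>2)"
    proof -
      have "((1 + t\<^sup>2 / 2) * sqrt (1 - t\<^sup>2))\<^sup>2 \<le> 1\<^sup>2"
      proof -
        have "((1 + t\<^sup>2 / 2) * sqrt (1 - t\<^sup>2))\<^sup>2 = (1 + t\<^sup>2 / 2)\<^sup>2 * (1 - t\<^sup>2)"
          using t2 by (simp add: power_mult_distrib)
        also have "\<dots> = 1 - (3 * (t\<^sup>2 * t\<^sup>2) + t\<^sup>2 * t\<^sup>2 * t\<^sup>2) / 4" by (simp add: field_simps power2_eq_square)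
        also have "\<dots> \<le> 1" by simp
        finally show ?thesis by simp
      qed
      then have "(1 + t\<^sup>2 / 2) * sqrt (1 - t\<^sup>2) \<le> 1" by (rule power2_le_imp_le) simp
      then show ?thesis using t2 by (simp add: le_divide_eq)
    qed
    have "hs_kernel \<tau> t * (exp (x\<^sup>2 / 2 * t\<^sup>2) - 1 / sqrt (1 - t\<^sup>2)) \<le> hs_kernel \<tau> t * (- (t\<^sup>2 / 4))"
      using 1 2 hs_kernel_pos[of \<tau> t] \<tau> t by (intro mult_left_mono) auto
    also have "\<dots> \<le> \<tau> * (- (t\<^sup>2 / 4))"
      using hs_kernel_ge[OF \<tau>, of t] t by (intro mult_right_mono_neg) auto
    finally show "hs_kernel \<tau> t * (exp (x\<^sup>2 / 2 * t\<^sup>2) - 1 / sqrt (1 - t\<^sup>2)) \<le> - \<tau> / 4 * t\<^sup>2" by simp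
  qed
  also have "\<dots> = - \<tau> / 12" by (simp only: set_integral_mult_right sq)
  finally have "hs_ratio \<tau> x - 1 \<le> 2 / pi * (- \<tau> / 12)"
    unfolding I(2) by (intro mult_left_mono) auto
  then show ?thesis by simp
qed

lemma N01_Ioc_pos:
  assumes "a < b"
  shows "0 < measure N01 {a<..b}"
proof -
  interpret N: prob_space N01 by (rule prob_space_N01)
  have "measure N01 {a<..b} \<noteq> 0"
  proof
    assume "measure N01 {a<..b} = 0"
    then have "AE x in N01. x \<notin> {a<..b}"
      by (subst (asm) N.prob_eq_0) auto
    then have "AE x in lborel. x \<notin> {a<..b}"
      by (subst (asm) AE_density) (auto simp: normal_density_pos elim!: eventually_mono)
    then have "{a<..b} \<in> null_sets lborel"
      by (subst AE_iff_null_sets) auto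
    then have "emeasure lborel {a<..b} = 0" by (rule null_setsD1)
    moreover have "emeasure lborel {a<..b} = ennreal (b - a)"
      using assms by (subst emeasure_lborel_Ioc) auto
    ultimately show False using assms by simp
  qed
  then show ?thesis by (simp add: zero_less_measure_iff)
qed

lemma strict_mono_cdf_N01: "a < b \<Longrightarrow> cdf N01 a < cdf N01 b"
proof -
  assume ab: "a < b"
  interpret N: prob_space N01 by (rule prob_space_N01)
  interpret finite_borel_measure N01 by standard auto
  show ?thesis using cdf_diff_eq[OF ab] N01_Ioc_pos[OF ab] by simp
qed

text \<open>With r the square root of the ratio, r = 1 + (r^2 - 1)/2 - (1 - r)^2/2 exactly. The
  middle term has null mean 0, and on the central interval the last one is of order tau^2 by
  \<open>hs_ratio_central_le\<close>.\<close>

lemma N01_Hellinger: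
  "\<exists>c>0. c \<le> 1 \<and> (\<forall>\<tau>. 0 < \<tau> \<and> \<tau> \<le> 1 \<longrightarrow> integrable N01 (\<lambda>x. sqrt (hs_ratio \<tau> x)) \<and> (\<integral>x. sqrt (hs_ratio \<tau> x) \<partial>N01) \<le> 1 - c * \<tau>\<^sup>2)"
proof -
  interpret N: prob_space N01 by (rule prob_space_N01)
  define m where "m = measure N01 {-1/2<..1/2}"
  \<comment> \<open>On the central interval 1 - r^2 >= tau/(6 pi) and r <= 1 give 1 - r >= tau/(12
    pi); \<open>d\<close> is the coefficient of tau^2 in half the square of this.\<close>
  define d where "d = (1 / (6 * pi))\<^sup>2 / 8"
  have d: "0 < d" "d \<le> 1"
  proof -
    have "1 / (6 * pi) \<le> 1" using pi_gt3 by simp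
    then have "(1 / (6 * pi))\<^sup>2 \<le> 1" by (intro power_le_one) auto
    then show "d \<le> 1" by (simp add: d_def)
  qed (simp add: d_def)
  have m: "0 < m" "m \<le> 1" using N01_Ioc_pos[of "-1/2" "1/2"] by (simp_all add: m_def)
  have main: "integrable N01 (\<lambda>x. sqrt (hs_ratio \<tau> x)) \<and> (\<integral>x. sqrt (hs_ratio \<tau> x) \<partial>N01) \<le> 1 - (d * m) * \<tau>\<^sup>2"
    if \<tau>: "0 < \<tau>" "\<tau> \<le> 1" for \<tau>
  proof
    note R = N01_hs_ratio[OF \<tau>(1)]
    let ?I = "indicator {-1/2<..1/2} :: real \<Rightarrow> real"
    have pos: "0 < hs_ratio \<tau> x" for x by (rule hs_ratio_pos[OF \<tau>])
    have le: "sqrt (hs_ratio \<tau> x) \<le> 1 + (hs_ratio \<tau> x - 1) / 2 - d * \<tau>\<^sup>2 * ?I x" for x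
    proof -
      define r where "r = sqrt (hs_ratio \<tau> x)"
      have r: "0 < r" "hs_ratio \<tau> x = r\<^sup>2" using pos[of x] by (simp_all add: r_def)
      have id: "1 + (r\<^sup>2 - 1) / 2 - r = (1 - r)\<^sup>2 / 2" by (simp add: power2_eq_square field_simps)
      show ?thesis
      proof (cases "x \<in> {-1/2<..1/2}")
        case True
        then have "r\<^sup>2 \<le> 1 - \<tau> / (6 * pi)" using hs_ratio_central_le[OF \<tau>, of x] r(2) by auto
        then have "\<tau> / (6 * pi) \<le> (1 - r) * (1 + r)" by (simp add: power2_eq_square algebra_simps)
        moreover have "0 \<le> \<tau> / (6 * pi)" using \<tau> by simp
        ultimately have "0 \<le> (1 - r) * (1 + r)" by linarith
        then have r1: "r \<le> 1" using r(1) by (simp add: zero_le_mult_iff)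
        have "(1 - r) * (1 + r) \<le> (1 - r) * 2" using r1 by (intro mult_left_mono) auto
        then have "\<tau> * (1 / (6 * pi)) / 2 \<le> 1 - r" using \<open>\<tau> / (6 * pi) \<le> (1 - r) * (1 + r)\<close> by simp
        then have "(\<tau> * (1 / (6 * pi)) / 2)\<^sup>2 \<le> (1 - r)\<^sup>2" using \<tau> by (intro power_mono) auto
        then have "d * \<tau>\<^sup>2 \<le> (1 - r)\<^sup>2 / 2"
          unfolding d_def by (simp add: power_mult_distrib power_divide mult.commute)
        then have "r \<le> 1 + (r\<^sup>2 - 1) / 2 - d * \<tau>\<^sup>2" using id by linarith
        then show ?thesis using True r by simp
      next
        case False
        have "r \<le> 1 + (r\<^sup>2 - 1) / 2" using id zero_le_power2[of "1 - r"] by linarith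
        then show ?thesis using False r by simp
      qed
    qed
    have iR: "integrable N01 (\<lambda>x. 1 + (hs_ratio \<tau> x - 1) / 2)"
      using R(1) N.integrable_const by (intro Bochner_Integration.integrable_add Bochner_Integration.integrable_diff integrable_divide) auto
    have iI: "integrable N01 (\<lambda>x. d * \<tau>\<^sup>2 * ?I x)" by (intro integrable_mult_right N.integrable_const_bound[where B=1]) auto
    show iS: "integrable N01 (\<lambda>x. sqrt (hs_ratio \<tau> x))"
    proof (rule Bochner_Integration.integrable_bound[OF iR])
      show "AE x in N01. norm (sqrt (hs_ratio \<tau> x)) \<le> norm (1 + (hs_ratio \<tau> x - 1) / 2)"
      proof (rule AE_I2)
        fix x
        have "0 \<le> d * \<tau>\<^sup>2 * ?I x" using d by simp
        then have "sqrt (hs_ratio \<tau> x) \<le> 1 + (hs_ratio \<tau> x - 1) / 2" using le[of x] by linarith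
        then show "norm (sqrt (hs_ratio \<tau> x)) \<le> norm (1 + (hs_ratio \<tau> x - 1) / 2)" using pos[of x] by simp
      qed
    qed simp
    have "(\<integral>x. sqrt (hs_ratio \<tau> x) \<partial>N01) \<le> (\<integral>x. 1 + (hs_ratio \<tau> x - 1) / 2 - d * \<tau>\<^sup>2 * ?I x \<partial>N01)"
      by (intro integral_mono iS Bochner_Integration.integrable_diff iR iI le)
    also have "\<dots> = (\<integral>x. 1 + (hs_ratio \<tau> x - 1) / 2 \<partial>N01) - (\<integral>x. d * \<tau>\<^sup>2 * ?I x \<partial>N01)"
      by (rule Bochner_Integration.integral_diff[OF iR iI])
    also have "(\<integral>x. d * \<tau>\<^sup>2 * ?I x \<partial>N01) = d * m * \<tau>\<^sup>2" by (simp add: m_def)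
    also have "(\<integral>x. 1 + (hs_ratio \<tau> x - 1) / 2 \<partial>N01) = (\<integral>x. 1 / 2 + 1 / 2 * hs_ratio \<tau> x \<partial>N01)"
      by (intro Bochner_Integration.integral_cong) (auto simp: field_simps)
    also have "\<dots> = 1 / 2 + 1 / 2 * 1"
      using R N.integrable_const N.prob_space by (subst Bochner_Integration.integral_add) auto
    finally show "(\<integral>x. sqrt (hs_ratio \<tau> x) \<partial>N01) \<le> 1 - d * m * \<tau>\<^sup>2" by simp
  qed
  show ?thesis
    by (rule exI[of _ "d * m"]) (use main d m mult_le_one[of d m] in auto)
qed

section \<open>The log-likelihood\<close>

lemma marginal_likelihood_eq:
  assumes "0 < \<tau>"
  shows "marginal_likelihood n x \<tau> = (\<Prod>i<n. std_normal_density (x i)) * (\<Prod>i<n. hs_ratio \<tau> (x i))"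
  by (simp add: marginal_likelihood_def marginal_density_eq[OF assms] prod.distrib)

definition hs_loglik :: "nat \<Rightarrow> (nat \<Rightarrow> real) \<Rightarrow> real \<Rightarrow> real" where
  "hs_loglik n x \<tau> = (\<Sum>i<n. ln (hs_ratio \<tau> (x i)))"

lemma exp_hs_loglik:
  assumes "0 < \<tau>" "\<tau> \<le> 1"
  shows "exp (hs_loglik n x \<tau>) = (\<Prod>i<n. hs_ratio \<tau> (x i))"
  using hs_ratio_pos[OF assms] by (simp add: hs_loglik_def exp_sum)

lemma is_mmle_loglik:
  assumes "is_mmle n T" "n \<ge> 1" "x \<in> space (PiM {..<n} (\<lambda>_. borel))"
  shows "T x \<in> {1 / real n..1}"
    and "\<And>\<tau>. \<tau> \<in> {1 / real n..1} \<Longrightarrow> hs_loglik n x \<tau> \<le> hs_loglik n x (T x)"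
proof -
  have arg: "is_arg_max (marginal_likelihood n x) (\<lambda>\<tau>. \<tau> \<in> {1 / real n..1}) (T x)"
    using assms by (simp add: is_mmle_def)
  show T: "T x \<in> {1 / real n..1}" using arg by (simp add: is_arg_max_def)
  fix \<tau> assume \<tau>: "\<tau> \<in> {1 / real n..1}"
  have n: "0 < 1 / real n" using assms by simp
  have "marginal_likelihood n x \<tau> \<le> marginal_likelihood n x (T x)"
    using arg \<tau> by (auto simp: is_arg_max_def not_less)
  moreover have "0 < (\<Prod>i<n. std_normal_density (x i))" by (intro prod_pos) (simp add: normal_density_pos)
  moreover have p: "0 < \<tau>" "\<tau> \<le> 1" "0 < T x" "T x \<le> 1" using \<tau> T less_le_trans[OF n] by auto
  ultimately have "(\<Prod>i<n. hs_ratio \<tau> (x i)) \<le> (\<Prod>i<n. hs_ratio (T x) (x i))"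
    by (simp add: marginal_likelihood_eq)
  then have "exp (hs_loglik n x \<tau>) \<le> exp (hs_loglik n x (T x))"
    by (simp add: exp_hs_loglik p)
  then show "hs_loglik n x \<tau> \<le> hs_loglik n x (T x)" by simp
qed

text \<open>Up to an error of order n \<tau>^(3/2), the log-likelihood is the concave function
  \<tau> \<mapsto> \<Sum> ln (1 + \<tau> g(x_i)), which lies below its tangent at T.\<close>

lemma hs_loglik_tangent:
  assumes T: "0 < T" "T \<le> 1" "360 * (T * sqrt T) \<le> 1" and \<tau>: "0 < \<tau>" "\<tau> \<le> 1" "360 * (\<tau> * sqrt \<tau>) \<le> 1"
  shows "hs_loglik n x \<tau> - hs_loglik n x T
    \<le> (\<tau> - T) * (\<Sum>i<n. hs_score T (x i)) + real n * (360 * (\<tau> * sqrt \<tau>) + 360 * (T * sqrt T))"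
proof -
  have "hs_loglik n x \<tau> - hs_loglik n x T = (\<Sum>i<n. ln (hs_ratio \<tau> (x i)) - ln (hs_ratio T (x i)))"
    by (simp add: hs_loglik_def sum_subtractf)
  also have "\<dots> \<le> (\<Sum>i<n. (\<tau> - T) * hs_score T (x i) + (360 * (\<tau> * sqrt \<tau>) + 360 * (T * sqrt T)))"
  proof (rule sum_mono)
    fix i
    define g where "g = hs_g (x i)"
    have p: "0 < 1 + T * g" "0 < 1 + \<tau> * g"
      using hs_linear_pos[of T "x i"] hs_linear_pos[of \<tau> "x i"] T \<tau> unfolding g_def by linarith+
    have "ln (1 + \<tau> * g) - ln (1 + T * g) = ln ((1 + \<tau> * g) / (1 + T * g))"
      using p by (simp add: ln_div)
    also have "\<dots> \<le> (1 + \<tau> * g) / (1 + T * g) - 1" using p by (intro ln_le_minus_one) auto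
    also have "\<dots> = (\<tau> - T) * hs_score T (x i)"
      using p by (simp add: hs_score_def g_def[symmetric] field_simps)
    finally have "ln (1 + \<tau> * g) - ln (1 + T * g) \<le> (\<tau> - T) * hs_score T (x i)" .
    then show "ln (hs_ratio \<tau> (x i)) - ln (hs_ratio T (x i)) \<le> (\<tau> - T) * hs_score T (x i) + (360 * (\<tau> * sqrt \<tau>) + 360 * (T * sqrt T))"
      using ln_hs_ratio_linear[OF T, of "x i"] ln_hs_ratio_linear[OF \<tau>, of "x i"] unfolding g_def by linarith
  qed
  also have "\<dots> = (\<tau> - T) * (\<Sum>i<n. hs_score T (x i)) + real n * (360 * (\<tau> * sqrt \<tau>) + 360 * (T * sqrt T))"
    by (simp add: sum.distrib sum_distrib_left)
  finally show ?thesis .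
qed

text \<open>Bounds what the null coordinates can lose at T itself. Since g >= -2/pi, the linear part
  loses at most 2T/3; the condition with 540 = 3 * 180 limits the linearisation error to
  T/3.\<close>

lemma hs_ratio_lower:
  assumes T: "0 < T" "T \<le> 1" "540 * sqrt T \<le> 1"
  shows "1 - T \<le> hs_ratio T x"
proof -
  define Q where "Q = 1 + T * hs_g x"
  have "T * (2 / pi) \<le> T * (2 / 3)" using T two_div_pi by (intro mult_left_mono) auto
  moreover have "T * (- (2 / pi)) \<le> T * hs_g x" using hs_g_ge[of x] T by (intro mult_left_mono) auto
  ultimately have Q: "1 - T * (2 / 3) \<le> Q" unfolding Q_def by argo
  define e where "e = 180 * (T * sqrt T)"
  have e: "0 \<le> e" "e \<le> T * (1 / 3)"
    using T mult_left_mono[OF T(3), of "T / 3"] by (simp_all add: e_def)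
  have "Q - e * Q \<le> hs_ratio T x" using hs_ratio_linear[OF T(1,2), of x] unfolding Q_def e_def by linarith
  moreover have "(1 - T * (2 / 3)) * (1 - e) \<le> Q * (1 - e)"
    using Q e T by (intro mult_right_mono) auto
  moreover have "(1 - T * (2 / 3)) * (1 - e) = 1 - T * (2 / 3) - e + T * (2 / 3) * e" by (simp add: field_simps)
  moreover have "0 \<le> T * (2 / 3) * e" using T e by simp
  moreover have "Q * (1 - e) = Q - e * Q" by (simp add: algebra_simps)
  ultimately show ?thesis using e by argo
qed

text \<open>For \<tau> bounded away from T the linearisation fails, but there the Hellinger affinity between
  the null law and the mixture beats the contribution of the signals; a grid of ratio 1 + c \<eta>^2 / 2
  handles all \<tau> at once.\<close>

lemma hs_loglik_large_tau:
  obtains c :: real where "0 < c" "c \<le> 1"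
    "\<And>n T \<eta> \<theta>. 0 < \<eta> \<Longrightarrow> \<eta> \<le> 1 \<Longrightarrow> 0 < T \<Longrightarrow> T \<le> \<eta> \<Longrightarrow> T \<le> 1 / 2 \<Longrightarrow> 540 * sqrt T \<le> 1 \<Longrightarrow>
      \<exists>B\<in>sets (PN n). (\<forall>\<omega>\<in>space (PN n) - B. \<forall>\<tau>\<in>{\<eta>..1}. hs_loglik n (\<lambda>i. \<theta> i + \<omega> i) \<tau> < hs_loglik n (\<lambda>i. \<theta> i + \<omega> i) T) \<and>
        measure (PN n) B \<le> (2 / (c * \<eta> ^ 3) + 2) *
          exp (- (real (n - card (support n \<theta>)) * c * \<eta>\<^sup>2) + (real n * c * \<eta>\<^sup>2 / 4 + real (card (support n \<theta>)) * ln (1 / T) / 2 + real n * T))"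
proof -
  from N01_Hellinger obtain c where c: "0 < c" "c \<le> 1"
    and H: "\<And>\<tau>. 0 < \<tau> \<Longrightarrow> \<tau> \<le> 1 \<Longrightarrow> integrable N01 (\<lambda>x. sqrt (hs_ratio \<tau> x))"
      "\<And>\<tau>. 0 < \<tau> \<Longrightarrow> \<tau> \<le> 1 \<Longrightarrow> (\<integral>x. sqrt (hs_ratio \<tau> x) \<partial>N01) \<le> 1 - c * \<tau>\<^sup>2" by blast
  show ?thesis
  proof (rule that[OF c])
    fix n :: nat and T \<eta> :: real and \<theta> :: "nat \<Rightarrow> real"
    assume \<eta>: "0 < \<eta>" "\<eta> \<le> 1" and T: "0 < T" "T \<le> \<eta>" "T \<le> 1 / 2" "540 * sqrt T \<le> 1"
    interpret P: prob_space "PN n" by (rule prob_space_PN)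
    define S where "S = support n \<theta>"
    define A where "A = {..<n} - S"
    \<comment> \<open>The grid ratio costs n \<rho> in the log-likelihood, hence n \<rho>/2 = n c
      \<eta>^2/4 after the square root, a quarter of what the affinity would gain on n null
      coordinates.\<close>
    define \<rho> where "\<rho> = c * \<eta>\<^sup>2 / 2"
    \<comment> \<open>The threshold solves exp (n \<rho>) V^2 T^(-s) = exp (-2 n T), with s =
      \<open>card S\<close>: off the bad events the null part, even after the losses from the grid
      and the signals, falls below the null likelihood at T.\<close>
    define V where "V = exp (- (real n * \<rho> + real (card S) * ln (1 / T) + 2 * real n * T) / 2)"
    define N where "N = nat \<lceil>1 / (\<rho> * \<eta>)\<rceil>"
    \<comment> \<open>An arithmetic grid of step \<rho> \<eta> suffices: all points are at least
      \<eta>, so consecutive ratios are at most 1 + \<rho>.\<close>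
    define t where "t = (\<lambda>j::nat. \<eta> + real j * (\<rho> * \<eta>))"
    define J where "J = {j. j \<le> N \<and> t j \<le> 1}"
    define E where "E = (\<lambda>j. {\<omega> \<in> space (PN n). V \<le> (\<Prod>i\<in>A. sqrt (hs_ratio (t j) (\<omega> i)))})"
    have S: "S \<subseteq> {..<n}" "finite S" and A: "A \<subseteq> {..<n}" "finite A" "A \<inter> S = {}" "A \<union> S = {..<n}"
      by (auto simp: S_def A_def support_def)
    have cA: "card A = n - card S" using card_Diff_subset[OF S(2,1)] by (simp add: A_def)
    have \<rho>: "0 < \<rho>" using c \<eta> by (simp add: \<rho>_def)
    have V: "0 < V" by (simp add: V_def)
    have tpos: "\<eta> \<le> t j" for j using \<rho> \<eta> by (simp add: t_def)
    have fJ: "finite J" by (rule finite_subset[of _ "{..N}"]) (auto simp: J_def)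
    have Em: "E j \<in> sets (PN n)" for j
    proof -
      have "(\<lambda>\<omega>. \<Prod>i\<in>A. sqrt (hs_ratio (t j) (\<omega> i))) \<in> borel_measurable (PN n)"
      proof (rule borel_measurable_prod)
        fix i assume "i \<in> A"
        then have "i \<in> {..<n}" using A by auto
        then show "(\<lambda>\<omega>. sqrt (hs_ratio (t j) (\<omega> i))) \<in> borel_measurable (PN n)" by measurable
      qed
      then show ?thesis unfolding E_def by measurable
    qed
    show "\<exists>B\<in>sets (PN n). (\<forall>\<omega>\<in>space (PN n) - B. \<forall>\<tau>\<in>{\<eta>..1}. hs_loglik n (\<lambda>i. \<theta> i + \<omega> i) \<tau> < hs_loglik n (\<lambda>i. \<theta> i + \<omega> i) T) \<and>
        measure (PN n) B \<le> (2 / (c * \<eta> ^ 3) + 2) *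
          exp (- (real (n - card (support n \<theta>)) * c * \<eta>\<^sup>2) + (real n * c * \<eta>\<^sup>2 / 4 + real (card (support n \<theta>)) * ln (1 / T) / 2 + real n * T))"
    proof (rule bexI[of _ "\<Union>j\<in>J. E j"], intro conjI ballI)
      show "(\<Union>j\<in>J. E j) \<in> sets (PN n)" using fJ Em by auto
      fix \<omega> \<tau> assume \<omega>: "\<omega> \<in> space (PN n) - (\<Union>j\<in>J. E j)" and \<tau>: "\<tau> \<in> {\<eta>..1}"
      have \<tau>0: "0 < \<tau>" "\<tau> \<le> 1" "T \<le> \<tau>" using \<tau> \<eta> T by auto
      define x where "x = (\<lambda>i. \<theta> i + \<omega> i)"
      define j where "j = nat \<lfloor>(\<tau> - \<eta>) / (\<rho> * \<eta>)\<rfloor>"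
      have q0: "0 \<le> (\<tau> - \<eta>) / (\<rho> * \<eta>)" using \<tau> \<rho> \<eta> by simp
      have j1: "real j \<le> (\<tau> - \<eta>) / (\<rho> * \<eta>)" "(\<tau> - \<eta>) / (\<rho> * \<eta>) < real j + 1"
        using q0 by (auto simp: j_def)
      have tj: "t j \<le> \<tau>" using j1(1) \<rho> \<eta> by (simp add: t_def field_simps)
      have tj2: "\<tau> \<le> (1 + \<rho>) * t j"
      proof -
        have "\<tau> - \<eta> \<le> (real j + 1) * (\<rho> * \<eta>)" using j1(2) \<rho> \<eta> by (simp add: field_simps)
        then have "\<tau> \<le> t j + \<rho> * \<eta>" by (simp add: t_def algebra_simps)
        also have "\<dots> \<le> t j + \<rho> * t j" using tpos[of j] \<rho> by simp
        finally show ?thesis by (simp add: algebra_simps)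
      qed
      have "real j \<le> 1 / (\<rho> * \<eta>)"
        using \<tau> \<rho> \<eta> by (intro order_trans[OF j1(1)] divide_right_mono) auto
      then have "real j \<le> real N" unfolding N_def by linarith
      then have "j \<in> J" using tj \<tau> by (simp add: J_def)
      then have nE: "(\<Prod>i\<in>A. sqrt (hs_ratio (t j) (\<omega> i))) < V" using \<omega> by (auto simp: E_def not_le)
      have tj0: "0 < t j" "t j \<le> 1" using tpos[of j] \<eta> tj \<tau> by auto
      have xA: "x i = \<omega> i" if "i \<in> A" for i using that by (auto simp: x_def A_def S_def support_def)
      \<comment> \<open>Moving down to the grid point below \<tau> multiplies each factor by at most
        1 + \<rho>. The square of \<open>V\<close> appears because the events concern products of
        square roots.\<close>
      have RA: "(\<Prod>i\<in>A. hs_ratio \<tau> (x i)) < exp (real n * \<rho>) * V\<^sup>2"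
      proof -
        have "(\<Prod>i\<in>A. hs_ratio \<tau> (x i)) \<le> (\<Prod>i\<in>A. (1 + \<rho>) * hs_ratio (t j) (x i))"
        proof (rule prod_mono)
          fix i assume "i \<in> A"
          have "hs_ratio \<tau> (x i) \<le> \<tau> / t j * hs_ratio (t j) (x i)" by (rule hs_ratio_le_scale[OF tj0(1) tj])
          also have "\<dots> \<le> (1 + \<rho>) * hs_ratio (t j) (x i)"
            using tj2 tj0 hs_ratio_pos[OF tj0, of "x i"] by (intro mult_right_mono) (auto simp: divide_le_eq)
          finally show "0 \<le> hs_ratio \<tau> (x i) \<and> hs_ratio \<tau> (x i) \<le> (1 + \<rho>) * hs_ratio (t j) (x i)"
            using hs_ratio_pos[OF \<tau>0(1,2), of "x i"] by simp
        qed
        also have "\<dots> = (1 + \<rho>) ^ card A * (\<Prod>i\<in>A. sqrt (hs_ratio (t j) (\<omega> i)))\<^sup>2"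
        proof -
          have "(\<Prod>i\<in>A. sqrt (hs_ratio (t j) (\<omega> i)))\<^sup>2 = (\<Prod>i\<in>A. (sqrt (hs_ratio (t j) (\<omega> i)))\<^sup>2)"
            by (rule prod_power_distrib)
          also have "\<dots> = (\<Prod>i\<in>A. hs_ratio (t j) (\<omega> i))"
            using hs_ratio_pos[OF tj0] by (intro prod.cong) (auto simp: less_imp_le)
          also have "\<dots> = (\<Prod>i\<in>A. hs_ratio (t j) (x i))" by (simp add: xA)
          finally show ?thesis by (simp only: prod.distrib prod_constant)
        qed
        also have "\<dots> \<le> exp (real n * \<rho>) * (\<Prod>i\<in>A. sqrt (hs_ratio (t j) (\<omega> i)))\<^sup>2"
        proof (rule mult_right_mono)
          have "(1 + \<rho>) ^ card A \<le> (1 + \<rho>) ^ n" using \<rho> cA by (intro power_increasing) auto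
          also have "\<dots> \<le> exp \<rho> ^ n" using \<rho> exp_ge_add_one_self[of \<rho>] by (intro power_mono) auto
          also have "\<dots> = exp (real n * \<rho>)" by (simp add: exp_of_nat_mult)
          finally show "(1 + \<rho>) ^ card A \<le> exp (real n * \<rho>)" .
        qed simp
        also have "\<dots> < exp (real n * \<rho>) * V\<^sup>2"
          using nE by (intro mult_strict_left_mono power_strict_mono prod_nonneg) (auto simp: hs_ratio_pos[OF tj0] less_imp_le)
        finally show ?thesis .
      qed
      \<comment> \<open>Each signal coordinate costs at most \<tau>/T <= 1/T, by the monotonicity of
        the ratio divided by \<tau>.\<close>
      have RS: "(\<Prod>i\<in>S. hs_ratio \<tau> (x i)) \<le> exp (real (card S) * ln (1 / T)) * (\<Prod>i\<in>S. hs_ratio T (x i))"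
      proof -
        have T1: "T \<le> 1" using T by simp
        have "(\<Prod>i\<in>S. hs_ratio \<tau> (x i)) \<le> (\<Prod>i\<in>S. 1 / T * hs_ratio T (x i))"
        proof (rule prod_mono)
          fix i
          have "hs_ratio \<tau> (x i) \<le> \<tau> / T * hs_ratio T (x i)" by (rule hs_ratio_le_scale[OF T(1) \<tau>0(3)])
          also have "\<dots> \<le> 1 / T * hs_ratio T (x i)"
            using \<tau>0 T hs_ratio_pos[OF T(1) T1, of "x i"] by (intro mult_right_mono divide_right_mono) auto
          finally show "0 \<le> hs_ratio \<tau> (x i) \<and> hs_ratio \<tau> (x i) \<le> 1 / T * hs_ratio T (x i)"
            using hs_ratio_pos[OF \<tau>0(1,2), of "x i"] by simp
        qed
        also have "\<dots> = (1 / T) ^ card S * (\<Prod>i\<in>S. hs_ratio T (x i))" by (simp only: prod.distrib prod_constant)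
        also have "(1 / T) ^ card S = exp (real (card S) * ln (1 / T))" using T by (simp add: exp_of_nat_mult)
        finally show ?thesis .
      qed
      have LA: "exp (- (2 * real n * T)) \<le> (\<Prod>i\<in>A. hs_ratio T (x i))"
      proof -
        have e: "exp (- (2 * T)) \<le> 1 - T"
        proof -
          have "T * T \<le> T * (1 / 2)" using T by (intro mult_left_mono) auto
          then have "- (2 * T) \<le> ln (1 - T)"
            using ln_one_minus_pos_lower_bound[of T] T unfolding power2_eq_square by linarith
          then have "exp (- (2 * T)) \<le> exp (ln (1 - T))" by simp
          then show ?thesis using T by simp
        qed
        have "exp (- (2 * real n * T)) = exp (- (2 * T)) ^ n" by (simp add: exp_of_nat_mult[symmetric] mult_ac)
        also have "\<dots> \<le> exp (- (2 * T)) ^ card A" using T cA by (intro power_decreasing) auto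
        also have "\<dots> = (\<Prod>i\<in>A. exp (- (2 * T)))" by simp
        also have "\<dots> \<le> (\<Prod>i\<in>A. hs_ratio T (x i))"
          using T by (intro prod_mono conjI order_trans[OF e hs_ratio_lower]) auto
        finally show ?thesis .
      qed
      have T1: "T \<le> 1" using T by simp
      have split: "(\<Prod>i<n. f i) = (\<Prod>i\<in>A. f i) * (\<Prod>i\<in>S. f i)" for f :: "nat \<Rightarrow> real"
        using prod.union_disjoint[of A S f] A S by simp
      have "exp (hs_loglik n x \<tau>) = (\<Prod>i\<in>A. hs_ratio \<tau> (x i)) * (\<Prod>i\<in>S. hs_ratio \<tau> (x i))"
        unfolding exp_hs_loglik[OF \<tau>0(1,2)] by (rule split)
      also have "\<dots> < (exp (real n * \<rho>) * V\<^sup>2) * (\<Prod>i\<in>S. hs_ratio \<tau> (x i))"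
        using RA by (intro mult_strict_right_mono prod_pos) (auto simp: hs_ratio_pos[OF \<tau>0(1,2)])
      also have "\<dots> \<le> (exp (real n * \<rho>) * V\<^sup>2) * (exp (real (card S) * ln (1 / T)) * (\<Prod>i\<in>S. hs_ratio T (x i)))"
        using RS by (intro mult_left_mono) auto
      also have "\<dots> = (exp (real n * \<rho>) * V\<^sup>2 * exp (real (card S) * ln (1 / T))) * (\<Prod>i\<in>S. hs_ratio T (x i))"
        by (simp only: mult_ac)
      also have "exp (real n * \<rho>) * V\<^sup>2 * exp (real (card S) * ln (1 / T)) = exp (- (2 * real n * T))"
        unfolding V_def exp_double[symmetric] exp_add[symmetric] by (simp add: field_simps)
      also have "\<dots> * (\<Prod>i\<in>S. hs_ratio T (x i)) \<le> (\<Prod>i\<in>A. hs_ratio T (x i)) * (\<Prod>i\<in>S. hs_ratio T (x i))"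
        using LA by (intro mult_right_mono prod_nonneg) (auto simp: hs_ratio_pos[OF T(1) T1] less_imp_le)
      also have "\<dots> = exp (hs_loglik n x T)"
        unfolding exp_hs_loglik[OF T(1) T1] by (rule split[symmetric])
      finally show "hs_loglik n (\<lambda>i. \<theta> i + \<omega> i) \<tau> < hs_loglik n (\<lambda>i. \<theta> i + \<omega> i) T"
        by (simp add: x_def)
    next
      have Ej: "measure (PN n) (E j) \<le> exp (- (real (card A) * (c * \<eta>\<^sup>2))) / V" if "j \<in> J" for j
      proof -
        have tj: "0 < t j" "t j \<le> 1" using tpos[of j] \<eta> that by (auto simp: J_def)
        define I where "I = (\<integral>x. sqrt (hs_ratio (t j) x) \<partial>N01)"
        have I0: "0 \<le> I" unfolding I_def by (intro integral_nonneg_AE AE_I2) (auto simp: hs_ratio_pos[OF tj] less_imp_le)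
        have "\<eta>\<^sup>2 \<le> (t j)\<^sup>2" using tpos[of j] \<eta> by (intro power_mono) auto
        then have "c * \<eta>\<^sup>2 \<le> c * (t j)\<^sup>2" using c by (intro mult_left_mono) auto
        then have "I \<le> 1 - c * \<eta>\<^sup>2" using H(2)[OF tj] unfolding I_def by linarith
        also have "\<dots> \<le> exp (- (c * \<eta>\<^sup>2))" using exp_ge_add_one_self[of "- (c * \<eta>\<^sup>2)"] by simp
        finally have "I ^ card A \<le> exp (- (c * \<eta>\<^sup>2)) ^ card A" using I0 by (intro power_mono)
        also have "\<dots> = exp (- (real (card A) * (c * \<eta>\<^sup>2)))" by (simp add: exp_of_nat_mult[symmetric])
        finally have "I ^ card A / V \<le> exp (- (real (card A) * (c * \<eta>\<^sup>2))) / V" using V by (intro divide_right_mono) auto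
        moreover have "measure (PN n) (E j) \<le> I ^ card A / V"
          unfolding E_def I_def using hs_ratio_pos[OF tj]
          by (intro PN_prod_Markov[OF A(1) H(1)[OF tj] _ V]) (auto simp: less_imp_le)
        ultimately show ?thesis by linarith
      qed
      have "measure (PN n) (\<Union>j\<in>J. E j) \<le> (\<Sum>j\<in>J. measure (PN n) (E j))"
        using fJ Em by (intro P.finite_measure_subadditive_finite) auto
      also have "\<dots> \<le> (\<Sum>j\<in>J. exp (- (real (card A) * (c * \<eta>\<^sup>2))) / V)" by (intro sum_mono Ej)
      also have "\<dots> = real (card J) * (exp (- (real (card A) * (c * \<eta>\<^sup>2))) / V)" by simp
      also have "\<dots> \<le> (2 / (c * \<eta> ^ 3) + 2) * (exp (- (real (card A) * (c * \<eta>\<^sup>2))) / V)"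
      proof (rule mult_right_mono)
        have "card J \<le> card {..N}" by (intro card_mono) (auto simp: J_def)
        then have "real (card J) \<le> real N + 1" by simp
        also have "real N \<le> 1 / (\<rho> * \<eta>) + 1" unfolding N_def using \<rho> \<eta> by simp
        also have "1 / (\<rho> * \<eta>) = 2 / (c * \<eta> ^ 3)" by (simp add: \<rho>_def power2_eq_square power3_eq_cube)
        finally show "real (card J) \<le> 2 / (c * \<eta> ^ 3) + 2" by simp
      qed (use V in simp)
      also have "exp (- (real (card A) * (c * \<eta>\<^sup>2))) / V = exp (- (real (n - card S) * c * \<eta>\<^sup>2) + (real n * c * \<eta>\<^sup>2 / 4 + real (card S) * ln (1 / T) / 2 + real n * T))"
        unfolding V_def exp_diff[symmetric] cA \<rho>_def by (simp add: field_simps)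
      finally show "measure (PN n) (\<Union>j\<in>J. E j) \<le> (2 / (c * \<eta> ^ 3) + 2) *
          exp (- (real (n - card (support n \<theta>)) * c * \<eta>\<^sup>2) + (real n * c * \<eta>\<^sup>2 / 4 + real (card (support n \<theta>)) * ln (1 / T) / 2 + real n * T))"
        by (simp add: S_def)
    qed
  qed
qed

section \<open>The score at the true scale\<close>

lemma zeta_exp:
  assumes "1 \<le> s" "s \<le> n"
  shows "exp (- (zeta n s)\<^sup>2 / 2) = real s / real n" "0 \<le> zeta n s"
proof -
  have "1 \<le> real n / real s" using assms by (simp add: le_divide_eq)
  then have l: "0 \<le> ln (real n / real s)" by simp
  then have "(zeta n s)\<^sup>2 = 2 * ln (real n / real s)" by (simp add: zeta_def)
  then have "exp (- (zeta n s)\<^sup>2 / 2) = inverse (exp (ln (real n / real s)))" by (simp add: exp_minus)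
  then show "exp (- (zeta n s)\<^sup>2 / 2) = real s / real n" using assms by simp
  show "0 \<le> zeta n s" using l by (simp add: zeta_def)
qed

lemma zeta_at_top:
  assumes "\<And>n. n \<ge> 1 \<Longrightarrow> 1 \<le> s n \<and> s n \<le> n" "(\<lambda>n. real (s n) / real n) \<longlonglongrightarrow> 0"
  shows "filterlim (\<lambda>n. zeta n (s n)) at_top sequentially"
proof -
  have "filterlim (\<lambda>n. real (s n) / real n) (at_right 0) sequentially"
  proof (rule tendsto_imp_filterlim_at_right[OF assms(2)])
    show "\<forall>\<^sub>F n in sequentially. 0 < real (s n) / real n"
      using eventually_ge_at_top[of 1]
    proof eventually_elim
      case (elim n)
      then show ?case using assms(1)[of n] by simp
    qed
  qed
  then have "filterlim (\<lambda>n. inverse (real (s n) / real n)) at_top sequentially"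
    by (rule filterlim_compose[OF filterlim_inverse_at_top_right])
  then have "filterlim (\<lambda>n. real n / real (s n)) at_top sequentially" by simp
  moreover have "filterlim (\<lambda>y::real. sqrt (2 * ln y)) at_top at_top" by real_asymp
  ultimately show ?thesis unfolding zeta_def by (rule filterlim_compose[rotated])
qed

lemma support_sum_split:
  fixes f :: "nat \<Rightarrow> real"
  shows "(\<Sum>i<n. f i) = (\<Sum>i\<in>{..<n} - support n \<theta>. f i) + (\<Sum>i\<in>support n \<theta>. f i)"
  by (rule sum.subset_diff) (auto simp: support_def)

lemma card_null: "card ({..<n} - support n \<theta>) = n - card (support n \<theta>)"
  by (subst card_Diff_subset) (auto simp: support_def)

text \<open>After multiplication by z/n the mean is m1/\<kappa> - (1 - s/n) z M, where m1 is the
  mean signal weight and -M the mean null score. The second moments contribute at most 3 z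
  M/(\<kappa> s) from the nulls and 4/(\<kappa>^2 s) from the signals, so s tending to infinity
  forces concentration. The score is even and the noise symmetric, so every signal has the same mean
  whatever its sign; this makes p independent of \<theta>.\<close>

lemma hs_score_concentration:
  fixes s :: "nat \<Rightarrow> nat" and b \<kappa> \<epsilon> :: real
  assumes \<kappa>: "0 < \<kappa>" and \<epsilon>: "0 < \<epsilon>"
    and s: "\<And>n. n \<ge> 1 \<Longrightarrow> 1 \<le> s n \<and> s n \<le> n" "filterlim s at_top sequentially"
    "(\<lambda>n. real (s n) / real n) \<longlonglongrightarrow> 0"
  shows "\<exists>p. p \<longlonglongrightarrow> 0 \<and> (\<forall>\<^sub>F n in sequentially. \<forall>\<theta>\<in>sparse_class n (s n) b.
    measure (PN n) {\<omega> \<in> space (PN n). \<epsilon> \<le> \<bar>zeta n (s n) / real n * (\<Sum>i<n. hs_score (hs_T \<kappa> (zeta n (s n))) (\<theta> i + \<omega> i))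
       - (cdf N01 b / \<kappa> - C_star)\<bar>} \<le> p n)"
proof -
  define z where "z = (\<lambda>n. zeta n (s n))"
  define T where "T = (\<lambda>n. hs_T \<kappa> (z n))"
  define M where "M = (\<lambda>n. \<integral>x. hs_g x * hs_w (T n) x \<partial>N01)"
  define m1 where "m1 = (\<lambda>n. \<integral>x. hs_w (T n) (z n + b - x) \<partial>N01)"
  define \<mu> where "\<mu> = cdf N01 b / \<kappa> - C_star"
  define q where "q = (\<lambda>n. m1 n / \<kappa> - (1 - real (s n) / real n) * (z n * M n))"
  \<comment> \<open>The factor 4/\<epsilon>^2 arises because half of \<epsilon> is reserved for the
    deterministic distance between q and \<mu>.\<close>
  define p where "p = (\<lambda>n. 4 / \<epsilon>\<^sup>2 * ((3 * (z n * M n) / \<kappa> + 4 / \<kappa>\<^sup>2) / real (s n)))"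
  interpret N: prob_space N01 by (rule prob_space_N01)
  have zlim: "filterlim z at_top sequentially" unfolding z_def by (rule zeta_at_top[OF s(1,3)])
  have Mlim: "(\<lambda>n. z n * M n) \<longlonglongrightarrow> C_star"
    unfolding M_def T_def by (rule filterlim_compose[OF hs_null_mean_scaled[OF \<kappa>] zlim])
  have mlim: "m1 \<longlonglongrightarrow> cdf N01 b"
    unfolding m1_def T_def by (rule filterlim_compose[OF hs_w_signal_mean[OF \<kappa>] zlim])
  have "q \<longlonglongrightarrow> cdf N01 b / \<kappa> - (1 - 0) * C_star"
    unfolding q_def using \<kappa> by (intro tendsto_intros Mlim mlim s(3)) auto
  then have qlim: "q \<longlonglongrightarrow> \<mu>" by (simp add: \<mu>_def)
  have "filterlim (\<lambda>n. real (s n)) at_top sequentially"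
    by (rule filterlim_compose[OF filterlim_real_sequentially s(2)])
  then have "(\<lambda>n. (3 * (z n * M n) / \<kappa> + 4 / \<kappa>\<^sup>2) / real (s n)) \<longlonglongrightarrow> 0"
    by (intro tendsto_divide_0[where c="3 * C_star / \<kappa> + 4 / \<kappa>\<^sup>2"] filterlim_at_top_imp_at_infinity tendsto_intros Mlim)
      (use \<kappa> in auto)
  from tendsto_mult_right_zero[OF this, of "4 / \<epsilon>\<^sup>2"] have plim: "p \<longlonglongrightarrow> 0" by (simp add: p_def)
  have evq: "\<forall>\<^sub>F n in sequentially. \<bar>q n - \<mu>\<bar> < \<epsilon> / 2"
    using tendstoD[OF qlim, of "\<epsilon> / 2"] \<epsilon> by (simp add: dist_real_def)
  have evT: "\<forall>\<^sub>F n in sequentially. 0 < T n \<and> T n < 1"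
    unfolding T_def using filterlim_iff[THEN iffD1, OF zlim, rule_format, OF eventually_hs_T[OF \<kappa>, of 1]] by simp
  have evz: "\<forall>\<^sub>F n in sequentially. 0 < z n"
    using filterlim_at_top_dense[THEN iffD1, OF zlim] by blast
  have main: "\<forall>\<^sub>F n in sequentially. \<forall>\<theta>\<in>sparse_class n (s n) b.
    measure (PN n) {\<omega> \<in> space (PN n). \<epsilon> \<le> \<bar>z n / real n * (\<Sum>i<n. hs_score (T n) (\<theta> i + \<omega> i)) - \<mu>\<bar>} \<le> p n"
    using evq evT evz eventually_ge_at_top[of 1]
  proof eventually_elim
    case (elim n)
    interpret P: prob_space "PN n" by (rule prob_space_PN)
    have T: "0 < T n" "T n \<le> 1" using elim by auto
    have n: "0 < real n" and sn: "1 \<le> s n" "s n \<le> n" using elim s(1)[of n] by auto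
    have sp: "0 < real (s n)" using sn by simp
    have z: "0 < z n" using elim by simp
    have Tn: "T n = \<kappa> * z n * (real (s n) / real n)"
      by (simp only: T_def hs_T_def z_def zeta_exp(1)[OF sn])
    show ?case
    proof
      fix \<theta> assume \<theta>: "\<theta> \<in> sparse_class n (s n) b"
      then have card: "card (support n \<theta>) = s n" and sig: "\<And>i. i \<in> support n \<theta> \<Longrightarrow> \<bar>\<theta> i\<bar> = z n + b"
        by (auto simp: sparse_class_def z_def)
      have null: "\<theta> i = 0" if "i \<in> {..<n} - support n \<theta>" for i using that by (auto simp: support_def)
      define f where "f = (\<lambda>i x. hs_score (T n) (\<theta> i + x))"
      have fm: "f i \<in> borel_measurable borel" for i unfolding f_def by measurable
      have fB: "\<bar>f i x\<bar> \<le> 2 / T n" for i x unfolding f_def by (rule hs_score_bound[OF T])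
      have sigmean: "(\<integral>x. f i x \<partial>N01) = m1 n / T n" if "i \<in> support n \<theta>" for i
      proof -
        have "(\<integral>x. f i x \<partial>N01) = (\<integral>x. hs_score (T n) (z n + b - x) \<partial>N01)"
        proof (cases "0 \<le> \<theta> i")
          case True
          then have "\<theta> i = z n + b" using sig[OF that] by simp
          then show ?thesis using N01_integral_uminus[OF fm, of i] by (simp add: f_def)
        next
          case False
          then have e: "\<theta> i = - (z n + b)" using sig[OF that] by simp
          have "f i x = hs_score (T n) (z n + b - x)" for x
            unfolding f_def e using hs_score_minus[of "T n" "z n + b - x"] by (simp add: algebra_simps)
          then show ?thesis by simp
        qed
        also have "\<dots> = m1 n / T n" unfolding m1_def using T by (simp add: hs_score_eq_w)
        finally show ?thesis .
      qed
      have nullmean: "(\<integral>x. f i x \<partial>N01) = - M n" if "i \<in> {..<n} - support n \<theta>" for i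
        using hs_score_null(1)[OF T] null[OF that] by (simp add: f_def M_def)
      have nullsq: "(\<integral>x. (f i x)\<^sup>2 \<partial>N01) \<le> 3 / T n * M n" if "i \<in> {..<n} - support n \<theta>" for i
        using hs_score_null(2)[OF T] null[OF that] by (simp add: f_def M_def)
      have sigsq: "(\<integral>x. (f i x)\<^sup>2 \<partial>N01) \<le> (2 / T n)\<^sup>2" for i
      proof -
        have le: "(f i x)\<^sup>2 \<le> (2 / T n)\<^sup>2" for x using power_mono[OF fB abs_ge_zero, of i x 2] by simp
        have "(\<integral>x. (f i x)\<^sup>2 \<partial>N01) \<le> (\<integral>x. (2 / T n)\<^sup>2 \<partial>N01)"
          by (intro integral_mono le N.integrable_const N.integrable_const_bound[where B="(2 / T n)\<^sup>2"])
            (use le fm in auto)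
        then show ?thesis by (simp add: N01_UNIV)
      qed
      have M0: "0 \<le> M n"
      proof -
        have "0 \<le> (\<integral>x. (hs_score (T n) x)\<^sup>2 \<partial>N01)" by (intro integral_nonneg_AE) auto
        also have "\<dots> \<le> 3 / T n * M n" using hs_score_null(2)[OF T] by (simp add: M_def)
        finally show ?thesis using T by (simp add: zero_le_divide_iff)
      qed
      define mean where "mean = (\<Sum>i<n. \<integral>x. f i x \<partial>N01)"
      have "mean = real (n - s n) * (- M n) + real (s n) * (m1 n / T n)"
        unfolding mean_def support_sum_split[where n=n and \<theta>=\<theta>] using sigmean nullmean
        by (simp add: card card_null)
      then have mean: "z n / real n * mean = q n"
        using n z \<kappa> sp sn unfolding q_def Tn by (simp add: of_nat_diff field_simps)
      define V where "V = (\<Sum>i<n. \<integral>x. (f i x)\<^sup>2 \<partial>N01)"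
      have "V \<le> real (n - s n) * (3 / T n * M n) + real (s n) * (2 / T n)\<^sup>2"
        unfolding V_def support_sum_split[where n=n and \<theta>=\<theta>]
      proof (rule add_mono)
        show "(\<Sum>i\<in>{..<n} - support n \<theta>. \<integral>x. (f i x)\<^sup>2 \<partial>N01) \<le> real (n - s n) * (3 / T n * M n)"
          using sum_bounded_above[of "{..<n} - support n \<theta>", OF nullsq] by (simp only: card card_null)
        show "(\<Sum>i\<in>support n \<theta>. \<integral>x. (f i x)\<^sup>2 \<partial>N01) \<le> real (s n) * (2 / T n)\<^sup>2"
          using sum_bounded_above[of "support n \<theta>", OF sigsq] by (simp only: card)
      qed
      also have "\<dots> \<le> real n * (3 / T n * M n) + real (s n) * (2 / T n)\<^sup>2"
        using M0 T by (intro add_right_mono mult_right_mono) auto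
      finally have V: "V \<le> real n * (3 / T n * M n) + real (s n) * (2 / T n)\<^sup>2" .
      define a where "a = \<epsilon> / 2 * real n / z n"
      have a: "0 < a" using \<epsilon> n z by (simp add: a_def)
      have "measure (PN n) {\<omega> \<in> space (PN n). \<epsilon> \<le> \<bar>z n / real n * (\<Sum>i<n. hs_score (T n) (\<theta> i + \<omega> i)) - \<mu>\<bar>}
        \<le> measure (PN n) {\<omega> \<in> space (PN n). a \<le> \<bar>(\<Sum>i<n. f i (\<omega> i)) - mean\<bar>}"
      proof (rule P.finite_measure_mono)
        show "{\<omega> \<in> space (PN n). a \<le> \<bar>(\<Sum>i<n. f i (\<omega> i)) - mean\<bar>} \<in> sets (PN n)"
          using fm by measurable
        show "{\<omega> \<in> space (PN n). \<epsilon> \<le> \<bar>z n / real n * (\<Sum>i<n. hs_score (T n) (\<theta> i + \<omega> i)) - \<mu>\<bar>}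
          \<subseteq> {\<omega> \<in> space (PN n). a \<le> \<bar>(\<Sum>i<n. f i (\<omega> i)) - mean\<bar>}"
        proof clarify
          fix \<omega> assume w: "\<epsilon> \<le> \<bar>z n / real n * (\<Sum>i<n. hs_score (T n) (\<theta> i + \<omega> i)) - \<mu>\<bar>"
          define Y where "Y = (\<Sum>i<n. f i (\<omega> i))"
          have "\<epsilon> \<le> \<bar>z n / real n * Y - \<mu>\<bar>" using w by (simp add: Y_def f_def)
          moreover have "\<epsilon> / 2 \<le> \<bar>A - q n\<bar>" if "\<epsilon> \<le> \<bar>A - \<mu>\<bar>" for A
            using elim(1) that by linarith
          ultimately have "\<epsilon> / 2 \<le> \<bar>z n / real n * Y - q n\<bar>" by blast
          also have "z n / real n * Y - q n = z n / real n * (Y - mean)"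
            unfolding mean[symmetric] by (simp add: right_diff_distrib)
          also have "\<bar>\<dots>\<bar> = z n / real n * \<bar>Y - mean\<bar>" using z n by (simp add: abs_mult)
          finally show "a \<le> \<bar>(\<Sum>i<n. f i (\<omega> i)) - mean\<bar>"
            using z n unfolding a_def Y_def[symmetric] by (simp add: field_simps)
        qed
      qed
      also have "\<dots> \<le> V / a\<^sup>2"
        unfolding mean_def V_def by (rule PN_Chebyshev[OF fm fB a])
      also have "\<dots> \<le> (real n * (3 / T n * M n) + real (s n) * (2 / T n)\<^sup>2) / a\<^sup>2"
        using V by (intro divide_right_mono) auto
      also have "\<dots> = p n"
        using n z \<kappa> sp \<epsilon> unfolding p_def a_def Tn
        by (simp add: power_mult_distrib power_divide divide_simps) (simp add: algebra_simps power2_eq_square)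
      finally show "measure (PN n) {\<omega> \<in> space (PN n). \<epsilon> \<le> \<bar>z n / real n * (\<Sum>i<n. hs_score (T n) (\<theta> i + \<omega> i)) - \<mu>\<bar>} \<le> p n" .
    qed
  qed
  show ?thesis
    using plim main by (intro exI[of _ p]) (simp add: z_def T_def \<mu>_def)
qed

text \<open>A real \<open>SUP\<close> over the empty set has no useful value, so the class must
  eventually be nonempty before the supremum can be sandwiched.\<close>

lemma sparse_class_nonempty:
  assumes "s \<le> n" "0 < zeta n s + b"
  shows "sparse_class n s b \<noteq> {}"
proof -
  define \<theta> where "\<theta> = (\<lambda>i\<in>{..<n}. if i < s then zeta n s + b else 0)"
  have S: "support n \<theta> = {..<s}" using assms by (auto simp: support_def \<theta>_def)
  have "\<theta> \<in> {..<n} \<rightarrow>\<^sub>E UNIV" by (simp add: \<theta>_def)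
  moreover have "\<bar>\<theta> i\<bar> = zeta n s + b" if "i < s" for i using that assms by (simp add: \<theta>_def)
  ultimately have "\<theta> \<in> sparse_class n s b" by (simp add: sparse_class_def S)
  then show ?thesis by auto
qed

lemma measure_sample_law:
  assumes "Measurable.pred (PiM {..<n} (\<lambda>_. borel)) Q"
  shows "measure (sample_law n \<theta>) {x \<in> space (sample_law n \<theta>). Q x} =
    measure (PN n) {\<omega> \<in> space (PN n). Q (\<lambda>i\<in>{..<n}. \<theta> i + \<omega> i)}"
proof -
  have m: "(\<lambda>\<omega>. \<lambda>i\<in>{..<n}. \<theta> i + \<omega> i) \<in> PN n \<rightarrow>\<^sub>M PiM {..<n} (\<lambda>_. borel)" by measurable
  have "{x \<in> space (PiM {..<n} (\<lambda>_. borel)). Q x} \<in> sets (PiM {..<n} (\<lambda>_. borel))"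
    using assms by (rule predE)
  from measure_distr[OF m this]
  have "measure (sample_law n \<theta>) {x \<in> space (PiM {..<n} (\<lambda>_. borel)). Q x} =
    measure (PN n) ((\<lambda>\<omega>. \<lambda>i\<in>{..<n}. \<theta> i + \<omega> i) -` {x \<in> space (PiM {..<n} (\<lambda>_. borel)). Q x} \<inter> space (PN n))"
    by (simp only: sample_law_def)
  also have "(\<lambda>\<omega>. \<lambda>i\<in>{..<n}. \<theta> i + \<omega> i) -` {x \<in> space (PiM {..<n} (\<lambda>_. borel)). Q x} \<inter> space (PN n)
    = {\<omega> \<in> space (PN n). Q (\<lambda>i\<in>{..<n}. \<theta> i + \<omega> i)}"
  proof (rule set_eqI)
    fix \<omega>
    have "\<omega> \<in> space (PN n) \<Longrightarrow> (\<lambda>i\<in>{..<n}. \<theta> i + \<omega> i) \<in> space (PiM {..<n} (\<lambda>_. borel))"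
      by (rule measurable_space[OF m])
    then show "\<omega> \<in> (\<lambda>\<omega>. \<lambda>i\<in>{..<n}. \<theta> i + \<omega> i) -` {x \<in> space (PiM {..<n} (\<lambda>_. borel)). Q x} \<inter> space (PN n)
      \<longleftrightarrow> \<omega> \<in> {\<omega> \<in> space (PN n). Q (\<lambda>i\<in>{..<n}. \<theta> i + \<omega> i)}"
      by (simp only: Int_iff vimage_eq mem_Collect_eq) argo
  qed
  finally show ?thesis by (simp only: sample_law_def space_distr)
qed

section \<open>Location of the maximiser\<close>

lemma hs_loglik_cong: "(\<And>i. i < n \<Longrightarrow> x i = y i) \<Longrightarrow> hs_loglik n x \<tau> = hs_loglik n y \<tau>"
  by (simp add: hs_loglik_def)

text \<open>The deterministic part of the argument. A positive score at the inner point \<kappa>'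
  rules out smaller maximisers, a negative one at \<kappa>'' larger ones. Outside the target
  interval the distance to the inner point is at least a fixed fraction d of the larger of the two
  values, so the tangent gain is proportional to that value and exceeds the linearisation
  error.\<close>

lemma mmle_location:
  fixes z \<eta> :: real and n :: nat and x :: "nat \<Rightarrow> real"
  assumes n: "1 \<le> n" and z: "0 < z"
    and \<kappa>: "0 \<le> \<kappa>1" "\<kappa>1 < \<kappa>'" "0 < \<kappa>''" "\<kappa>'' < \<kappa>2"
    and \<epsilon>: "0 < \<epsilon>'" "0 < \<epsilon>''"
    and T': "1 / real n \<le> hs_T \<kappa>' z" "hs_T \<kappa>' z \<le> 1" "360 * (hs_T \<kappa>' z * sqrt (hs_T \<kappa>' z)) \<le> 1"
    and T'': "1 / real n \<le> hs_T \<kappa>'' z" "hs_T \<kappa>'' z \<le> 1" "360 * (hs_T \<kappa>'' z * sqrt (hs_T \<kappa>'' z)) \<le> 1"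
    and \<eta>: "\<eta> \<le> 1" "360 * (\<eta> * sqrt \<eta>) \<le> 1" "hs_T \<kappa>'' z \<le> \<eta>"
    and err': "720 * sqrt (hs_T \<kappa>' z) < (1 - \<kappa>1 / \<kappa>') * \<epsilon>' / z"
    and err'': "720 * sqrt \<eta> < (1 - \<kappa>'' / \<kappa>2) * \<epsilon>'' / z"
    and S': "\<epsilon>' * real n / z \<le> (\<Sum>i<n. hs_score (hs_T \<kappa>' z) (x i))"
    and S'': "(\<Sum>i<n. hs_score (hs_T \<kappa>'' z) (x i)) \<le> - (\<epsilon>'' * real n / z)"
    and large: "\<And>\<tau>. \<tau> \<in> {\<eta>..1} \<Longrightarrow> hs_loglik n x \<tau> < hs_loglik n x (hs_T \<kappa>'' z)"
    and \<tau>: "\<tau> \<in> {1 / real n..1}"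
    and max: "\<And>t. t \<in> {1 / real n..1} \<Longrightarrow> hs_loglik n x t \<le> hs_loglik n x \<tau>"
  shows "\<tau> \<in> {hs_T \<kappa>1 z..hs_T \<kappa>2 z}"
proof -
  have rn: "0 < 1 / real n" "0 < real n" using n by simp_all
  have \<tau>0: "0 < \<tau>" "\<tau> \<le> 1" using \<tau> less_le_trans[OF rn(1)] by auto
  have scale: "hs_T a z = a / c * hs_T c z" if "c \<noteq> 0" for a c using that by (simp add: hs_T_def)
  have mono32: "360 * (t * sqrt t) \<le> 1" if "0 < t" "t \<le> u" "360 * (u * sqrt u) \<le> 1" for t u :: real
  proof -
    have "t * sqrt t \<le> u * sqrt u" using that by (intro mult_mono) auto
    then show ?thesis using that(3) by linarith
  qed
  have up: "\<tau> \<le> hs_T \<kappa>2 z"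
  proof (rule ccontr)
    assume "\<not> \<tau> \<le> hs_T \<kappa>2 z"
    then have gt: "hs_T \<kappa>2 z < \<tau>" by simp
    define T where "T = hs_T \<kappa>'' z"
    have T: "0 < T" "T \<le> 1" "360 * (T * sqrt T) \<le> 1" using T'' less_le_trans[OF rn(1)] by (auto simp: T_def)
    \<comment> \<open>Values from \<eta> upwards lose strictly against T, so from here on \<tau>
      lies in the range of the linearisation.\<close>
    have \<tau>\<eta>: "\<tau> < \<eta>"
      using large[of \<tau>] max[of T] T''(1,2) \<tau>0 by (force simp: T_def)
    have r32: "360 * (\<tau> * sqrt \<tau>) \<le> 1" using mono32[OF \<tau>0(1) less_imp_le[OF \<tau>\<eta>] \<eta>(2)] .
    \<comment> \<open>\<tau> exceeds \<open>hs_T \<kappa>2 z\<close>, hence T <=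
      (\<kappa>''/\<kappa>2) \<tau> and \<tau> - T >= d \<tau>. The gain being proportional to
      \<tau>, the comparison reduces to sqrt \<tau> against 1/z, and the single bound at \<eta>
      covers all smaller \<tau>.\<close>
    define d where "d = 1 - \<kappa>'' / \<kappa>2"
    have d: "0 < d" using \<kappa> by (simp add: d_def)
    have "T = \<kappa>'' / \<kappa>2 * hs_T \<kappa>2 z" unfolding T_def using \<kappa> by (intro scale) auto
    also have "\<dots> \<le> \<kappa>'' / \<kappa>2 * \<tau>" using gt \<kappa> by (intro mult_left_mono) auto
    finally have dT: "d * \<tau> \<le> \<tau> - T" by (simp add: d_def algebra_simps)
    have dtau: "0 < d * \<tau>" using d \<tau>0 by simp
    have "(\<tau> - T) * (\<Sum>i<n. hs_score T (x i)) \<le> (\<tau> - T) * (- (\<epsilon>'' * real n / z))"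
      using S'' dT dtau unfolding T_def by (intro mult_left_mono) auto
    also have "\<dots> \<le> (d * \<tau>) * (- (\<epsilon>'' * real n / z))"
      using dT \<epsilon> z by (intro mult_right_mono_neg) auto
    finally have 1: "(\<tau> - T) * (\<Sum>i<n. hs_score T (x i)) \<le> (d * \<tau>) * (- (\<epsilon>'' * real n / z))" .
    have "T * sqrt T \<le> \<tau> * sqrt \<tau>" using dT dtau T by (intro mult_mono) auto
    then have "real n * (360 * (\<tau> * sqrt \<tau>) + 360 * (T * sqrt T)) \<le> real n * (\<tau> * (720 * sqrt \<tau>))"
      by (intro mult_left_mono) auto
    also have "\<dots> < real n * (\<tau> * (d * \<epsilon>'' / z))"
    proof -
      have "720 * sqrt \<tau> \<le> 720 * sqrt \<eta>" using \<tau>\<eta> by simp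
      then have "720 * sqrt \<tau> < d * \<epsilon>'' / z" unfolding d_def using err'' by (rule le_less_trans)
      then show ?thesis using rn \<tau>0 by (intro mult_strict_left_mono) auto
    qed
    finally have 2: "real n * (360 * (\<tau> * sqrt \<tau>) + 360 * (T * sqrt T)) < real n * (\<tau> * (d * \<epsilon>'' / z))" .
    have "(d * \<tau>) * (- (\<epsilon>'' * real n / z)) = - (real n * (\<tau> * (d * \<epsilon>'' / z)))" by simp
    then have "hs_loglik n x \<tau> - hs_loglik n x T < 0"
      using hs_loglik_tangent[OF T \<tau>0 r32, of n x] 1 2 by linarith
    then show False using max[of T] T''(1,2) by (simp add: T_def)
  qed
  have low: "hs_T \<kappa>1 z \<le> \<tau>"
  proof (rule ccontr)
    assume "\<not> hs_T \<kappa>1 z \<le> \<tau>"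
    then have lt: "\<tau> < hs_T \<kappa>1 z" by simp
    define T where "T = hs_T \<kappa>' z"
    have T: "0 < T" "T \<le> 1" "360 * (T * sqrt T) \<le> 1" using T' less_le_trans[OF rn(1)] by (auto simp: T_def)
    \<comment> \<open>Here T is the larger value: T - \<tau> >= d T, and both error terms are
      bounded by T^(3/2).\<close>
    define d where "d = 1 - \<kappa>1 / \<kappa>'"
    have d: "0 < d" using \<kappa> by (simp add: d_def)
    have "\<tau> \<le> \<kappa>1 / \<kappa>' * T" unfolding T_def using lt \<kappa> scale[of \<kappa>' \<kappa>1] by auto
    then have dT: "d * T \<le> T - \<tau>" by (simp add: d_def algebra_simps)
    have dpos: "0 < d * T" using d T by simp
    have r32: "360 * (\<tau> * sqrt \<tau>) \<le> 1" using mono32[OF \<tau>0(1) _ T(3)] dT dpos by simp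
    have "(d * T) * (\<epsilon>' * real n / z) \<le> (T - \<tau>) * (\<epsilon>' * real n / z)"
      using dT \<epsilon> z by (intro mult_right_mono) auto
    also have "\<dots> \<le> (T - \<tau>) * (\<Sum>i<n. hs_score T (x i))"
      using S' dT dpos unfolding T_def by (intro mult_left_mono) auto
    also have "\<dots> = - ((\<tau> - T) * (\<Sum>i<n. hs_score T (x i)))" by (simp add: algebra_simps)
    finally have 1: "(\<tau> - T) * (\<Sum>i<n. hs_score T (x i)) \<le> - ((d * T) * (\<epsilon>' * real n / z))" by simp
    have "\<tau> * sqrt \<tau> \<le> T * sqrt T" using dT dpos \<tau>0 by (intro mult_mono) auto
    then have "real n * (360 * (\<tau> * sqrt \<tau>) + 360 * (T * sqrt T)) \<le> real n * (T * (720 * sqrt T))"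
      by (intro mult_left_mono) auto
    also have "\<dots> < real n * (T * (d * \<epsilon>' / z))"
      using err' rn T unfolding d_def T_def by (intro mult_strict_left_mono) auto
    finally have 2: "real n * (360 * (\<tau> * sqrt \<tau>) + 360 * (T * sqrt T)) < real n * (T * (d * \<epsilon>' / z))" .
    have 3: "(d * T) * (\<epsilon>' * real n / z) = real n * (T * (d * \<epsilon>' / z))" by simp
    have "A < 0" if "A \<le> P + Q" "P \<le> - E" "Q < F" "E = F" for A P Q E F :: real
      using that by linarith
    from this[OF hs_loglik_tangent[OF T \<tau>0 r32, of n x] 1 2 3]
    have "hs_loglik n x \<tau> - hs_loglik n x T < 0" .
    then show False using max[of T] T'(1,2) by (simp add: T_def)
  qed
  show ?thesis using up low by simp
qed

text \<open>With \<eta> = 1/z^4 the affinity gain is c n/z^8, a quarter of which pays for the grid.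
  The losses to the signals and to T are n exp(-z^2/2) times polynomials in z, hence
  negligible.\<close>

lemma large_tau_exponent:
  assumes c: "0 < c" and \<kappa>: "0 < \<kappa>"
  shows "\<forall>\<^sub>F z in at_top. \<forall>n s. 1 \<le> s \<longrightarrow> s \<le> n \<longrightarrow> exp (- z\<^sup>2 / 2) = real s / real n \<longrightarrow>
     - (real (n - s) * c * (1 / z ^ 4)\<^sup>2) + (real n * c * (1 / z ^ 4)\<^sup>2 / 4 + real s * ln (1 / hs_T \<kappa> z) / 2 + real n * hs_T \<kappa> z)
     \<le> - (exp (z\<^sup>2 / 2) * (c / (4 * z ^ 8)))"
proof -
  have "((\<lambda>z. exp (- z\<^sup>2 / 2) * c + z ^ 8 * (exp (- z\<^sup>2 / 2) * ln (1 / (\<kappa> * z * exp (- z\<^sup>2 / 2))) / 2 + \<kappa> * z * exp (- z\<^sup>2 / 2))) \<longlongrightarrow> 0) at_top"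
    using c \<kappa> by real_asymp
  then have "\<forall>\<^sub>F z in at_top. exp (- z\<^sup>2 / 2) * c + z ^ 8 * (exp (- z\<^sup>2 / 2) * ln (1 / hs_T \<kappa> z) / 2 + hs_T \<kappa> z) < c / 2"
    unfolding hs_T_def by (rule order_tendstoD) (use c in simp)
  then show ?thesis using eventually_gt_at_top[of 0]
  proof eventually_elim
    case (elim z)
    define T where "T = hs_T \<kappa> z"
    define L where "L = ln (1 / T)"
    define e where "e = exp (- z\<^sup>2 / 2)"
    define W where "W = z ^ 8 * (e * L / 2 + T)"
    have W: "e * c + W < c / 2"
      using elim(1) unfolding T_def[symmetric] L_def[symmetric] e_def[symmetric] W_def .
    have z: "0 < z ^ 8" using elim by simp
    show ?case
    proof (intro allI impI)
      fix n s :: nat assume s: "1 \<le> s" "s \<le> n" and es: "exp (- z\<^sup>2 / 2) = real s / real n"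
      have n: "0 < real n" using s by simp
      have sn: "real s = e * real n" using es n by (simp add: e_def)
      have z8: "(1 / z ^ 4)\<^sup>2 = 1 / z ^ 8" by (simp add: power_divide flip: power_mult)
      have "- (real (n - s) * c * (1 / z ^ 4)\<^sup>2) + (real n * c * (1 / z ^ 4)\<^sup>2 / 4 + real s * L / 2 + real n * T)
        = real n / z ^ 8 * (e * c + W - c * (3 / 4))"
        unfolding z8 of_nat_diff[OF s(2)] sn W_def using z by (simp add: field_simps)
      also have "\<dots> \<le> real n / z ^ 8 * (- (c / 4))"
        using W z n by (intro mult_left_mono) auto
      also have "\<dots> \<le> exp (z\<^sup>2 / 2) / z ^ 8 * (- (c / 4))"
      \<comment> \<open>Since s >= 1 and n/s = exp(z^2/2), n is at least exp(z^2/2). The coefficient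
        -c/4 is negative, so this replaces n and leaves a bound in z alone.\<close>
      proof (intro mult_right_mono_neg divide_right_mono)
        have "exp (z\<^sup>2 / 2) * e = 1" unfolding e_def exp_add[symmetric] by simp
        then have "exp (z\<^sup>2 / 2) * real s = real n" unfolding sn by (simp add: mult.assoc[symmetric])
        moreover have "exp (z\<^sup>2 / 2) * 1 \<le> exp (z\<^sup>2 / 2) * real s" using s by (intro mult_left_mono) auto
        ultimately show "exp (z\<^sup>2 / 2) \<le> real n" by simp
      qed (use c z in auto)
      finally show "- (real (n - s) * c * (1 / z ^ 4)\<^sup>2) + (real n * c * (1 / z ^ 4)\<^sup>2 / 4 + real s * ln (1 / hs_T \<kappa> z) / 2 + real n * hs_T \<kappa> z)
        \<le> - (exp (z\<^sup>2 / 2) * (c / (4 * z ^ 8)))"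
        by (simp add: L_def T_def)
    qed
  qed
qed

theorem proposition3:
  fixes b \<delta> :: real and s :: "nat \<Rightarrow> nat"
    and tau_hat :: "nat \<Rightarrow> (nat \<Rightarrow> real) \<Rightarrow> real"
  assumes "\<delta> > 0"
    and "\<And>n. n \<ge> 1 \<Longrightarrow> 1 \<le> s n \<and> s n \<le> n"
    and "filterlim s at_top sequentially"
    and "(\<lambda>n. real (s n) / real n) \<longlonglongrightarrow> 0"
    and "\<And>n. n \<ge> 1 \<Longrightarrow> is_mmle n (tau_hat n)"
  shows "\<exists>e1 e2 :: nat \<Rightarrow> real. e1 \<longlonglongrightarrow> 0 \<and> e2 \<longlonglongrightarrow> 0 \<and>
    (\<lambda>n. SUP \<theta>\<in>sparse_class n (s n) b.
       measure (sample_law n \<theta>)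
         {x \<in> space (sample_law n \<theta>).
            tau_hat n x \<notin>
              {real (s n) / real n * zeta n (s n) * (cdf std_normal_distribution (b - \<delta>) / C_star) * (1 + e1 n)
               .. real (s n) / real n * zeta n (s n) * (cdf std_normal_distribution (b + \<delta>) / C_star) * (1 + e2 n)}})
    \<longlonglongrightarrow> 0"
proof -
  define z where "z = (\<lambda>n. zeta n (s n))"
  define \<kappa>1 where "\<kappa>1 = cdf N01 (b - \<delta>) / C_star"
  define \<kappa>2 where "\<kappa>2 = cdf N01 (b + \<delta>) / C_star"
  define \<kappa>0 where "\<kappa>0 = cdf N01 b / C_star"
  \<comment> \<open>Midpoints leave room on both sides: towards \<kappa>0 so that the limiting score
    is nonzero, towards the endpoint of the interval so that the linear gain has a fixed relative
    length.\<close>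
  define \<kappa>' where "\<kappa>' = (\<kappa>1 + \<kappa>0) / 2"
  define \<kappa>'' where "\<kappa>'' = (\<kappa>0 + \<kappa>2) / 2"
  have C: "0 < C_star" by (simp add: C_star_def)
  interpret N: prob_space N01 by (rule prob_space_N01)
  have k1: "0 \<le> \<kappa>1" using C by (simp add: \<kappa>1_def cdf_def)
  have k10: "\<kappa>1 < \<kappa>0" unfolding \<kappa>1_def \<kappa>0_def
    using strict_mono_cdf_N01[of "b - \<delta>" b] assms(1) C by (intro divide_strict_right_mono) auto
  have k02: "\<kappa>0 < \<kappa>2" unfolding \<kappa>2_def \<kappa>0_def
    using strict_mono_cdf_N01[of b "b + \<delta>"] assms(1) C by (intro divide_strict_right_mono) auto
  have k': "\<kappa>1 < \<kappa>'" "\<kappa>' < \<kappa>0" "0 < \<kappa>'" using k1 k10 by (auto simp: \<kappa>'_def)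
  have k'': "\<kappa>0 < \<kappa>''" "\<kappa>'' < \<kappa>2" "0 < \<kappa>''" using k1 k10 k02 by (auto simp: \<kappa>''_def)
  define \<mu>' where "\<mu>' = cdf N01 b / \<kappa>' - C_star"
  define \<mu>'' where "\<mu>'' = cdf N01 b / \<kappa>'' - C_star"
  have cdf0: "cdf N01 b = \<kappa>0 * C_star" using C by (simp add: \<kappa>0_def)
  have "\<mu>' = C_star * (\<kappa>0 / \<kappa>' - 1)" by (simp add: \<mu>'_def cdf0 right_diff_distrib)
  moreover have "1 < \<kappa>0 / \<kappa>'" using k' by simp
  ultimately have \<mu>': "0 < \<mu>'" using C by simp
  have "\<mu>'' = - (C_star * (1 - \<kappa>0 / \<kappa>''))" by (simp add: \<mu>''_def cdf0 right_diff_distrib)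
  moreover have "\<kappa>0 / \<kappa>'' < 1" using k'' by simp
  ultimately have \<mu>'': "\<mu>'' < 0" using C by simp
  \<comment> \<open>Half of the limiting normalised score: a deviation smaller than this preserves
    its sign and leaves a margin of the same size.\<close>
  define \<epsilon>' where "\<epsilon>' = \<mu>' / 2"
  define \<epsilon>'' where "\<epsilon>'' = - \<mu>'' / 2"
  have \<epsilon>: "0 < \<epsilon>'" "0 < \<epsilon>''" using \<mu>' \<mu>'' by (auto simp: \<epsilon>'_def \<epsilon>''_def)
  obtain p1 where p1: "p1 \<longlonglongrightarrow> 0" "\<forall>\<^sub>F n in sequentially. \<forall>\<theta>\<in>sparse_class n (s n) b.
    measure (PN n) {\<omega> \<in> space (PN n). \<epsilon>' \<le> \<bar>z n / real n * (\<Sum>i<n. hs_score (hs_T \<kappa>' (z n)) (\<theta> i + \<omega> i)) - \<mu>'\<bar>} \<le> p1 n"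
    using hs_score_concentration[OF k'(3) \<epsilon>(1) assms(2-4), of b] unfolding z_def \<mu>'_def by blast
  obtain p2 where p2: "p2 \<longlonglongrightarrow> 0" "\<forall>\<^sub>F n in sequentially. \<forall>\<theta>\<in>sparse_class n (s n) b.
    measure (PN n) {\<omega> \<in> space (PN n). \<epsilon>'' \<le> \<bar>z n / real n * (\<Sum>i<n. hs_score (hs_T \<kappa>'' (z n)) (\<theta> i + \<omega> i)) - \<mu>''\<bar>} \<le> p2 n"
    using hs_score_concentration[OF k''(3) \<epsilon>(2) assms(2-4), of b] unfolding z_def \<mu>''_def by blast
  obtain c :: real where c: "0 < c" "c \<le> 1" and large:
    "\<And>n T \<eta> \<theta>. 0 < \<eta> \<Longrightarrow> \<eta> \<le> 1 \<Longrightarrow> 0 < T \<Longrightarrow> T \<le> \<eta> \<Longrightarrow> T \<le> 1 / 2 \<Longrightarrow> 540 * sqrt T \<le> 1 \<Longrightarrow>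
      \<exists>B\<in>sets (PN n). (\<forall>\<omega>\<in>space (PN n) - B. \<forall>\<tau>\<in>{\<eta>..1}. hs_loglik n (\<lambda>i. \<theta> i + \<omega> i) \<tau> < hs_loglik n (\<lambda>i. \<theta> i + \<omega> i) T) \<and>
        measure (PN n) B \<le> (2 / (c * \<eta> ^ 3) + 2) *
          exp (- (real (n - card (support n \<theta>)) * c * \<eta>\<^sup>2) + (real n * c * \<eta>\<^sup>2 / 4 + real (card (support n \<theta>)) * ln (1 / T) / 2 + real n * T))"
    by (rule hs_loglik_large_tau) blast
  define p3 where "p3 = (\<lambda>z::real. (2 / (c * (1 / z ^ 4) ^ 3) + 2) * exp (- (exp (z\<^sup>2 / 2) * (c / (4 * z ^ 8)))))"
  have zlim: "filterlim z at_top sequentially" unfolding z_def by (rule zeta_at_top[OF assms(2,4)])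
  have "(p3 \<longlongrightarrow> 0) at_top" unfolding p3_def using c by real_asymp
  then have p3: "(\<lambda>n. p3 (z n)) \<longlonglongrightarrow> 0" by (rule filterlim_compose[OF _ zlim])
  \<comment> \<open>The numerical conditions on z: the search range contains both inner points, the
    class is nonempty, the linearisation is valid up to 1/z^4, and its errors stay below the score
    margins.\<close>
  define good where "good = (\<lambda>z. 0 < z \<and> 1 \<le> \<kappa>' * z \<and> 1 \<le> \<kappa>'' * z \<and> 0 < z + b \<and>
    hs_T \<kappa>' z \<le> 1 \<and> 360 * (hs_T \<kappa>' z * sqrt (hs_T \<kappa>' z)) \<le> 1 \<and>
    hs_T \<kappa>'' z \<le> 1 / 2 \<and> 360 * (hs_T \<kappa>'' z * sqrt (hs_T \<kappa>'' z)) \<le> 1 \<and> 540 * sqrt (hs_T \<kappa>'' z) \<le> 1 \<and>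
    1 / z ^ 4 \<le> 1 \<and> 360 * (1 / z ^ 4 * sqrt (1 / z ^ 4)) \<le> 1 \<and> hs_T \<kappa>'' z \<le> 1 / z ^ 4 \<and>
    720 * sqrt (hs_T \<kappa>' z) < (1 - \<kappa>1 / \<kappa>') * \<epsilon>' / z \<and>
    720 * sqrt (1 / z ^ 4) < (1 - \<kappa>'' / \<kappa>2) * \<epsilon>'' / z)"
  have "\<forall>\<^sub>F z in at_top. good z"
  proof -
    have d: "0 < (1 - \<kappa>1 / \<kappa>') * \<epsilon>'" "0 < (1 - \<kappa>'' / \<kappa>2) * \<epsilon>''" using k' k'' \<epsilon> by simp_all
    have "\<forall>\<^sub>F z in at_top. 0 < z \<and> 1 \<le> \<kappa>' * z \<and> 1 \<le> \<kappa>'' * z \<and> 0 < z + b"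
      using k'(3) k''(3) by (intro eventually_conj) real_asymp+
    moreover have "\<forall>\<^sub>F z in at_top. \<kappa>' * z * exp (- z\<^sup>2 / 2) \<le> 1 \<and>
        360 * ((\<kappa>' * z * exp (- z\<^sup>2 / 2)) * sqrt (\<kappa>' * z * exp (- z\<^sup>2 / 2))) \<le> 1"
      using k'(3) by (intro eventually_conj) real_asymp+
    moreover have "\<forall>\<^sub>F z in at_top. \<kappa>'' * z * exp (- z\<^sup>2 / 2) \<le> 1 / 2 \<and>
        360 * ((\<kappa>'' * z * exp (- z\<^sup>2 / 2)) * sqrt (\<kappa>'' * z * exp (- z\<^sup>2 / 2))) \<le> 1 \<and>
        540 * sqrt (\<kappa>'' * z * exp (- z\<^sup>2 / 2)) \<le> 1 \<and> \<kappa>'' * z * exp (- z\<^sup>2 / 2) \<le> 1 / z ^ 4"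
      using k''(3) by (intro eventually_conj) real_asymp+
    moreover have "\<forall>\<^sub>F z in at_top. 1 / z ^ 4 \<le> (1::real) \<and> 360 * (1 / z ^ 4 * sqrt (1 / z ^ 4)) \<le> (1::real)"
      by (intro eventually_conj) real_asymp+
    moreover have "\<forall>\<^sub>F z in at_top. 720 * sqrt (\<kappa>' * z * exp (- z\<^sup>2 / 2)) < D / z"  if "0 < D" for D :: real
      using that k'(3) by real_asymp
    moreover have "\<forall>\<^sub>F z in at_top. 720 * sqrt (1 / z ^ 4) < D / z" if "0 < D" for D :: real
      using that by real_asymp
    ultimately have "\<forall>\<^sub>F z in at_top. 0 < z \<and> 1 \<le> \<kappa>' * z \<and> 1 \<le> \<kappa>'' * z \<and> 0 < z + b"
      "\<forall>\<^sub>F z in at_top. \<kappa>' * z * exp (- z\<^sup>2 / 2) \<le> 1 \<and>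
        360 * ((\<kappa>' * z * exp (- z\<^sup>2 / 2)) * sqrt (\<kappa>' * z * exp (- z\<^sup>2 / 2))) \<le> 1"
      "\<forall>\<^sub>F z in at_top. \<kappa>'' * z * exp (- z\<^sup>2 / 2) \<le> 1 / 2 \<and>
        360 * ((\<kappa>'' * z * exp (- z\<^sup>2 / 2)) * sqrt (\<kappa>'' * z * exp (- z\<^sup>2 / 2))) \<le> 1 \<and>
        540 * sqrt (\<kappa>'' * z * exp (- z\<^sup>2 / 2)) \<le> 1 \<and> \<kappa>'' * z * exp (- z\<^sup>2 / 2) \<le> 1 / z ^ 4"
      "\<forall>\<^sub>F z in at_top. 1 / z ^ 4 \<le> (1::real) \<and> 360 * (1 / z ^ 4 * sqrt (1 / z ^ 4)) \<le> (1::real)"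
      "\<forall>\<^sub>F z in at_top. 720 * sqrt (\<kappa>' * z * exp (- z\<^sup>2 / 2)) < (1 - \<kappa>1 / \<kappa>') * \<epsilon>' / z"
      "\<forall>\<^sub>F z in at_top. 720 * sqrt (1 / z ^ 4) < (1 - \<kappa>'' / \<kappa>2) * \<epsilon>'' / z"
      using d by blast+
    then show ?thesis
      by eventually_elim (simp only: good_def hs_T_def simp_thms)
  qed
  then have ev_good: "\<forall>\<^sub>F n in sequentially. good (z n)"
    using filterlim_iff[THEN iffD1, OF zlim] by blast
  have ev_exp: "\<forall>\<^sub>F n in sequentially. \<forall>m k. 1 \<le> k \<longrightarrow> k \<le> m \<longrightarrow> exp (- (z n)\<^sup>2 / 2) = real k / real m \<longrightarrow>
     - (real (m - k) * c * (1 / z n ^ 4)\<^sup>2) + (real m * c * (1 / z n ^ 4)\<^sup>2 / 4 + real k * ln (1 / hs_T \<kappa>'' (z n)) / 2 + real m * hs_T \<kappa>'' (z n))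
     \<le> - (exp ((z n)\<^sup>2 / 2) * (c / (4 * z n ^ 8)))"
    using filterlim_iff[THEN iffD1, OF zlim, rule_format, OF large_tau_exponent[OF c(1) k''(3)]] .
  \<comment> \<open>The factors 1 + 0 match the statement with both sequences equal to 0; the strict
    monotonicity of the normal distribution function already provides the slack.\<close>
  let ?bad = "\<lambda>n x. tau_hat n x \<notin> {real (s n) / real n * zeta n (s n) * (cdf N01 (b - \<delta>) / C_star) * (1 + 0)
     .. real (s n) / real n * zeta n (s n) * (cdf N01 (b + \<delta>) / C_star) * (1 + 0)}"
  let ?P = "\<lambda>n \<theta>. measure (sample_law n \<theta>) {x \<in> space (sample_law n \<theta>). ?bad n x}"
  have main: "\<forall>\<^sub>F n in sequentially. sparse_class n (s n) b \<noteq> {} \<and>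
      (\<forall>\<theta>\<in>sparse_class n (s n) b. ?P n \<theta> \<le> p1 n + p2 n + p3 (z n))"
    using ev_good ev_exp p1(2) p2(2) eventually_ge_at_top[of 1]
  proof eventually_elim
    case (elim n)
    interpret P: prob_space "PN n" by (rule prob_space_PN)
    have n: "1 \<le> n" "0 < real n" and sn: "1 \<le> s n" "s n \<le> n" using elim assms(2)[of n] by auto
    have g: "0 < z n" "1 \<le> \<kappa>' * z n" "1 \<le> \<kappa>'' * z n" "0 < z n + b"
      "hs_T \<kappa>' (z n) \<le> 1" "360 * (hs_T \<kappa>' (z n) * sqrt (hs_T \<kappa>' (z n))) \<le> 1"
      "hs_T \<kappa>'' (z n) \<le> 1 / 2" "360 * (hs_T \<kappa>'' (z n) * sqrt (hs_T \<kappa>'' (z n))) \<le> 1" "540 * sqrt (hs_T \<kappa>'' (z n)) \<le> 1"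
      "1 / z n ^ 4 \<le> 1" "360 * (1 / z n ^ 4 * sqrt (1 / z n ^ 4)) \<le> 1" "hs_T \<kappa>'' (z n) \<le> 1 / z n ^ 4"
      "720 * sqrt (hs_T \<kappa>' (z n)) < (1 - \<kappa>1 / \<kappa>') * \<epsilon>' / z n"
      "720 * sqrt (1 / z n ^ 4) < (1 - \<kappa>'' / \<kappa>2) * \<epsilon>'' / z n"
      using elim(1) by (simp_all add: good_def)
    have es: "exp (- (z n)\<^sup>2 / 2) = real (s n) / real n" unfolding z_def by (rule zeta_exp(1)[OF sn])
    \<comment> \<open>The inner points are k z s/n, so k z >= 1 together with s >= 1 puts them above
      the lower end 1/n of the search range, where the maximality of the estimator can be tested
      against them.\<close>
    have Tge: "1 / real n \<le> hs_T k (z n)" if "1 \<le> k * z n" for k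
    proof -
      have "1 * 1 \<le> (k * z n) * real (s n)" using that sn by (intro mult_mono) auto
      then show ?thesis unfolding hs_T_def es using n by (simp add: divide_right_mono)
    qed
    have T''0: "0 < hs_T \<kappa>'' (z n)" using Tge[OF g(3)] n by (simp add: less_le_trans[of 0 "1 / real n"])
    have T''1: "hs_T \<kappa>'' (z n) \<le> 1" using g(7) by simp
    have \<eta>0: "0 < 1 / z n ^ 4" using g(1) by simp
    have mm: "is_mmle n (tau_hat n)" by (rule assms(5)[OF n(1)])
    have meas: "tau_hat n \<in> borel_measurable (PiM {..<n} (\<lambda>_. borel))" using mm by (simp add: is_mmle_def)
    have ends: "real (s n) / real n * zeta n (s n) * (cdf N01 (b - \<delta>) / C_star) * (1 + 0) = hs_T \<kappa>1 (z n)"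
      "real (s n) / real n * zeta n (s n) * (cdf N01 (b + \<delta>) / C_star) * (1 + 0) = hs_T \<kappa>2 (z n)"
      unfolding hs_T_def es \<kappa>1_def \<kappa>2_def by (simp_all add: z_def mult_ac)
    have "?P n \<theta> \<le> p1 n + p2 n + p3 (z n)" if \<theta>: "\<theta> \<in> sparse_class n (s n) b" for \<theta>
    proof -
      have card: "card (support n \<theta>) = s n" using \<theta> by (simp add: sparse_class_def)
      define B1 where "B1 = {\<omega> \<in> space (PN n). \<epsilon>' \<le> \<bar>z n / real n * (\<Sum>i<n. hs_score (hs_T \<kappa>' (z n)) (\<theta> i + \<omega> i)) - \<mu>'\<bar>}"
      define B2 where "B2 = {\<omega> \<in> space (PN n). \<epsilon>'' \<le> \<bar>z n / real n * (\<Sum>i<n. hs_score (hs_T \<kappa>'' (z n)) (\<theta> i + \<omega> i)) - \<mu>''\<bar>}"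
      obtain B3 where B3: "B3 \<in> sets (PN n)"
        "\<And>\<omega> \<tau>. \<omega> \<in> space (PN n) - B3 \<Longrightarrow> \<tau> \<in> {1 / z n ^ 4..1} \<Longrightarrow> hs_loglik n (\<lambda>i. \<theta> i + \<omega> i) \<tau> < hs_loglik n (\<lambda>i. \<theta> i + \<omega> i) (hs_T \<kappa>'' (z n))"
        "measure (PN n) B3 \<le> (2 / (c * (1 / z n ^ 4) ^ 3) + 2) *
          exp (- (real (n - s n) * c * (1 / z n ^ 4)\<^sup>2) + (real n * c * (1 / z n ^ 4)\<^sup>2 / 4 + real (s n) * ln (1 / hs_T \<kappa>'' (z n)) / 2 + real n * hs_T \<kappa>'' (z n)))"
        using large[OF \<eta>0 g(10) T''0 g(12) g(7) g(9), of n \<theta>] unfolding card by blast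
      have B12: "B1 \<in> sets (PN n)" "B2 \<in> sets (PN n)" unfolding B1_def B2_def by measurable
      have m1: "measure (PN n) B1 \<le> p1 n" unfolding B1_def using elim(3) \<theta> by blast
      have m2: "measure (PN n) B2 \<le> p2 n" unfolding B2_def using elim(4) \<theta> by blast
      have m3: "measure (PN n) B3 \<le> p3 (z n)"
      proof -
        have "- (real (n - s n) * c * (1 / z n ^ 4)\<^sup>2) + (real n * c * (1 / z n ^ 4)\<^sup>2 / 4 + real (s n) * ln (1 / hs_T \<kappa>'' (z n)) / 2 + real n * hs_T \<kappa>'' (z n))
          \<le> - (exp ((z n)\<^sup>2 / 2) * (c / (4 * z n ^ 8)))"
          using elim(2) sn es by blast
        then show ?thesis
          unfolding p3_def using c \<eta>0
          by (intro order_trans[OF B3(3)] mult_left_mono) (auto intro!: add_nonneg_nonneg divide_nonneg_nonneg)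
      qed
      have "?P n \<theta> = measure (PN n) {\<omega> \<in> space (PN n). ?bad n (\<lambda>i\<in>{..<n}. \<theta> i + \<omega> i)}"
        by (rule measure_sample_law) (use meas in measurable)
      also have "\<dots> \<le> measure (PN n) (B1 \<union> B2 \<union> B3)"
      proof (rule P.finite_measure_mono)
        show "{\<omega> \<in> space (PN n). ?bad n (\<lambda>i\<in>{..<n}. \<theta> i + \<omega> i)} \<subseteq> B1 \<union> B2 \<union> B3"
        proof (rule ccontr)
          assume "\<not> ?thesis"
          then obtain \<omega> where \<omega>: "\<omega> \<in> space (PN n)" "?bad n (\<lambda>i\<in>{..<n}. \<theta> i + \<omega> i)"
            "\<omega> \<notin> B1" "\<omega> \<notin> B2" "\<omega> \<notin> B3" by blast
          define x where "x = (\<lambda>i\<in>{..<n}. \<theta> i + \<omega> i)"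
          have x: "x \<in> space (PiM {..<n} (\<lambda>_. borel))" by (simp add: x_def space_PiM)
          have xi: "x i = \<theta> i + \<omega> i" if "i < n" for i using that by (simp add: x_def)
          define Y' where "Y' = (\<Sum>i<n. hs_score (hs_T \<kappa>' (z n)) (x i))"
          define Y'' where "Y'' = (\<Sum>i<n. hs_score (hs_T \<kappa>'' (z n)) (x i))"
          have "\<bar>z n / real n * Y' - \<mu>'\<bar> < \<epsilon>'" using \<omega>(1,3) by (simp add: B1_def Y'_def xi not_le)
          moreover have "\<epsilon>' \<le> A" if "\<bar>A - \<mu>'\<bar> < \<epsilon>'" for A
            using that unfolding \<epsilon>'_def by linarith
          ultimately have "\<epsilon>' \<le> z n / real n * Y'" by blast
          then have S': "\<epsilon>' * real n / z n \<le> Y'" using g(1) n by (simp add: field_simps)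
          have "\<bar>z n / real n * Y'' - \<mu>''\<bar> < \<epsilon>''" using \<omega>(1,4) by (simp add: B2_def Y''_def xi not_le)
          moreover have "A \<le> - \<epsilon>''" if "\<bar>A - \<mu>''\<bar> < \<epsilon>''" for A
            using that unfolding \<epsilon>''_def by linarith
          ultimately have "z n / real n * Y'' \<le> - \<epsilon>''" by blast
          then have S'': "Y'' \<le> - (\<epsilon>'' * real n / z n)" using g(1) n by (simp add: field_simps)
          have L: "hs_loglik n x \<tau> < hs_loglik n x (hs_T \<kappa>'' (z n))" if "\<tau> \<in> {1 / z n ^ 4..1}" for \<tau>
            using B3(2)[of \<omega> \<tau>] \<omega>(1,5) that hs_loglik_cong[of n x "\<lambda>i. \<theta> i + \<omega> i"] xi by simp
          have "tau_hat n x \<in> {hs_T \<kappa>1 (z n)..hs_T \<kappa>2 (z n)}"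
            by (rule mmle_location[OF n(1) g(1) k1 k'(1) k''(3,2) \<epsilon> Tge[OF g(2)] g(5,6) Tge[OF g(3)] T''1 g(8) g(10-14)
                S'[unfolded Y'_def] S''[unfolded Y''_def] L is_mmle_loglik[OF mm n(1) x]])
          then show False using \<omega>(2) unfolding ends x_def by simp
        qed
      qed (use B12 B3(1) in auto)
      also have "\<dots> \<le> measure (PN n) (B1 \<union> B2) + measure (PN n) B3"
        using B12 B3(1) by (intro measure_Un_le) auto
      also have "measure (PN n) (B1 \<union> B2) \<le> measure (PN n) B1 + measure (PN n) B2"
        using B12 by (intro measure_Un_le) auto
      finally show ?thesis using m1 m2 m3 by linarith
    qed
    moreover have "sparse_class n (s n) b \<noteq> {}"
      using sparse_class_nonempty[OF sn(2), of b] g(4) by (simp add: z_def)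
    ultimately show ?case by blast
  qed
  have "(\<lambda>n. SUP \<theta>\<in>sparse_class n (s n) b. ?P n \<theta>) \<longlonglongrightarrow> 0"
  proof (rule tendsto_sandwich[OF _ _ tendsto_const])
    show "\<forall>\<^sub>F n in sequentially. 0 \<le> (SUP \<theta>\<in>sparse_class n (s n) b. ?P n \<theta>)"
      using main
    proof eventually_elim
      case (elim n)
      then obtain \<theta> where \<theta>: "\<theta> \<in> sparse_class n (s n) b" by blast
      have "bdd_above ((\<lambda>\<theta>. ?P n \<theta>) ` sparse_class n (s n) b)" using elim by (intro bdd_aboveI2) blast
      then show ?case by (rule cSUP_upper2[OF _ \<theta>]) simp
    qed
    show "\<forall>\<^sub>F n in sequentially. (SUP \<theta>\<in>sparse_class n (s n) b. ?P n \<theta>) \<le> p1 n + p2 n + p3 (z n)"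
      using main by eventually_elim (intro cSUP_least, auto)
    show "(\<lambda>n. p1 n + p2 n + p3 (z n)) \<longlonglongrightarrow> 0"
      using tendsto_add[OF tendsto_add[OF p1(1) p2(1)] p3] by simp
  qed
  then show ?thesis
    by (intro exI[of _ "\<lambda>_. 0"] conjI tendsto_const)
qed

end
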